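(* Let $n\ge 2$, and let $\Gamma\le\mathrm{PSL}(n,\mathbb{R})$ be a Zariski-dense subgroup such that the canonical action $\Gamma\curvearrowright\mathbb{P}^{n-1}(\mathbb{R})$ is minimal. Then $\Gamma\curvearrowright\mathbb{P}^{n-1}(\mathbb{R})$ (that is, the induced action of the discrete group $\Gamma$ on $C(\mathbb{P}^{n-1}(\mathbb{R}))$) has the $\mathrm{PHP}$ property with respect to any state $\phi$ on $C(\mathbb{P}^{n-1}(\mathbb{R}))$.
   Context: The induced action on $C(X)$ of an action $G\curvearrowright X$ is $\alpha_g(f)(x)=f(g^{-1}x)$; an action is minimal if every orbit is dense. $\mathrm{PHP}$ property. Let $G$ be a discrete group, $A$ a unital $\mathrm{C}^*$-algebra and $\phi$ a state on $A$. A map $\alpha\colon G\to\mathrm{Aut}(A)$ has the $\mathrm{PHP}$ property with respect to $\phi$ if for every finite $F_A\subseteq A$, finite $F_G\subseteq G$, $N\in\mathbb{N}$ and $\varepsilon>0$, there exist $m\ge N$, $t_i\in G$ and $C_i\subseteq D_i\subseteq G$ for $1\le i\le m$ such that: (i) the subsets $\{gC_i: g\in F_G,\ i=1,\dots,m\}\cup\{ht_j^{-1}(G\setminus D_j): h\in F_G,\ j=1,\dots,m\}$ (as a family indexed by the pairs $(g,i)$ and $(h,j)$) are pairwise disjoint; (ii) $\sup_{g\in G}|\{i: g\in D_i\}\cup\{j: g\in t_j^{-1}(G\setminus C_j)\}|\le\varepsilon m^{1/2}$; (iii) $\max_{a\in F_A}\big\|\frac{1}{2m}\sum_{i=1}^m(\alpha_{t_i}(a)+\alpha_{t_i}^{-1}(a))-\phi(a)1_A\big\|<\varepsilon$.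 *)

theory Defs
  imports
    "HOL-Analysis.Analysis"
    "HOL-Algebra.Group_Action"
    "HOL-Library.Nonpos_Ints"
begin

section \<open>Unital C*-algebras, states, automorphisms\<close>

text \<open>
  Completeness and submultiplicativity of the norm come from the real superclasses. The axiom
  \<open>norm 1 = 1\<close> of \<^class>\<open>real_normed_algebra_1\<close> only excludes the zero algebra, which has no states.
\<close>

class unital_cstar_algebra = real_normed_algebra_1 + banach +
  fixes scaleC :: "complex \<Rightarrow> 'a \<Rightarrow> 'a"  (infixr "*\<^sub>C" 75)
    and cstar :: "'a \<Rightarrow> 'a"
  assumes scaleC_add_right: "c *\<^sub>C (x + y) = c *\<^sub>C x + c *\<^sub>C y"
    and scaleC_add_left: "(c + d) *\<^sub>C x = c *\<^sub>C x + d *\<^sub>C x"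
    and scaleC_scaleC: "c *\<^sub>C d *\<^sub>C x = (c * d) *\<^sub>C x"
    and scaleC_of_real: "complex_of_real r *\<^sub>C x = r *\<^sub>R x"
    and mult_scaleC_left: "(c *\<^sub>C x) * y = c *\<^sub>C (x * y)"
    and mult_scaleC_right: "x * (c *\<^sub>C y) = c *\<^sub>C (x * y)"
    and norm_scaleC: "norm (c *\<^sub>C x) = cmod c * norm x"
    and cstar_cstar: "cstar (cstar x) = x"
    and cstar_add: "cstar (x + y) = cstar x + cstar y"
    and cstar_scaleC: "cstar (c *\<^sub>C x) = cnj c *\<^sub>C cstar x"
    and cstar_mult: "cstar (x * y) = cstar y * cstar x"
    and norm_cstar_mult: "norm (cstar x * x) = (norm x)\<^sup>2"

definition cstar_state :: "('a::unital_cstar_algebra \<Rightarrow> complex) \<Rightarrow> bool" where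
  "cstar_state \<phi> \<longleftrightarrow>
     (\<forall>a b. \<phi> (a + b) = \<phi> a + \<phi> b) \<and> (\<forall>c a. \<phi> (c *\<^sub>C a) = c * \<phi> a) \<and>
     (\<forall>a. \<phi> (cstar a * a) \<in> \<real>\<^sub>\<ge>\<^sub>0) \<and> \<phi> 1 = 1"

definition cstar_automorphism :: "('a::unital_cstar_algebra \<Rightarrow> 'a) \<Rightarrow> bool" where
  "cstar_automorphism f \<longleftrightarrow>
     bij f \<and> (\<forall>a b. f (a + b) = f a + f b) \<and> (\<forall>c a. f (c *\<^sub>C a) = c *\<^sub>C f a) \<and>
     (\<forall>a b. f (a * b) = f a * f b) \<and> (\<forall>a. f (cstar a) = cstar (f a))"


section \<open>The PHP property\<close>

text \<open>
  The first conjunct says that \<open>\<alpha>\<close> takes values in the automorphism group. In the disjointness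
  condition \<open>Inl (g, i)\<close> indexes \<open>g C\<^sub>i\<close> and \<open>Inr (h, j)\<close> indexes \<open>h t\<^sub>j\<^sup>-\<^sup>1 (G - D\<^sub>j)\<close>.
  The real supremum is over cardinalities bounded by \<open>m\<close>, so it is a genuine one.
\<close>

definition PHP_property ::
  "('g, 'm) monoid_scheme \<Rightarrow> ('g \<Rightarrow> 'a::unital_cstar_algebra \<Rightarrow> 'a) \<Rightarrow> ('a \<Rightarrow> complex) \<Rightarrow> bool" where
  "PHP_property G \<alpha> \<phi> \<longleftrightarrow>
     (\<forall>g\<in>carrier G. cstar_automorphism (\<alpha> g)) \<and>
     (\<forall>F\<^sub>A F\<^sub>G (N::nat) (\<epsilon>::real).
        finite F\<^sub>A \<longrightarrow> finite F\<^sub>G \<longrightarrow> F\<^sub>G \<subseteq> carrier G \<longrightarrow> 0 < \<epsilon> \<longrightarrow>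
        (\<exists>m\<ge>N. \<exists>t C D.
           (\<forall>i\<in>{1..m}. t i \<in> carrier G \<and> C i \<subseteq> D i \<and> D i \<subseteq> carrier G) \<and>
           disjoint_family_on
             (case_sum (\<lambda>(g, i). g <#\<^bsub>G\<^esub> C i)
                       (\<lambda>(h, j). (h \<otimes>\<^bsub>G\<^esub> inv\<^bsub>G\<^esub> t j) <#\<^bsub>G\<^esub> (carrier G - D j)))
             ((F\<^sub>G \<times> {1..m}) <+> (F\<^sub>G \<times> {1..m})) \<and>
           (SUP g\<in>carrier G. real (card ({i\<in>{1..m}. g \<in> D i} \<union>
               {j\<in>{1..m}. g \<in> inv\<^bsub>G\<^esub> t j <#\<^bsub>G\<^esub> (carrier G - C j)}))) \<le> \<epsilon> * sqrt (real m) \<and>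
           (\<forall>a\<in>F\<^sub>A. norm ((1 / (2 * real m)) *\<^sub>R
                (\<Sum>i=1..m. \<alpha> (t i) a + inv_into UNIV (\<alpha> (t i)) a) - \<phi> a *\<^sub>C 1) < \<epsilon>)))"


section \<open>The algebra of continuous functions\<close>

text \<open>
  For compact \<open>X\<close> the type \<open>X \<Rightarrow>\<^sub>C complex\<close> of bounded continuous functions is \<open>C(X)\<close>; it carries the
  supremum norm and is given pointwise operations.
\<close>

instance bcontfun :: (topological_space, complete_space) complete_space
proof
  fix f :: "nat \<Rightarrow> ('a, 'b) bcontfun"
  assume "Cauchy f"
  then obtain g where "uniform_limit UNIV f g sequentially"
    using uniformly_convergent_eq_cauchy[of "\<lambda>_. True" f]
    unfolding Cauchy_def uniform_limit_sequentially_iff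
    by (metis dist_fun_lt_imp_dist_val_lt)
  from uniform_limit_bcontfunE[OF this sequentially_bot]
  obtain l' where "g = apply_bcontfun l'" "f \<longlonglongrightarrow> l'" by metis
  then show "convergent f"
    by (intro convergentI)
qed

instance bcontfun :: (topological_space, banach) banach ..

setup_lifting type_definition_bcontfun

instantiation bcontfun :: (topological_space, real_normed_algebra_1) real_normed_algebra_1
begin

lift_definition one_bcontfun :: "'a \<Rightarrow>\<^sub>C 'b" is "\<lambda>_. 1"
  by (rule const_bcontfun)

lift_definition times_bcontfun :: "('a \<Rightarrow>\<^sub>C 'b) \<Rightarrow> ('a \<Rightarrow>\<^sub>C 'b) \<Rightarrow> 'a \<Rightarrow>\<^sub>C 'b" is "\<lambda>f g x. f x * g x"
proof -
  fix f g :: "'a \<Rightarrow> 'b"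
  assume f: "f \<in> bcontfun" and g: "g \<in> bcontfun"
  obtain a b where a: "\<And>x. norm (f x) \<le> a" and b: "\<And>x. norm (g x) \<le> b"
    using f g by (auto simp: bcontfun_def bounded_iff)
  have "norm (f x * g x) \<le> a * b" for x
    by (rule order_trans[OF norm_mult_ineq mult_mono[OF a b order_trans[OF norm_ge_zero a]]]) simp
  with f g show "(\<lambda>x. f x * g x) \<in> bcontfun"
    by (intro bcontfun_normI) (auto simp: bcontfun_def intro!: continuous_intros)
qed

instance
proof
  fix f g h :: "'a \<Rightarrow>\<^sub>C 'b" and r :: real
  note [simp] = times_bcontfun.rep_eq one_bcontfun.rep_eq
  show "f * g * h = f * (g * h)" "(f + g) * h = f * h + g * h" "f * (g + h) = f * g + f * h"
    "1 * f = f" "f * 1 = f" "(r *\<^sub>R f) * g = r *\<^sub>R (f * g)" "f * (r *\<^sub>R g) = r *\<^sub>R (f * g)"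
    by (auto intro!: bcontfun_eqI simp: algebra_simps)
  show "(0 :: 'a \<Rightarrow>\<^sub>C 'b) \<noteq> 1"
  proof
    assume "(0 :: 'a \<Rightarrow>\<^sub>C 'b) = 1"
    then have "apply_bcontfun (0 :: 'a \<Rightarrow>\<^sub>C 'b) undefined = apply_bcontfun 1 undefined" by simp
    then show False by simp
  qed
  show "norm (f * g) \<le> norm f * norm g"
    by (rule norm_bound, simp)
      (rule order_trans[OF norm_mult_ineq mult_mono[OF norm_bounded norm_bounded]], simp_all)
  show "norm (1 :: 'a \<Rightarrow>\<^sub>C 'b) = 1"
    using norm_bounded[of "1 :: 'a \<Rightarrow>\<^sub>C 'b"]
    by (intro antisym norm_bound) auto
qed

end

instantiation complex :: unital_cstar_algebra
begin
definition "scaleC_complex (c::complex) (x::complex) = c * x"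
definition "cstar_complex = cnj"
instance
  by standard
    (auto simp: scaleC_complex_def cstar_complex_def algebra_simps norm_mult power2_eq_square
      scaleR_conv_of_real)
end

lemma norm_cstar: "norm (cstar x) = norm x" for x :: "'c::unital_cstar_algebra"
proof -
  have *: "norm y \<le> norm (cstar y)" for y :: 'c
  proof (cases "y = 0")
    case False
    have "norm y * norm y \<le> norm (cstar y) * norm y"
      using norm_mult_ineq[of "cstar y" y] by (simp add: norm_cstar_mult power2_eq_square)
    with False show ?thesis by simp
  qed simp
  from *[of x] *[of "cstar x"] show ?thesis
    by (simp add: cstar_cstar)
qed

lemma bounded_linear_scaleC: "bounded_linear ((*\<^sub>C) c :: 'c \<Rightarrow> 'c::unital_cstar_algebra)"
proof (rule bounded_linear_intro)
  fix x y :: 'c and r :: real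
  show "c *\<^sub>C (x + y) = c *\<^sub>C x + c *\<^sub>C y" by (rule scaleC_add_right)
  show "c *\<^sub>C r *\<^sub>R x = r *\<^sub>R c *\<^sub>C x"
    by (simp add: scaleC_scaleC mult.commute flip: scaleC_of_real)
  show "norm (c *\<^sub>C x) \<le> norm x * cmod c" by (simp add: norm_scaleC)
qed

lemma bounded_linear_cstar: "bounded_linear (cstar :: 'c \<Rightarrow> 'c::unital_cstar_algebra)"
proof (rule bounded_linear_intro)
  fix x y :: 'c and r :: real
  show "cstar (x + y) = cstar x + cstar y" by (rule cstar_add)
  show "cstar (r *\<^sub>R x) = r *\<^sub>R cstar x"
    by (simp add: cstar_scaleC flip: scaleC_of_real)
  show "norm (cstar x) \<le> norm x * 1" by (simp add: norm_cstar)
qed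

instantiation bcontfun :: (topological_space, unital_cstar_algebra) unital_cstar_algebra
begin

lift_definition scaleC_bcontfun :: "complex \<Rightarrow> ('a \<Rightarrow>\<^sub>C 'b) \<Rightarrow> 'a \<Rightarrow>\<^sub>C 'b" is "\<lambda>c f x. c *\<^sub>C f x"
  by (auto simp: bcontfun_def image_image
      intro!: bounded_linear.continuous_on[OF bounded_linear_scaleC]
      dest: bounded_linear_image[OF _ bounded_linear_scaleC])

lift_definition cstar_bcontfun :: "('a \<Rightarrow>\<^sub>C 'b) \<Rightarrow> 'a \<Rightarrow>\<^sub>C 'b" is "\<lambda>f x. cstar (f x)"
  by (auto simp: bcontfun_def image_image
      intro!: bounded_linear.continuous_on[OF bounded_linear_cstar]
      dest: bounded_linear_image[OF _ bounded_linear_cstar])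

instance
proof
  fix f g :: "'a \<Rightarrow>\<^sub>C 'b" and r :: real and c d :: complex
  note [simp] = times_bcontfun.rep_eq scaleC_bcontfun.rep_eq cstar_bcontfun.rep_eq
  show "c *\<^sub>C (f + g) = c *\<^sub>C f + c *\<^sub>C g" "(c + d) *\<^sub>C f = c *\<^sub>C f + d *\<^sub>C f"
    "c *\<^sub>C d *\<^sub>C f = (c * d) *\<^sub>C f" "complex_of_real r *\<^sub>C f = r *\<^sub>R f"
    "(c *\<^sub>C f) * g = c *\<^sub>C (f * g)" "f * (c *\<^sub>C g) = c *\<^sub>C (f * g)"
    "cstar (cstar f) = f" "cstar (f + g) = cstar f + cstar g"
    "cstar (c *\<^sub>C f) = cnj c *\<^sub>C cstar f" "cstar (f * g) = cstar g * cstar f"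
    by (auto intro!: bcontfun_eqI simp: scaleC_add_right scaleC_add_left scaleC_scaleC
        scaleC_of_real mult_scaleC_left mult_scaleC_right cstar_cstar cstar_add cstar_scaleC
        cstar_mult)
  have le: "norm (c *\<^sub>C f) \<le> cmod c * norm f" for c and f :: "'a \<Rightarrow>\<^sub>C 'b"
    by (rule norm_bound) (simp add: norm_scaleC mult_left_mono norm_bounded)
  show "norm (c *\<^sub>C f) = cmod c * norm f"
  proof (cases "c = 0")
    case True
    have "(0::complex) *\<^sub>C f = 0"
      using scaleC_of_real[of 0] by (intro bcontfun_eqI) simp
    with True show ?thesis by simp
  next
    case False
    have "inverse c *\<^sub>C c *\<^sub>C f = f"
      using False
      using scaleC_of_real[of 1] by (intro bcontfun_eqI) (simp add: scaleC_scaleC)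
    then have "norm f \<le> inverse (cmod c) * norm (c *\<^sub>C f)"
      using le[of "inverse c" "c *\<^sub>C f"] by (simp add: norm_inverse)
    with False le[of c f] show ?thesis
      by (simp add: field_simps)
  qed
  show "norm (cstar f * f) = (norm f)\<^sup>2"
  proof (rule antisym)
    show "norm (cstar f * f) \<le> (norm f)\<^sup>2"
      by (rule norm_bound) (simp add: norm_cstar_mult power_mono norm_bounded)
    have "norm (f x) \<le> sqrt (norm (cstar f * f))" for x
      using norm_bounded[of "cstar f * f" x] by (intro real_le_rsqrt) (simp add: norm_cstar_mult)
    then have "norm f \<le> sqrt (norm (cstar f * f))"
      by (rule norm_bound)
    then show "(norm f)\<^sup>2 \<le> norm (cstar f * f)"
      using power_mono[of "norm f" "sqrt (norm (cstar f * f))" 2] by simp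
  qed
qed

end

lifting_update bcontfun.lifting
lifting_forget bcontfun.lifting

lemmas bcontfun_cstar_apply [simp] =
  one_bcontfun.rep_eq times_bcontfun.rep_eq scaleC_bcontfun.rep_eq cstar_bcontfun.rep_eq


section \<open>Actions on spaces\<close>

definition minimal_action ::
  "('g, 'm) monoid_scheme \<Rightarrow> ('g \<Rightarrow> 'x \<Rightarrow> 'x::topological_space) \<Rightarrow> bool" where
  "minimal_action G act \<longleftrightarrow> (\<forall>x. closure (orbit G act x) = UNIV)"

text \<open>
  \<^const>\<open>Bcontfun\<close> is applied to a function that lies in \<open>bcontfun\<close> whenever the action is
  by continuous maps; see \<open>induced_action_apply\<close>.
\<close>

definition induced_action ::
  "('g, 'm) monoid_scheme \<Rightarrow> ('g \<Rightarrow> 'x \<Rightarrow> 'x) \<Rightarrow> 'g \<Rightarrow>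
    ('x::topological_space \<Rightarrow>\<^sub>C complex) \<Rightarrow> ('x \<Rightarrow>\<^sub>C complex)" where
  "induced_action G act g f = Bcontfun (\<lambda>x. apply_bcontfun f (act (inv\<^bsub>G\<^esub> g) x))"

lemma induced_action_apply:
  assumes "continuous_on UNIV (act (inv\<^bsub>G\<^esub> g))"
  shows "apply_bcontfun (induced_action G act g f) x = apply_bcontfun f (act (inv\<^bsub>G\<^esub> g) x)"
proof -
  have "continuous_on UNIV (\<lambda>x. apply_bcontfun f (act (inv\<^bsub>G\<^esub> g) x))"
    by (rule continuous_on_compose2[OF _ assms]) auto
  moreover have "bounded (range (\<lambda>x. apply_bcontfun f (act (inv\<^bsub>G\<^esub> g) x)))"
    by (rule bounded_subset[OF bounded_apply_bcontfun]) auto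
  ultimately show ?thesis
    by (simp add: induced_action_def Bcontfun_inverse bcontfun_def)
qed


section \<open>Real projective space\<close>

text \<open>
  The points of \<open>'n rproj\<close> are the lines through the origin of \<open>real ^ 'n\<close>; this is the projective
  space of dimension \<open>CARD('n) - 1\<close>.
\<close>

typedef 'n rproj = "{L :: (real ^ 'n::finite) set. subspace L \<and> dim L = 1}"
  morphisms line_of Abs_rproj
proof
  show "span {axis undefined 1} \<in> {L :: (real ^ 'n) set. subspace L \<and> dim L = 1}"
    by (simp add: dim_span dim_singleton axis_eq_0_iff)
qed

definition proj_point :: "real ^ 'n::finite \<Rightarrow> 'n rproj" where
  "proj_point v = Abs_rproj (span {v})"

lemma line_of_proj_point: "v \<noteq> 0 \<Longrightarrow> line_of (proj_point v) = span {v}"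
  by (simp add: proj_point_def Abs_rproj_inverse dim_span dim_singleton)

lemma proj_point_cases:
  obtains v where "v \<noteq> 0" "x = proj_point v"
proof -
  have L: "subspace (line_of x)" "dim (line_of x) = 1"
    using line_of[of x] by auto
  then obtain v where v: "v \<in> line_of x" "v \<noteq> 0"
    by (metis dim_eq_0 subsetI singletonI insertCI zero_neq_one)
  have "span {v} = line_of x"
    by (rule subspace_dim_equal) (use L v in \<open>auto simp: dim_span dim_singleton span_minimal\<close>)
  with v that[of v] show thesis
    by (simp add: proj_point_def line_of_inverse)
qed

text \<open>
  The quotient topology along \<open>proj_point\<close> on the nonzero vectors; these form an open subset of
  \<open>real ^ 'n\<close>, so openness in the subspace is openness in the whole space.
\<close>

instantiation rproj :: (finite) topological_space
begin

definition open_rproj :: "'a rproj set \<Rightarrow> bool" where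
  "open_rproj U \<longleftrightarrow> open {v. v \<noteq> 0 \<and> proj_point v \<in> U}"

instance
proof
  show "open (UNIV :: 'a rproj set)"
    by (simp add: open_rproj_def open_Collect_neq)
next
  fix S T :: "'a rproj set"
  assume "open S" "open T"
  moreover have "{v. v \<noteq> 0 \<and> proj_point v \<in> S \<inter> T} =
      {v. v \<noteq> 0 \<and> proj_point v \<in> S} \<inter> {v. v \<noteq> 0 \<and> proj_point v \<in> T}"
    by auto
  ultimately show "open (S \<inter> T)"
    by (simp only: open_rproj_def open_Int)
next
  fix K :: "'a rproj set set"
  assume "\<forall>S\<in>K. open S"
  moreover have "{v. v \<noteq> 0 \<and> proj_point v \<in> \<Union>K} = (\<Union>S\<in>K. {v. v \<noteq> 0 \<and> proj_point v \<in> S})"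
    by auto
  ultimately show "open (\<Union>K)"
    by (simp add: open_rproj_def open_UN)
qed

end

lemma continuous_on_proj_point: "continuous_on (- {0}) proj_point"
  unfolding continuous_on_open_vimage[OF open_delete[OF open_UNIV, of 0, folded Compl_eq_Diff_UNIV]]
proof (intro allI impI)
  fix U :: "'a rproj set"
  assume "open U"
  moreover have "proj_point -` U \<inter> - {0} = {v. v \<noteq> 0 \<and> proj_point v \<in> U}"
    by auto
  ultimately show "open (proj_point -` U \<inter> - {0})"
    by (simp add: open_rproj_def)
qed

lemma compact_rproj: "compact (UNIV :: 'n::finite rproj set)"
proof -
  have "x \<in> proj_point ` sphere 0 1" for x :: "'n rproj"
  proof -
    obtain v where v: "v \<noteq> 0" "x = proj_point v"
      by (rule proj_point_cases)
    then have "x = proj_point (v /\<^sub>R norm v)"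
      using span_image_scale[of "{v}" "\<lambda>_. inverse (norm v)"] by (simp add: proj_point_def)
    with v show ?thesis by (intro image_eqI[of _ _ "v /\<^sub>R norm v"]) auto
  qed
  then have "UNIV = (proj_point ` sphere 0 1 :: 'n rproj set)"
    by blast
  moreover have "compact (proj_point ` sphere 0 1 :: 'n rproj set)"
    by (intro compact_continuous_image continuous_on_subset[OF continuous_on_proj_point]) auto
  ultimately show ?thesis by simp
qed


section \<open>The projective special linear group\<close>

definition SL :: "(real ^ 'n::finite ^ 'n) monoid" where
  "SL = \<lparr>carrier = {A. det A = 1}, mult = (**), one = mat 1\<rparr>"

text \<open>The scalar matrices of determinant 1 form the centre of \<open>SL\<close>.\<close>

definition SL_scalars :: "(real ^ 'n::finite ^ 'n) set" where
  "SL_scalars = {A \<in> carrier SL. \<exists>c. A = mat c}"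

definition PSL :: "(real ^ 'n::finite ^ 'n) set monoid" where
  "PSL = SL Mod SL_scalars"

lemma group_SL: "group (SL :: (real ^ 'n::finite ^ 'n) monoid)"
proof (rule groupI)
  fix A :: "real ^ 'n ^ 'n"
  assume "A \<in> carrier SL"
  then have A: "det A = 1" by (simp add: SL_def)
  then obtain B where B: "B ** A = mat 1"
    using invertible_det_nz[of A] by (auto simp: invertible_def)
  with A have "det B = 1"
    using det_mul[of B A] by simp
  with B show "\<exists>B\<in>carrier SL. B \<otimes>\<^bsub>SL\<^esub> A = \<one>\<^bsub>SL\<^esub>"
    by (auto simp: SL_def)
qed (auto simp: SL_def det_mul matrix_mul_assoc)

lemma mat_mult_commute: "mat c ** A = A ** mat c" for A :: "real ^ 'n::finite ^ 'n"
  by (simp add: vec_eq_iff matrix_matrix_mult_def mat_def if_distrib[of "\<lambda>x. x * _"]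
      if_distrib[of "\<lambda>x. _ * x"] cong: if_cong)

lemma mat_mult_mat: "mat c ** mat d = (mat (c * d) :: real ^ 'n::finite ^ 'n)"
  by (simp add: vec_eq_iff matrix_matrix_mult_def mat_def if_distrib[of "\<lambda>x. x * _"]
      if_distrib[of "\<lambda>x. _ * x"] cong: if_cong)

lemma mat_vec_mult: "mat c *v v = c *\<^sub>R v" for v :: "real ^ 'n::finite"
  by (simp add: vec_eq_iff matrix_vector_mult_def mat_def if_distrib[of "\<lambda>x. x * _"] cong: if_cong)

lemma mat_SL_nonzero:
  assumes "(mat c :: real ^ 'n::finite ^ 'n) \<in> carrier SL"
  shows "c \<noteq> 0"
proof
  assume "c = 0"
  then have "det (mat c :: real ^ 'n ^ 'n) = 0"
    by (intro det_zero_row(2)[of undefined]) (simp add: row_def vec_eq_iff)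
  with assms show False by (simp add: SL_def)
qed

lemma normal_SL_scalars: "(SL_scalars :: (real ^ 'n::finite ^ 'n) set) \<lhd> SL"
proof -
  interpret group "SL :: (real ^ 'n ^ 'n) monoid" by (rule group_SL)
  have "subgroup SL_scalars (SL :: (real ^ 'n ^ 'n) monoid)"
  proof (rule subgroupI)
    have "mat 1 \<in> (SL_scalars :: (real ^ 'n ^ 'n) set)"
      by (auto simp: SL_scalars_def SL_def)
    then show "(SL_scalars :: (real ^ 'n ^ 'n) set) \<noteq> {}" by blast
  next
    fix A :: "real ^ 'n ^ 'n"
    assume A: "A \<in> SL_scalars"
    then obtain c where c: "A = mat c" "A \<in> carrier SL" by (auto simp: SL_scalars_def)
    then have "c \<noteq> 0" using mat_SL_nonzero by blast
    then have 1: "mat (inverse c) ** A = mat 1" by (simp add: c mat_mult_mat)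
    with c(2) have "det (mat (inverse c) :: real ^ 'n ^ 'n) = 1"
      using det_mul[of "mat (inverse c) :: real ^ 'n ^ 'n" A] by (simp add: SL_def)
    then have 2: "(mat (inverse c) :: real ^ 'n ^ 'n) \<in> carrier SL" by (simp add: SL_def)
    have "inv\<^bsub>SL\<^esub> A = mat (inverse c)"
      using 1 2 c(2) by (intro inv_equality) (auto simp: SL_def)
    with 2 show "inv\<^bsub>SL\<^esub> A \<in> SL_scalars" by (auto simp: SL_scalars_def)
  next
    fix A B :: "real ^ 'n ^ 'n"
    assume "A \<in> SL_scalars" "B \<in> SL_scalars"
    then show "A \<otimes>\<^bsub>SL\<^esub> B \<in> SL_scalars"
      by (auto simp: SL_scalars_def SL_def det_mul mat_mult_mat)
  qed (auto simp: SL_scalars_def)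
  moreover have "SL_scalars #>\<^bsub>SL\<^esub> A = A <#\<^bsub>SL\<^esub> SL_scalars" for A :: "real ^ 'n ^ 'n"
  proof -
    have "Z \<otimes>\<^bsub>SL\<^esub> A = A \<otimes>\<^bsub>SL\<^esub> Z" if "Z \<in> SL_scalars" for Z
      using that by (auto simp: SL_scalars_def SL_def mat_mult_commute)
    then show ?thesis by (auto simp: r_coset_def l_coset_def)
  qed
  ultimately show ?thesis by (auto intro: normalI)
qed

lemma group_PSL: "group (PSL :: (real ^ 'n::finite ^ 'n) set monoid)"
  unfolding PSL_def by (rule normal.factorgroup_is_group[OF normal_SL_scalars])

text \<open>
  The Zariski topology on \<open>PSL\<close> is the quotient of the Zariski topology on \<open>SL\<close>: the elements of
  \<open>PSL\<close> are cosets, so \<open>\<Union>S\<close> is the preimage of \<open>S\<close>, and \<^const>\<open>real_polynomial_function\<close> on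
  matrices means polynomial in the entries. It agrees with the topology given by polynomials
  invariant under the scalars (replace \<open>p\<close> by \<open>p\<^sup>2 + q\<^sup>2\<close>, where \<open>q A = p (- A)\<close>), that is, with the
  one \<open>PSL\<close> inherits from the algebraic group \<open>PGL\<close>.
\<close>

definition zariski_closed_PSL :: "(real ^ 'n::finite ^ 'n) set set \<Rightarrow> bool" where
  "zariski_closed_PSL S \<longleftrightarrow> S \<subseteq> carrier PSL \<and>
     (\<exists>P. (\<forall>p\<in>P. real_polynomial_function p) \<and> \<Union>S = {A \<in> carrier SL. \<forall>p\<in>P. p A = 0})"

definition zariski_dense_PSL :: "(real ^ 'n::finite ^ 'n) set set \<Rightarrow> bool" where
  "zariski_dense_PSL \<Gamma> \<longleftrightarrow> \<Inter>{S. zariski_closed_PSL S \<and> \<Gamma> \<subseteq> S} = carrier PSL"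

text \<open>
  All representatives \<open>A\<close> of a class map a given line onto the same line, which is the union below;
  see \<open>PSL_action_coset\<close>.
\<close>

definition PSL_action :: "(real ^ 'n::finite ^ 'n) set \<Rightarrow> 'n rproj \<Rightarrow> 'n rproj" where
  "PSL_action g x = Abs_rproj (\<Union>A\<in>g. (*v) A ` line_of x)"

lemma SL_mult_nonzero:
  fixes A :: "real ^ 'n::finite ^ 'n"
  assumes "A \<in> carrier SL" "v \<noteq> 0"
  shows "A *v v \<noteq> 0"
proof
  obtain B where "B ** A = mat 1"
    using assms(1) invertible_det_nz[of A] by (auto simp: SL_def invertible_def)
  moreover assume "A *v v = 0"
  ultimately show False
    using assms(2) by (metis matrix_vector_mul_assoc matrix_vector_mul_lid matrix_vector_mult_0_right)
qed

lemma PSL_action_coset: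
  fixes A :: "real ^ 'n::finite ^ 'n"
  assumes A: "A \<in> carrier SL" and v: "v \<noteq> 0"
  shows "PSL_action (SL_scalars #>\<^bsub>SL\<^esub> A) (proj_point v) = proj_point (A *v v)"
proof -
  have *: "(*v) B ` span {v} = span {B *v v}" for B :: "real ^ 'n ^ 'n"
    by (simp add: linear_span_image[symmetric] matrix_vector_mul_linear)
  have "(*v) B ` span {v} = span {A *v v}" if B: "B \<in> SL_scalars #>\<^bsub>SL\<^esub> A" for B
  proof -
    obtain c where c: "B = mat c ** A" "mat c \<in> (carrier SL :: (real ^ 'n ^ 'n) set)"
      using B by (auto simp: r_coset_def SL_scalars_def SL_def)
    then have "c \<noteq> 0" using mat_SL_nonzero by blast
    moreover have "B *v v = c *\<^sub>R (A *v v)"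
      by (simp add: c mat_vec_mult flip: matrix_vector_mul_assoc)
    moreover have "span {c *\<^sub>R (A *v v)} = span {A *v v}"
      using span_image_scale[of "{A *v v}" "\<lambda>_. c"] \<open>c \<noteq> 0\<close> by simp
    ultimately show ?thesis
      by (simp only: *)
  qed
  moreover have "A \<in> SL_scalars #>\<^bsub>SL\<^esub> A"
    using A normal_SL_scalars group.rcos_self[OF group_SL] normal_imp_subgroup by blast
  ultimately have "(\<Union>B\<in>SL_scalars #>\<^bsub>SL\<^esub> A. (*v) B ` span {v}) = span {A *v v}"
    by (intro SUP_eq_const) auto
  then show ?thesis
    by (simp add: PSL_action_def line_of_proj_point v proj_point_def[of "A *v v"])
qed

lemma PSL_cases:
  assumes "g \<in> carrier PSL"
  obtains A where "A \<in> carrier SL" "g = SL_scalars #>\<^bsub>SL\<^esub> A"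
  using assms by (auto simp: PSL_def FactGroup_def RCOSETS_def)

lemma continuous_on_PSL_action:
  assumes "g \<in> carrier PSL"
  shows "continuous_on UNIV (PSL_action g)"
proof -
  obtain A where A: "A \<in> carrier SL" "g = SL_scalars #>\<^bsub>SL\<^esub> A"
    using PSL_cases[OF assms] .
  have "open (PSL_action g -` U)" if "open U" for U
  proof -
    have "{v. v \<noteq> 0 \<and> proj_point v \<in> PSL_action g -` U} =
        (*v) A -` {v. v \<noteq> 0 \<and> proj_point v \<in> U}"
    proof (rule Set.set_eqI)
      fix v
      have "A *v v \<noteq> 0 \<longleftrightarrow> v \<noteq> 0"
        using SL_mult_nonzero[OF A(1), of v] by auto
      moreover have "PSL_action g (proj_point v) = proj_point (A *v v)" if "v \<noteq> 0"
        unfolding A(2) by (rule PSL_action_coset[OF A(1) that])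
      ultimately show "v \<in> {v. v \<noteq> 0 \<and> proj_point v \<in> PSL_action g -` U} \<longleftrightarrow>
          v \<in> (*v) A -` {v. v \<noteq> 0 \<and> proj_point v \<in> U}"
        by auto
    qed
    moreover have "open ((*v) A -` {v. v \<noteq> 0 \<and> proj_point v \<in> U})"
      using that by (intro open_vimage matrix_vector_mult_linear_continuous_on)
        (simp add: open_rproj_def)
    ultimately show ?thesis
      by (simp only: open_rproj_def)
  qed
  then show ?thesis
    by (simp add: continuous_on_open_vimage)
qed

lemma PSL_action_mult:
  assumes "g \<in> carrier PSL" "h \<in> carrier PSL"
  shows "PSL_action (g \<otimes>\<^bsub>PSL\<^esub> h) x = PSL_action g (PSL_action h x)"
proof -
  obtain A where A: "A \<in> carrier SL" "g = SL_scalars #>\<^bsub>SL\<^esub> A"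
    using PSL_cases[OF assms(1)] .
  obtain B where B: "B \<in> carrier SL" "h = SL_scalars #>\<^bsub>SL\<^esub> B"
    using PSL_cases[OF assms(2)] .
  obtain v where v: "v \<noteq> 0" "x = proj_point v"
    by (rule proj_point_cases)
  have "g \<otimes>\<^bsub>PSL\<^esub> h = SL_scalars #>\<^bsub>SL\<^esub> (A \<otimes>\<^bsub>SL\<^esub> B)"
    using A B normal.rcos_sum[OF normal_SL_scalars] by (simp add: PSL_def FactGroup_def)
  moreover have "A \<otimes>\<^bsub>SL\<^esub> B \<in> carrier SL" "A \<otimes>\<^bsub>SL\<^esub> B = A ** B"
    using A B by (auto simp: SL_def det_mul)
  ultimately show ?thesis
    using A B v by (simp add: PSL_action_coset SL_mult_nonzero matrix_vector_mul_assoc)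
qed

lemma PSL_action_one: "PSL_action \<one>\<^bsub>PSL\<^esub> x = x"
proof -
  obtain v where v: "v \<noteq> 0" "x = proj_point v"
    by (rule proj_point_cases)
  interpret group "SL :: (real ^ 'a ^ 'a) monoid" by (rule group_SL)
  have "\<one>\<^bsub>PSL\<^esub> = SL_scalars #>\<^bsub>SL\<^esub> (\<one>\<^bsub>SL\<^esub> :: real ^ 'a ^ 'a)"
    using coset_mult_one[of SL_scalars] by (auto simp: PSL_def FactGroup_def SL_scalars_def)
  then have "PSL_action \<one>\<^bsub>PSL\<^esub> x = proj_point (\<one>\<^bsub>SL\<^esub> *v v)"
    using v by (simp add: PSL_action_coset)
  with v show ?thesis by (simp add: SL_def)
qed

end

theory Submission
  imports Defs "HOL-Real_Asymp.Real_Asymp"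
begin

text \<open>
  The elements \<open>t i\<close> of the PHP property are contracting projective maps. Suppose that a matrix \<open>t\<close> is,
  up to a scalar, close to a matrix \<open>a k\<^sup>T\<close> of rank one. Then \<open>t\<close> moves every line that is not close
  to the hyperplane \<open>ker k\<close> to a line close to the one through \<open>a\<close>. If the inverse of \<open>t\<close> is close
  to a rank one matrix \<open>b l\<^sup>T\<close> as well, it moves everything off a neighbourhood of \<open>ker l\<close> close to
  \<open>b\<close>. Fix a point \<open>x0\<close> of projective space, let \<open>C i\<close> be the set of \<open>g\<close> that move \<open>x0\<close> close to the
  attracting point \<open>a\<close> of \<open>t i\<close>, and \<open>D i\<close> the set of \<open>g\<close> that move \<open>x0\<close> close to the
  hyperplane \<open>ker l\<close> or into the neighbourhood of \<open>a\<close>. The first condition then asks that finitely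
  many translated attracting points be distinct. The second one asks that few of the hyperplanes
  pass close to a given line; if the hyperplanes are in general position, fewer than \<open>n\<close> of them
  do, and a constant is at most \<open>\<epsilon> sqrt m\<close> for large \<open>m\<close>. Finally \<open>f (t i x)\<close> is close to the value
  of \<open>f\<close> at the attracting point except for boundedly many \<open>i\<close>, so the averages in the third condition
  are governed by the attracting points alone. This reduction is \<open>PHP_criterion\<close>. By
  \<open>state_empirical_limit\<close> there are points along which the averages of finitely many functions tend to
  their values under the state, and it remains to find contracting elements with
  attracting points close to prescribed ones and hyperplanes in general position.

  Contracting elements come from Zariski density (\<open>exists_rank_one_limit\<close>). Among the nonzero
  limits of rescaled elements of the group, one of minimal rank is taken, with range \<open>V\<close>. Compressed to
  \<open>V\<close>, the group acts by zero and by invertible maps whose normalisations lie in a compact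
  semigroup; so it preserves an inner product on \<open>V\<close> up to scalars. This is a polynomial
  condition, which passes to all matrices by density and fails there unless \<open>V\<close> is a line. A
  conjugation argument makes the elements contracting together with their inverses
  (\<open>exists_contracting_sequence\<close>).

  If \<open>u\<close> is contracting, then so is \<open>g u h\<^sup>-\<^sup>1\<close>, with attracting points \<open>g a\<close> and \<open>h b\<close> and with
  hyperplanes moved in the same way; \<open>g\<close> and \<open>h\<close> are chosen independently of each other.
  Minimality brings the points to the prescribed places. It does so for a set of elements
  finitely many translates of which cover the group, so Zariski density still allows
  the hyperplanes to be put in general position (\<open>exists_lift_into_cone\<close>,
  \<open>exists_general_position\<close>, \<open>exists_contracting_family\<close>).
\<close>

section \<open>States on continuous functions are limits of empirical averages\<close>

text \<open>
  Positivity makes \<open>\<phi>\<close> real on \<open>(1 + c f)\<^sup>* (1 + c f)\<close>, hence on the cross terms. The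
  values \<open>c = 1\<close> and \<open>c = \<i>\<close> give the two components of the equation.
\<close>

lemma cstar_state_cstar:
  assumes "cstar_state \<phi>"
  shows "\<phi> (cstar f) = cnj (\<phi> f)"
proof -
  have add: "\<phi> (a + b) = \<phi> a + \<phi> b" and scale: "\<phi> (c *\<^sub>C a) = c * \<phi> a"
    and pos: "\<phi> (cstar a * a) \<in> \<real>\<^sub>\<ge>\<^sub>0" and one: "\<phi> 1 = 1" for a b c
    using assms by (auto simp: cstar_state_def)
  have one1: "1 *\<^sub>C x = x" for x :: 'a
    using scaleC_of_real[of 1 x] by simp
  have cone: "cstar (1::'a) = 1"
    by (metis cstar_cstar cstar_mult mult.right_neutral mult_1)
  have real: "Im (\<phi> (cstar a * a)) = 0" for a
    using pos[of a] by (auto simp: nonneg_Reals_def)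
  have *: "Im (cnj c * \<phi> (cstar f) + c * \<phi> f) = 0" for c
  proof -
    have "cstar (1 + c *\<^sub>C f) * (1 + c *\<^sub>C f)
        = 1 + c *\<^sub>C f + (cnj c *\<^sub>C cstar f + cstar (c *\<^sub>C f) * (c *\<^sub>C f))"
      by (simp add: cstar_add cone cstar_scaleC algebra_simps)
    then have "\<phi> (cstar (1 + c *\<^sub>C f) * (1 + c *\<^sub>C f))
        = 1 + c * \<phi> f + (cnj c * \<phi> (cstar f) + \<phi> (cstar (c *\<^sub>C f) * (c *\<^sub>C f)))"
      by (simp only: add scale one)
    then show ?thesis
      using real[of "1 + c *\<^sub>C f"] real[of "c *\<^sub>C f"] by simp
  qed
  show ?thesis
    using *[of 1] *[of \<i>] by (simp add: complex_eq_iff)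
qed

lemma cstar_state_sum:
  assumes "cstar_state \<phi>"
  shows "\<phi> (\<Sum>f\<in>F. c f *\<^sub>C g f) = (\<Sum>f\<in>F. c f * \<phi> (g f))"
proof -
  have add: "\<phi> (a + b) = \<phi> a + \<phi> b" and scale: "\<phi> (c *\<^sub>C a) = c * \<phi> a" for a b c
    using assms by (auto simp: cstar_state_def)
  have "\<phi> 0 = 0"
    using add[of 0 0] by simp
  then show ?thesis
    by (induction F rule: infinite_finite_induct) (simp_all add: add scale)
qed

text \<open>
  The function \<open>t - Re f\<close> is nonnegative, hence of the form \<open>b\<^sup>* b\<close> with \<open>b\<close> its square root.
\<close>

lemma cstar_state_Re_le:
  fixes f :: "'x::topological_space \<Rightarrow>\<^sub>C complex"
  assumes \<phi>: "cstar_state \<phi>" and le: "\<And>x. Re (apply_bcontfun f x) \<le> t"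
  shows "Re (\<phi> f) \<le> t"
proof -
  have add: "\<phi> (a + b) = \<phi> a + \<phi> b" and scale: "\<phi> (c *\<^sub>C a) = c * \<phi> a"
    and pos: "\<phi> (cstar a * a) \<in> \<real>\<^sub>\<ge>\<^sub>0" and one: "\<phi> 1 = 1" for a b c
    using \<phi> by (auto simp: cstar_state_def)
  define b where "b = Bcontfun (\<lambda>x. complex_of_real (sqrt (t - Re (apply_bcontfun f x))))"
  have "(\<lambda>x. complex_of_real (sqrt (t - Re (apply_bcontfun f x)))) \<in> bcontfun"
  proof (rule bcontfun_normI)
    show "continuous_on UNIV (\<lambda>x. complex_of_real (sqrt (t - Re (apply_bcontfun f x))))"
      by (intro continuous_intros) auto
    have "\<bar>Re (apply_bcontfun f x)\<bar> \<le> norm f" for x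
      by (rule order_trans[OF abs_Re_le_cmod norm_bounded])
    then have "t - Re (apply_bcontfun f x) \<le> \<bar>t\<bar> + norm f" for x
      by (smt (verit))
    then show "norm (complex_of_real (sqrt (t - Re (apply_bcontfun f x)))) \<le> sqrt (\<bar>t\<bar> + norm f)" for x
      using le[of x] by simp
  qed
  then have b: "apply_bcontfun b x = complex_of_real (sqrt (t - Re (apply_bcontfun f x)))" for x
    by (simp add: b_def Bcontfun_inverse)
  have "f + cstar f + 2 *\<^sub>C (cstar b * b) = complex_of_real (2 * t) *\<^sub>C 1"
  proof (rule bcontfun_eqI)
    fix x
    have "complex_of_real (sqrt (t - Re (apply_bcontfun f x))) * complex_of_real (sqrt (t - Re (apply_bcontfun f x)))
      = complex_of_real (t - Re (apply_bcontfun f x))"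
      using le[of x] by (simp flip: of_real_mult)
    then show "apply_bcontfun (f + cstar f + 2 *\<^sub>C (cstar b * b)) x = apply_bcontfun (complex_of_real (2 * t) *\<^sub>C 1) x"
      by (simp add: b cstar_complex_def scaleC_complex_def complex_eq_iff)
  qed
  then have "\<phi> (f + cstar f + 2 *\<^sub>C (cstar b * b)) = \<phi> (complex_of_real (2 * t) *\<^sub>C 1)"
    by simp
  then have "\<phi> f + cnj (\<phi> f) + 2 * \<phi> (cstar b * b) = complex_of_real (2 * t)"
    by (simp only: add scale one cstar_state_cstar[OF \<phi>]) simp
  moreover have "Re (\<phi> (cstar b * b)) \<ge> 0"
    using pos[of b] by (auto simp: nonneg_Reals_def)
  ultimately show ?thesis
    by (simp add: complex_eq_iff)
qed

lemma apply_bcontfun_sum: "apply_bcontfun (\<Sum>i\<in>I. f i) x = (\<Sum>i\<in>I. apply_bcontfun (f i) x)"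
  by (induction I rule: infinite_finite_induct) auto

text \<open>
  A state cannot exceed every point evaluation, so against any
  accumulated error \<open>D\<close> some point corrects in the direction opposite to \<open>D\<close>. Choosing points
  greedily, the squared length of the error grows at most linearly, hence its length at most like
  \<open>sqrt m\<close>, and after division by \<open>m\<close> it tends to 0.
\<close>

lemma state_empirical_limit:
  fixes \<phi> :: "('x::topological_space \<Rightarrow>\<^sub>C complex) \<Rightarrow> complex"
  assumes \<phi>: "cstar_state \<phi>" and fin: "finite F"
  obtains x :: "nat \<Rightarrow> 'x" where
    "\<And>f. f \<in> F \<Longrightarrow> (\<lambda>m. (\<Sum>i=1..m. \<phi> f - apply_bcontfun f (x i)) /\<^sub>R real m) \<longlonglongrightarrow> 0"
proof -
  define err where "err y f = \<phi> f - apply_bcontfun f y" for y f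
  have "\<exists>y. Re (\<Sum>f\<in>F. cnj (D f) * err y f) \<le> 1" for D
  proof (rule ccontr)
    assume "\<nexists>y. Re (\<Sum>f\<in>F. cnj (D f) * err y f) \<le> 1"
    then have far: "Re (\<Sum>f\<in>F. cnj (D f) * err y f) \<ge> 1" for y
      by (meson linear order.trans)
    define g where "g = (\<Sum>f\<in>F. cnj (D f) *\<^sub>C f)"
    have g: "apply_bcontfun g y = (\<Sum>f\<in>F. cnj (D f) * apply_bcontfun f y)" for y
      by (simp add: g_def apply_bcontfun_sum scaleC_complex_def)
    have \<phi>g: "\<phi> g = (\<Sum>f\<in>F. cnj (D f) * \<phi> f)"
      using cstar_state_sum[OF \<phi>, of "\<lambda>f. cnj (D f)" "\<lambda>f. f" F] by (simp add: g_def)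
    have "Re (apply_bcontfun g y) \<le> Re (\<phi> g) - 1" for y
      using far[of y] by (simp add: g \<phi>g err_def right_diff_distrib sum_subtractf)
    from cstar_state_Re_le[OF \<phi> this] show False by simp
  qed
  then obtain pick where pick: "\<And>D. Re (\<Sum>f\<in>F. cnj (D f) * err (pick D) f) \<le> 1"
    by metis
  define D where "D = rec_nat (\<lambda>f. 0) (\<lambda>_ D f. D f + err (pick D) f)"
  have D0: "D 0 = (\<lambda>f. 0)" and DS: "D (Suc m) = (\<lambda>f. D m f + err (pick (D m)) f)" for m
    by (simp_all add: D_def)
  define x where "x i = pick (D (i - 1))" for i
  have D_sum: "D m f = (\<Sum>i=1..m. err (x i) f)" for m f
    by (induction m) (simp_all add: D0 DS x_def)
  define B where "B = (\<Sum>f\<in>F. (cmod (\<phi> f) + norm f)\<^sup>2)"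
  have errB: "(\<Sum>f\<in>F. (cmod (err y f))\<^sup>2) \<le> B" for y
    unfolding B_def err_def
    by (intro sum_mono power_mono order_trans[OF norm_triangle_ineq4] add_left_mono norm_bounded) auto
  have lin: "(\<Sum>f\<in>F. (cmod (D m f))\<^sup>2) \<le> (2 + B) * real m" for m
  proof (induction m)
    case (Suc m)
    have "(cmod (a + b))\<^sup>2 = (cmod a)\<^sup>2 + 2 * Re (cnj a * b) + (cmod b)\<^sup>2" for a b
      unfolding cmod_power2 by (simp add: power2_eq_square algebra_simps)
    then have "(\<Sum>f\<in>F. (cmod (D (Suc m) f))\<^sup>2) = (\<Sum>f\<in>F. (cmod (D m f))\<^sup>2)
        + 2 * Re (\<Sum>f\<in>F. cnj (D m f) * err (pick (D m)) f) + (\<Sum>f\<in>F. (cmod (err (pick (D m)) f))\<^sup>2)"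
      by (simp add: DS sum.distrib sum_distrib_left)
    also have "\<dots> \<le> (2 + B) * real m + 2 * 1 + B"
      by (intro add_mono Suc mult_left_mono pick errB) auto
    finally show ?case by (simp add: algebra_simps)
  qed (simp add: D0)
  have "B \<ge> 0"
    unfolding B_def by (intro sum_nonneg) auto
  show thesis
  proof (rule that[of x])
    fix f assume f: "f \<in> F"
    have "cmod (D m f) \<le> sqrt ((2 + B) * real m)" for m
    proof (rule real_le_rsqrt)
      have "(cmod (D m f))\<^sup>2 \<le> (\<Sum>f\<in>F. (cmod (D m f))\<^sup>2)"
        using f fin by (intro member_le_sum) auto
      then show "(cmod (D m f))\<^sup>2 \<le> (2 + B) * real m"
        using lin[of m] by linarith
    qed
    then have "cmod (D m f /\<^sub>R real m) \<le> sqrt (2 + B) * (sqrt (real m) / real m)" for m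
      using divide_right_mono[of "cmod (D m f)" "sqrt ((2 + B) * real m)" "real m"]
      by (simp add: real_sqrt_mult divide_inverse mult.commute mult.left_commute)
    then have "\<forall>\<^sub>F m in sequentially. cmod (D m f /\<^sub>R real m) \<le> sqrt (2 + B) * (sqrt (real m) / real m)"
      by (rule always_eventually[OF allI])
    moreover have "(\<lambda>m. sqrt (real m) / real m) \<longlonglongrightarrow> 0"
      by real_asymp
    then have "(\<lambda>m. sqrt (2 + B) * (sqrt (real m) / real m)) \<longlonglongrightarrow> 0"
      by (rule tendsto_mult_right_zero)
    ultimately have "(\<lambda>m. D m f /\<^sub>R real m) \<longlonglongrightarrow> 0"
      by (rule Lim_null_comparison)
    then show "(\<lambda>m. (\<Sum>i=1..m. \<phi> f - apply_bcontfun f (x i)) /\<^sub>R real m) \<longlonglongrightarrow> 0"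
      by (simp add: D_sum err_def)
  qed
qed

section \<open>A dynamical criterion\<close>

locale continuous_action = group G for G :: "('g, 'm) monoid_scheme" (structure) +
  fixes act :: "'g \<Rightarrow> 'x \<Rightarrow> 'x::topological_space"
  assumes cont: "g \<in> carrier G \<Longrightarrow> continuous_on UNIV (act g)"
    and act_one: "act \<one> x = x"
    and act_mult: "g \<in> carrier G \<Longrightarrow> h \<in> carrier G \<Longrightarrow> act (g \<otimes> h) x = act g (act h x)"
begin

lemma act_inv_act [simp]: "g \<in> carrier G \<Longrightarrow> act (inv g) (act g x) = x"
  by (simp add: act_mult[symmetric] act_one)

lemma act_act_inv [simp]: "g \<in> carrier G \<Longrightarrow> act g (act (inv g) x) = x"
  by (simp add: act_mult[symmetric] act_one)

lemma induced_apply: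
  "g \<in> carrier G \<Longrightarrow>
    apply_bcontfun (induced_action G act g f) x = apply_bcontfun f (act (inv g) x)"
  by (simp add: induced_action_apply cont)

lemma induced_inverse:
  "g \<in> carrier G \<Longrightarrow> induced_action G act g (induced_action G act (inv g) f) = f"
  by (rule bcontfun_eqI) (simp add: induced_apply)

lemma inv_into_induced:
  assumes "g \<in> carrier G"
  shows "inv_into UNIV (induced_action G act g) = induced_action G act (inv g)"
  by (rule inv_unique_comp)
    (use assms induced_inverse[of g] induced_inverse[of "inv g"] in \<open>auto simp: fun_eq_iff\<close>)

lemma cstar_automorphism_induced:
  assumes g: "g \<in> carrier G"
  shows "cstar_automorphism (induced_action G act g)"
  unfolding cstar_automorphism_def
proof (intro conjI allI)
  show "bij (induced_action G act g)"
    by (rule o_bij[of "induced_action G act (inv g)"])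
      (use g induced_inverse[of g] induced_inverse[of "inv g"] in \<open>auto simp: fun_eq_iff\<close>)
qed (auto intro!: bcontfun_eqI simp: induced_apply g)

lemma mem_l_coset_iff:
  assumes "g \<in> carrier G" "S \<subseteq> carrier G"
  shows "k \<in> g <# S \<longleftrightarrow> k \<in> carrier G \<and> inv g \<otimes> k \<in> S"
proof
  assume k: "k \<in> g <# S"
  then obtain s where "s \<in> S" "k = g \<otimes> s" by (auto simp: l_coset_def)
  with assms show "k \<in> carrier G \<and> inv g \<otimes> k \<in> S"
    by (auto simp: m_assoc[symmetric] subset_iff)
next
  assume "k \<in> carrier G \<and> inv g \<otimes> k \<in> S"
  then show "k \<in> g <# S"
    using assms by (auto simp: l_coset_def m_assoc[symmetric] intro!: bexI[of _ "inv g \<otimes> k"])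
qed

text \<open>
  The subsets of the group are pulled back along an orbit map \<open>g \<mapsto> g x0\<close>: \<open>C i\<close> from \<open>A i\<close>, and \<open>D i\<close>
  from the points that the inverse of \<open>t i\<close> does not move into \<open>B i\<close>, together with \<open>C i\<close>. Then
  \<open>(t j)\<^sup>-\<^sup>1 (G - D j)\<close> lies over \<open>B j\<close>, and \<open>(t j)\<^sup>-\<^sup>1 (G - C j)\<close> over the points that
  \<open>t j\<close> does not move into \<open>A j\<close>. Disjointness is inherited from the translates of \<open>A i\<close> and \<open>B j\<close>, and a
  group element lies in at most \<open>2 \<kappa> + 1\<close> of the sets in the supremum.

  The open sets \<open>U i\<close> are chosen around sample points for the state, so small that the given functions
  hardly vary on them. The averages along \<open>t i\<close> and its inverse differ substantially from
  those at the sample points in at most \<open>\<kappa>\<close> terms each, which is negligible for large \<open>m\<close>.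
\<close>

theorem PHP_criterion:
  fixes \<phi> :: "('x \<Rightarrow>\<^sub>C complex) \<Rightarrow> complex" and \<kappa> :: nat
  assumes \<phi>: "cstar_state \<phi>"
    and contracting: "\<And>F m (U :: nat \<Rightarrow> 'x set). finite F \<Longrightarrow> F \<subseteq> carrier G \<Longrightarrow>
      (\<And>i. open (U i) \<and> U i \<noteq> {}) \<Longrightarrow>
      \<exists>t A B. (\<forall>i\<in>{1..m}. t i \<in> carrier G \<and> A i \<subseteq> U i \<and> B i \<subseteq> U i) \<and>
        disjoint_family_on (case_sum (\<lambda>(g, i). act g ` A i) (\<lambda>(h, j). act h ` B j))
          (F \<times> {1..m} <+> F \<times> {1..m}) \<and>
        (\<forall>x. card {i\<in>{1..m}. act (t i) x \<notin> A i} \<le> \<kappa>) \<and>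
        (\<forall>x. card {i\<in>{1..m}. act (inv (t i)) x \<notin> B i} \<le> \<kappa>)"
  shows "PHP_property G (induced_action G act) \<phi>"
  unfolding PHP_property_def
proof (intro conjI ballI allI impI)
  show "cstar_automorphism (induced_action G act g)" if "g \<in> carrier G" for g
    using that by (rule cstar_automorphism_induced)
next
  fix FA :: "('x \<Rightarrow>\<^sub>C complex) set" and FG :: "'g set" and N :: nat and \<epsilon> :: real
  assume FA: "finite FA" and FG: "finite FG" "FG \<subseteq> carrier G" and \<epsilon>: "0 < \<epsilon>"
  obtain x :: "nat \<Rightarrow> 'x" where
    x: "\<And>f. f \<in> FA \<Longrightarrow> (\<lambda>m. (\<Sum>i=1..m. \<phi> f - apply_bcontfun f (x i)) /\<^sub>R real m) \<longlonglongrightarrow> 0"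
    using state_empirical_limit[OF \<phi> FA] by blast
  have "\<forall>\<^sub>F m in sequentially. \<forall>f\<in>FA. cmod ((\<Sum>i=1..m. \<phi> f - apply_bcontfun f (x i)) /\<^sub>R real m) < \<epsilon>/4"
  proof (intro eventually_ball_finite[OF FA] ballI)
    fix f assume "f \<in> FA"
    from tendsto_norm_zero[OF x[OF this]]
    show "\<forall>\<^sub>F m in sequentially. cmod ((\<Sum>i=1..m. \<phi> f - apply_bcontfun f (x i)) /\<^sub>R real m) < \<epsilon>/4"
      by (rule order_tendstoD(2)) (use \<epsilon> in simp)
  qed
  moreover have "\<forall>\<^sub>F m in sequentially. \<forall>f\<in>FA. 2 * \<kappa> * norm f / real m < \<epsilon>/4"
  proof (intro eventually_ball_finite[OF FA] ballI)
    fix f :: "'x \<Rightarrow>\<^sub>C complex"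
    have "(\<lambda>m. 2 * \<kappa> * norm f / real m) \<longlonglongrightarrow> 0"
      by (rule lim_const_over_n)
    then show "\<forall>\<^sub>F m in sequentially. 2 * \<kappa> * norm f / real m < \<epsilon>/4"
      by (rule order_tendstoD(2)) (use \<epsilon> in simp)
  qed
  moreover have "filterlim (\<lambda>m. sqrt (real m)) at_top sequentially"
    by real_asymp
  then have "filterlim (\<lambda>m. \<epsilon> * sqrt (real m)) at_top sequentially"
    by (rule filterlim_tendsto_pos_mult_at_top[OF tendsto_const \<epsilon>])
  then have "\<forall>\<^sub>F m in sequentially. real (2 * \<kappa> + 1) \<le> \<epsilon> * sqrt (real m)"
    by (rule filterlim_at_top[THEN iffD1, rule_format])
  moreover have "\<forall>\<^sub>F m in sequentially. max N 1 \<le> m"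
    by (rule eventually_ge_at_top)
  ultimately have "\<forall>\<^sub>F m in sequentially. max N 1 \<le> m \<and> real (2 * \<kappa> + 1) \<le> \<epsilon> * sqrt (real m) \<and>
      (\<forall>f\<in>FA. 2 * \<kappa> * norm f / real m < \<epsilon>/4) \<and>
      (\<forall>f\<in>FA. cmod ((\<Sum>i=1..m. \<phi> f - apply_bcontfun f (x i)) /\<^sub>R real m) < \<epsilon>/4)"
    by eventually_elim blast
  from eventually_happens'[OF sequentially_bot this] obtain m where m: "max N 1 \<le> m" and m\<kappa>: "real (2 * \<kappa> + 1) \<le> \<epsilon> * sqrt (real m)"
    and mf: "\<And>f. f \<in> FA \<Longrightarrow> 2 * \<kappa> * norm f / real m < \<epsilon>/4"
    and mx: "\<And>f. f \<in> FA \<Longrightarrow> cmod ((\<Sum>i=1..m. \<phi> f - apply_bcontfun f (x i)) /\<^sub>R real m) < \<epsilon>/4"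
    by blast
  define U where "U i = (\<Inter>f\<in>FA. apply_bcontfun f -` ball (apply_bcontfun f (x i)) (\<epsilon>/4))" for i
  have U_open: "open (U i)" for i
    unfolding U_def by (intro open_INT FA ballI open_vimage) auto
  have U: "open (U i) \<and> U i \<noteq> {}" for i
  proof
    have "x i \<in> U i" using \<epsilon> by (auto simp: U_def)
    then show "U i \<noteq> {}" by blast
  qed (rule U_open)
  \<comment> \<open>Adding the identity makes the sets \<open>A i\<close> themselves disjoint.\<close>
  have "finite (insert \<one> FG)" "insert \<one> FG \<subseteq> carrier G"
    using FG by auto
  from contracting[of _ U m, OF this U] obtain t A B where
    tAB: "(\<forall>i\<in>{1..m}. t i \<in> carrier G \<and> A i \<subseteq> U i \<and> B i \<subseteq> U i) \<and>
        disjoint_family_on (case_sum (\<lambda>(g, i). act g ` A i) (\<lambda>(h, j). act h ` B j))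
          (insert \<one> FG \<times> {1..m} <+> insert \<one> FG \<times> {1..m}) \<and>
        (\<forall>x. card {i\<in>{1..m}. act (t i) x \<notin> A i} \<le> \<kappa>) \<and>
        (\<forall>x. card {i\<in>{1..m}. act (inv (t i)) x \<notin> B i} \<le> \<kappa>)"
    by (elim exE) (rule that)
  note disj = tAB[THEN conjunct2, THEN conjunct1]
  have t: "t i \<in> carrier G" and AU: "A i \<subseteq> U i" and BU: "B i \<subseteq> U i" if "i \<in> {1..m}" for i
    using tAB that by blast+
  have cardA: "card {i\<in>{1..m}. act (t i) y \<notin> A i} \<le> \<kappa>" and
    cardB: "card {i\<in>{1..m}. act (inv (t i)) y \<notin> B i} \<le> \<kappa>" for y
    using tAB by blast+
  obtain x0 :: 'x where True by blast
  define C where "C i = {g \<in> carrier G. act g x0 \<in> A i}" for i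
  define D where "D i = {g \<in> carrier G. act (inv (t i)) (act g x0) \<notin> B i} \<union> C i" for i
  have CD: "C i \<subseteq> D i" "D i \<subseteq> carrier G" for i
    by (auto simp: C_def D_def)
  have gC: "act k x0 \<in> act g ` A i" if "g \<in> FG" and k: "k \<in> g <# C i" for g i k
  proof -
    have "g \<in> carrier G" using that FG by blast
    moreover obtain c where c: "c \<in> carrier G" "act c x0 \<in> A i" "k = g \<otimes> c"
      using k by (auto simp: l_coset_def C_def)
    ultimately have "act k x0 = act g (act c x0)" by (simp add: act_mult)
    with c show ?thesis by blast
  qed
  have hD: "act k x0 \<in> act h ` B j"
    if "h \<in> FG" "j \<in> {1..m}" and k: "k \<in> (h \<otimes> inv (t j)) <# (carrier G - D j)" for h j k
  proof -
    have "h \<in> carrier G" "t j \<in> carrier G" using that FG t by auto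
    moreover obtain c where c: "c \<in> carrier G" "c \<notin> D j" "k = h \<otimes> inv (t j) \<otimes> c"
      using k by (auto simp: l_coset_def)
    ultimately have "act k x0 = act h (act (inv (t j)) (act c x0))"
      by (simp add: act_mult)
    moreover have "act (inv (t j)) (act c x0) \<in> B j"
      using c by (auto simp: D_def)
    ultimately show ?thesis by blast
  qed
  have "disjoint_family_on (case_sum (\<lambda>(g, i). g <# C i) (\<lambda>(h, j). (h \<otimes> inv (t j)) <# (carrier G - D j)))
      (FG \<times> {1..m} <+> FG \<times> {1..m})" (is "disjoint_family_on ?S ?I")
  proof -
    let ?T = "case_sum (\<lambda>(g, i). act g ` A i) (\<lambda>(h, j). act h ` B j)"
    have sub: "act k x0 \<in> ?T p" if "p \<in> ?I" "k \<in> ?S p" for p k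
      using that gC hD by (cases p) auto
    have "?S p \<inter> ?S q = {}" if "p \<in> ?I" "q \<in> ?I" "p \<noteq> q" for p q
    proof -
      have "?T p \<inter> ?T q = {}"
        using that by (intro disjoint_family_onD[OF disj]) auto
      then show ?thesis using sub that by blast
    qed
    then show ?thesis by (auto simp: disjoint_family_on_def)
  qed
  moreover have "(SUP g\<in>carrier G. real (card ({i\<in>{1..m}. g \<in> D i} \<union>
      {j\<in>{1..m}. g \<in> inv (t j) <# (carrier G - C j)}))) \<le> \<epsilon> * sqrt (real m)"
  proof (rule cSUP_least)
    fix g assume g: "g \<in> carrier G"
    let ?y = "act g x0"
    have 1: "card {i\<in>{1..m}. ?y \<in> A i} \<le> 1"
    proof (rule card_le_Suc0_iff_eq[THEN iffD2, simplified One_nat_def[symmetric]])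
      show "\<forall>i\<in>{i \<in> {1..m}. ?y \<in> A i}. \<forall>j\<in>{i \<in> {1..m}. ?y \<in> A i}. i = j"
      proof (intro ballI, rule ccontr)
        fix i j assume ij: "i \<in> {i \<in> {1..m}. ?y \<in> A i}" "j \<in> {i \<in> {1..m}. ?y \<in> A i}" "i \<noteq> j"
        have "act \<one> ` A i \<inter> act \<one> ` A j = {}"
          using disjoint_family_onD[OF disj, of "Inl (\<one>, i)" "Inl (\<one>, j)"] ij by (simp add: InlI)
        moreover have "act \<one> ` S = S" for S
          by (simp add: act_one)
        ultimately show False using ij by auto
      qed
    qed auto
    have "{i\<in>{1..m}. g \<in> D i} \<subseteq> {i\<in>{1..m}. act (inv (t i)) ?y \<notin> B i} \<union> {i\<in>{1..m}. ?y \<in> A i}"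
      by (auto simp: D_def C_def)
    moreover have "{j\<in>{1..m}. g \<in> inv (t j) <# (carrier G - C j)} \<subseteq> {i\<in>{1..m}. act (t i) ?y \<notin> A i}"
    proof safe
      fix j assume j: "j \<in> {1..m}" "g \<in> inv (t j) <# (carrier G - C j)" "act (t j) ?y \<in> A j"
      then have "t j \<otimes> g \<in> carrier G - C j"
        using t[OF j(1)] by (auto simp: mem_l_coset_iff)
      with j(3) show False
        using t[OF j(1)] g by (auto simp: C_def act_mult)
    qed
    ultimately have "card ({i\<in>{1..m}. g \<in> D i} \<union> {j\<in>{1..m}. g \<in> inv (t j) <# (carrier G - C j)})
        \<le> card (({i\<in>{1..m}. act (inv (t i)) ?y \<notin> B i} \<union> {i\<in>{1..m}. ?y \<in> A i}) \<union> {i\<in>{1..m}. act (t i) ?y \<notin> A i})"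
      by (intro card_mono) auto
    also have "\<dots> \<le> \<kappa> + 1 + \<kappa>"
      using 1 cardA[of ?y] cardB[of ?y] by (meson add_mono card_Un_le order_trans)
    finally show "real (card ({i\<in>{1..m}. g \<in> D i} \<union> {j\<in>{1..m}. g \<in> inv (t j) <# (carrier G - C j)}))
        \<le> \<epsilon> * sqrt (real m)"
      using m\<kappa> by linarith
  qed auto
  moreover have "norm ((1 / (2 * real m)) *\<^sub>R (\<Sum>i=1..m. induced_action G act (t i) f +
      inv_into UNIV (induced_action G act (t i)) f) - \<phi> f *\<^sub>C 1) < \<epsilon>" if f: "f \<in> FA" for f
  proof -
    have avg: "cmod (\<Sum>i=1..m. apply_bcontfun f (s i y) - apply_bcontfun f (x i)) \<le> real m * (\<epsilon>/4) + 2 * \<kappa> * norm f"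
      if E: "\<And>i. i \<in> {1..m} \<Longrightarrow> E i \<subseteq> U i" and card: "card {i\<in>{1..m}. s i y \<notin> E i} \<le> \<kappa>"
      for s :: "nat \<Rightarrow> 'x \<Rightarrow> 'x" and E y
    proof -
      have "cmod (apply_bcontfun f (s i y) - apply_bcontfun f (x i))
          \<le> \<epsilon>/4 + (if s i y \<notin> E i then 2 * norm f else 0)" if "i \<in> {1..m}" for i
      proof (cases "s i y \<in> E i")
        case True
        then have "s i y \<in> U i" using E that by blast
        then have "dist (apply_bcontfun f (x i)) (apply_bcontfun f (s i y)) < \<epsilon>/4"
          using f by (auto simp: U_def)
        with True show ?thesis by (simp add: dist_norm norm_minus_commute)
      next
        case False
        have "cmod (apply_bcontfun f (s i y) - apply_bcontfun f (x i)) \<le> norm f + norm f"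
          by (rule order_trans[OF norm_triangle_ineq4]) (intro add_mono norm_bounded)
        with False \<epsilon> show ?thesis by simp
      qed
      then have "cmod (\<Sum>i=1..m. apply_bcontfun f (s i y) - apply_bcontfun f (x i))
          \<le> (\<Sum>i=1..m. \<epsilon>/4 + (if s i y \<notin> E i then 2 * norm f else 0))"
        by (rule sum_norm_le)
      also have "\<dots> = real m * (\<epsilon>/4) + real (card {i\<in>{1..m}. s i y \<notin> E i}) * (2 * norm f)"
        by (simp add: sum.distrib sum.If_cases Int_def conj_commute)
      also have "\<dots> \<le> real m * (\<epsilon>/4) + real \<kappa> * (2 * norm f)"
        using card \<epsilon> by (intro add_mono mult_right_mono) auto
      finally show ?thesis by (simp add: mult_ac)
    qed
    have m0: "real m > 0" using m by simp
    have "norm ((1 / (2 * real m)) *\<^sub>R (\<Sum>i=1..m. induced_action G act (t i) f +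
      inv_into UNIV (induced_action G act (t i)) f) - \<phi> f *\<^sub>C 1) \<le> \<epsilon>/4 + \<epsilon>/4 + \<epsilon>/4"
    proof (rule norm_bound)
      fix y
      let ?s1 = "\<Sum>i=1..m. apply_bcontfun f (act (inv (t i)) y) - apply_bcontfun f (x i)"
      let ?s2 = "\<Sum>i=1..m. apply_bcontfun f (act (t i) y) - apply_bcontfun f (x i)"
      let ?s3 = "\<Sum>i=1..m. \<phi> f - apply_bcontfun f (x i)"
      have "apply_bcontfun ((1 / (2 * real m)) *\<^sub>R (\<Sum>i=1..m. induced_action G act (t i) f +
          inv_into UNIV (induced_action G act (t i)) f) - \<phi> f *\<^sub>C 1) y
        = (1 / (2 * real m)) *\<^sub>R (\<Sum>i=1..m. apply_bcontfun f (act (inv (t i)) y) + apply_bcontfun f (act (t i) y)) - \<phi> f"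
        using t by (simp add: apply_bcontfun_sum inv_into_induced induced_apply scaleC_complex_def)
      also have "(\<Sum>i=1..m. apply_bcontfun f (act (inv (t i)) y) + apply_bcontfun f (act (t i) y))
        = ?s1 + ?s2 - 2 * ?s3 + of_real (2 * real m) * \<phi> f"
        by (simp add: sum.distrib sum_subtractf algebra_simps)
      also have "(1 / (2 * real m)) *\<^sub>R (?s1 + ?s2 - 2 * ?s3 + of_real (2 * real m) * \<phi> f) - \<phi> f
        = (1 / (2 * real m)) *\<^sub>R (?s1 + ?s2) - ?s3 /\<^sub>R real m"
        using m0 by (simp add: scaleR_conv_of_real field_simps)
      also have "cmod \<dots> \<le> (1 / (2 * real m)) * cmod (?s1 + ?s2) + cmod (?s3 /\<^sub>R real m)"
        using norm_triangle_ineq4[of "(1 / (2 * real m)) *\<^sub>R (?s1 + ?s2)" "?s3 /\<^sub>R real m"] m0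
        by simp
      also have "\<dots> \<le> (1 / (2 * real m)) * (2 * (real m * (\<epsilon>/4) + 2 * \<kappa> * norm f)) + \<epsilon>/4"
      proof (intro add_mono mult_left_mono)
        have "cmod ?s1 \<le> real m * (\<epsilon>/4) + 2 * \<kappa> * norm f"
          by (rule avg[OF BU cardB])
        moreover have "cmod ?s2 \<le> real m * (\<epsilon>/4) + 2 * \<kappa> * norm f"
          by (rule avg[OF AU cardA])
        ultimately show "cmod (?s1 + ?s2) \<le> 2 * (real m * (\<epsilon>/4) + 2 * \<kappa> * norm f)"
          unfolding mult_2 by (intro norm_triangle_le add_mono)
      qed (use mx[OF f] m0 in auto)
      also have "\<dots> = \<epsilon>/4 + 2 * \<kappa> * norm f / real m + \<epsilon>/4"
        using m0 by (simp add: field_simps)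
      also have "\<dots> \<le> \<epsilon>/4 + \<epsilon>/4 + \<epsilon>/4"
        using mf[OF f] by simp
      finally show "cmod (apply_bcontfun ((1 / (2 * real m)) *\<^sub>R (\<Sum>i=1..m. induced_action G act (t i) f +
          inv_into UNIV (induced_action G act (t i)) f) - \<phi> f *\<^sub>C 1) y) \<le> \<epsilon>/4 + \<epsilon>/4 + \<epsilon>/4" .
    qed
    with \<epsilon> show ?thesis by linarith
  qed
  ultimately show "\<exists>m\<ge>N. \<exists>t C D.
     (\<forall>i\<in>{1..m}. t i \<in> carrier G \<and> C i \<subseteq> D i \<and> D i \<subseteq> carrier G) \<and>
     disjoint_family_on
       (case_sum (\<lambda>(g, i). g <# C i) (\<lambda>(h, j). (h \<otimes> inv (t j)) <# (carrier G - D j)))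
       (FG \<times> {1..m} <+> FG \<times> {1..m}) \<and>
     (SUP g\<in>carrier G. real (card ({i\<in>{1..m}. g \<in> D i} \<union>
        {j\<in>{1..m}. g \<in> inv (t j) <# (carrier G - C j)}))) \<le> \<epsilon> * sqrt (real m) \<and>
     (\<forall>a\<in>FA. norm ((1 / (2 * real m)) *\<^sub>R (\<Sum>i=1..m. induced_action G act (t i) a +
        inv_into UNIV (induced_action G act (t i)) a) - \<phi> a *\<^sub>C 1) < \<epsilon>)"
    using m t CD by (intro exI[of _ m] conjI exI[of _ t] exI[of _ C] exI[of _ D]) auto
qed

end

section \<open>Polynomial functions and Zariski density\<close>

lemma real_polynomial_zero_of_infinite_zeros:
  assumes "real_polynomial_function q" "infinite {t::real. q t = 0}"
  shows "q t = 0"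
proof -
  obtain a n where q: "q = (\<lambda>x. \<Sum>i\<le>n. a i * x^i)"
    using assms(1) by (auto simp: real_polynomial_function_iff_sum)
  have "\<forall>i\<le>n. a i = 0"
    using assms(2) polyfun_finite_roots[of a n] by (auto simp: q)
  then show ?thesis by (simp add: q)
qed

lemma real_polynomial_function_line:
  assumes "real_polynomial_function p"
  shows "real_polynomial_function (\<lambda>t::real. p (a + t *\<^sub>R b))"
proof -
  have "polynomial_function (\<lambda>t::real. a + t *\<^sub>R b)"
    by (intro polynomial_function_add polynomial_function_const polynomial_function_bounded_linear
        bounded_linear_scaleR_left)
  from real_polynomial_function_compose[OF this assms] show ?thesis
    by (simp add: o_def)
qed

text \<open>
  On the line through a point of \<open>V\<close> and an arbitrary point, \<open>p\<close> is a polynomial in one variable with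
  infinitely many zeros.
\<close>

lemma polynomial_zero_of_zero_on_open:
  fixes p :: "'a::real_normed_vector \<Rightarrow> real"
  assumes p: "real_polynomial_function p" and V: "open V" "V \<noteq> {}" and zero: "\<And>x. x \<in> V \<Longrightarrow> p x = 0"
  shows "p y = 0"
proof -
  obtain v where v: "v \<in> V" using V by blast
  let ?l = "\<lambda>t::real. v + t *\<^sub>R (y - v)"
  have "open (?l -` V)"
    by (intro open_vimage V continuous_intros)
  moreover have "0 \<in> ?l -` V" using v by simp
  ultimately have "infinite (?l -` V)"
    using not_open_singleton open_delete by (metis empty_iff finite_imp_not_open)
  moreover have "?l -` V \<subseteq> {t. p (?l t) = 0}" using zero by auto
  ultimately have "p (?l 1) = 0"
    using real_polynomial_zero_of_infinite_zeros[OF real_polynomial_function_line[OF p]] finite_subset by blast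
  then show ?thesis by simp
qed

lemma continuous_on_real_polynomial_function:
  "real_polynomial_function p \<Longrightarrow> continuous_on S p"
  by (simp add: continuous_on_polymonial_function real_polynomial_function_eq)

lemma open_avoids_polynomials:
  fixes V :: "'a::real_normed_vector set"
  assumes "finite P" and "\<And>p. p \<in> P \<Longrightarrow> real_polynomial_function p"
    and "\<And>p. p \<in> P \<Longrightarrow> \<exists>x. p x \<noteq> 0" and "open V" "V \<noteq> {}"
  obtains x where "x \<in> V" "\<And>p. p \<in> P \<Longrightarrow> p x \<noteq> 0"
  using assms
proof (induction P arbitrary: V thesis rule: finite_induct)
  case empty
  then show ?case by auto
next
  case (insert p P)
  let ?V = "V \<inter> p -` (- {0})"
  have p: "real_polynomial_function p" by (simp add: insert.prems)
  have "open ?V"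
    by (intro open_Int insert.prems(4) open_vimage continuous_on_real_polynomial_function p) auto
  moreover have "?V \<noteq> {}"
    using polynomial_zero_of_zero_on_open[OF p insert.prems(4,5)] insert.prems(3)[of p] by auto
  ultimately obtain x where "x \<in> ?V" "\<And>q. q \<in> P \<Longrightarrow> q x \<noteq> 0"
    using insert.IH[of ?V] insert.prems(2,3) by blast
  then show ?case by (intro insert.prems(1)[of x]) auto
qed

lemma real_polynomial_function_det:
  fixes F :: "'a::real_normed_vector \<Rightarrow> real ^ 'n ^ 'n"
  assumes "\<And>i j. real_polynomial_function (\<lambda>x. F x $ i $ j)"
  shows "real_polynomial_function (\<lambda>x. det (F x))"
  unfolding det_def
  by (intro real_polynomial_function_sum real_polynomial_function.intros(4) real_polynomial_function_prod
      real_polynomial_function.intros(2) assms) (auto simp: finite_permutations)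

lemma mat_mult_eq_scaleR: "mat c ** A = c *\<^sub>R A" for A :: "real ^ 'n::finite ^ 'n"
  by (simp add: matrix_eq mat_vec_mult scaleR_matrix_vector_assoc flip: matrix_vector_mul_assoc)

lemma det_scaleR: "det (c *\<^sub>R A) = c ^ CARD('n) * det A" for A :: "real ^ 'n::finite ^ 'n"
proof -
  have "det (mat c :: real ^ 'n ^ 'n) = c ^ CARD('n)"
    using det_matrix_scaleR[of c, where 'n = 'n] by (simp add: matrix_scaleR)
  then show ?thesis by (simp add: det_mul flip: mat_mult_eq_scaleR)
qed

lemma real_polynomial_matrix_entry: "real_polynomial_function (\<lambda>A :: real ^ 'n::finite ^ 'n. A $ i $ j)"
  by (rule real_polynomial_function.intros(1))
    (intro bounded_linear_compose[OF bounded_linear_vec_nth bounded_linear_vec_nth])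

lemma continuous_det: "continuous_on UNIV (det :: real ^ 'n::finite ^ 'n \<Rightarrow> real)"
  by (intro continuous_on_real_polynomial_function real_polynomial_function_det real_polynomial_matrix_entry)

lemma PSL_class_of_member:
  assumes "g \<in> carrier PSL" "A \<in> g"
  shows "A \<in> carrier SL" "g = SL_scalars #>\<^bsub>SL\<^esub> A"
proof -
  interpret group "SL :: (real ^ 'a ^ 'a) monoid" by (rule group_SL)
  have sub: "subgroup SL_scalars (SL :: (real ^ 'a ^ 'a) monoid)"
    using normal_SL_scalars normal_imp_subgroup by blast
  obtain B where B: "B \<in> carrier SL" "g = SL_scalars #>\<^bsub>SL\<^esub> B"
    using PSL_cases[OF assms(1)] .
  show A: "A \<in> carrier SL"
    using assms(2) B sub r_coset_subset_G subgroup.subset by blast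
  show "g = SL_scalars #>\<^bsub>SL\<^esub> A"
    using repr_independence[OF _ B(1) sub] assms(2) B(2) by blast
qed

lemma mem_PSL_class_iff:
  assumes "A \<in> carrier SL"
  shows "B \<in> SL_scalars #>\<^bsub>SL\<^esub> A \<longleftrightarrow> B \<in> carrier SL \<and> (\<exists>c. B = c *\<^sub>R A)"
proof
  assume "B \<in> SL_scalars #>\<^bsub>SL\<^esub> A"
  then obtain c where "mat c \<in> (carrier SL :: (real ^ 'a ^ 'a) set)" "B = mat c ** A"
    by (auto simp: r_coset_def SL_scalars_def SL_def)
  then show "B \<in> carrier SL \<and> (\<exists>c. B = c *\<^sub>R A)"
    using assms by (auto simp: SL_def det_mul simp flip: mat_mult_eq_scaleR)
next
  assume "B \<in> carrier SL \<and> (\<exists>c. B = c *\<^sub>R A)"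
  then obtain c where c: "B \<in> carrier SL" "B = mat c ** A"
    by (auto simp: mat_mult_eq_scaleR)
  with assms have "det (mat c :: real ^ 'a ^ 'a) = 1"
    by (simp add: SL_def det_mul)
  then show "B \<in> SL_scalars #>\<^bsub>SL\<^esub> A"
    using c by (auto simp: r_coset_def SL_scalars_def SL_def)
qed

lemma PSL_class_mem:
  assumes "A \<in> carrier SL"
  shows "SL_scalars #>\<^bsub>SL\<^esub> A \<in> carrier PSL" "A \<in> SL_scalars #>\<^bsub>SL\<^esub> A"
  using assms mem_PSL_class_iff[OF assms, of A]
  by (auto simp: PSL_def FactGroup_def RCOSETS_def intro: exI[of _ 1])

lemma matrix_inv_mult:
  assumes "invertible (A :: real ^ 'n::finite ^ 'n)"
  shows "matrix_inv A ** A = mat 1" "A ** matrix_inv A = mat 1"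
  using someI_ex[OF assms[unfolded invertible_def]] by (auto simp: matrix_inv_def)

locale PSL_subgroup =
  fixes \<Gamma> :: "(real ^ 'n::finite ^ 'n) set set"
  assumes subgroup: "subgroup \<Gamma> PSL"
begin

text \<open>
  The preimage of \<open>\<Gamma>\<close> in \<open>SL\<close>, since the elements of \<open>PSL\<close> are cosets.
\<close>

definition lifts :: "(real ^ 'n ^ 'n) set" where
  "lifts = \<Union>\<Gamma>"

lemma lift_det: "A \<in> lifts \<Longrightarrow> det A = 1"
  using PSL_class_of_member(1) subgroup.mem_carrier[OF subgroup] by (fastforce simp: SL_def lifts_def)

lemma lift_class: "A \<in> lifts \<Longrightarrow> SL_scalars #>\<^bsub>SL\<^esub> A \<in> \<Gamma>"
  using PSL_class_of_member(2) subgroup.mem_carrier[OF subgroup] by (metis UnionE lifts_def)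

lemma lift_iff: "A \<in> lifts \<longleftrightarrow> det A = 1 \<and> SL_scalars #>\<^bsub>SL\<^esub> A \<in> \<Gamma>"
  using lift_det[of A] lift_class[of A] PSL_class_mem(2)[of A] by (auto simp: SL_def lifts_def)

lemma lift_mult:
  assumes "A \<in> lifts" "B \<in> lifts"
  shows "A ** B \<in> lifts"
proof -
  have "SL_scalars #>\<^bsub>SL\<^esub> (A ** B) = (SL_scalars #>\<^bsub>SL\<^esub> A) \<otimes>\<^bsub>PSL\<^esub> (SL_scalars #>\<^bsub>SL\<^esub> B)"
    using normal.rcos_sum[OF normal_SL_scalars, of A B] assms
    by (simp add: PSL_def FactGroup_def SL_def lift_det)
  then show ?thesis
    using assms subgroup.m_closed[OF subgroup] by (simp add: lift_iff det_mul)
qed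

lemma lift_one: "mat 1 \<in> lifts"
proof -
  interpret group "SL :: (real ^ 'n ^ 'n) monoid" by (rule group_SL)
  have "\<one>\<^bsub>PSL\<^esub> = SL_scalars #>\<^bsub>SL\<^esub> (\<one>\<^bsub>SL\<^esub> :: real ^ 'n ^ 'n)"
    using coset_mult_one[of SL_scalars] by (auto simp: PSL_def FactGroup_def SL_scalars_def)
  then show ?thesis
    using subgroup.one_closed[OF subgroup] by (simp add: lift_iff SL_def)
qed

lemma lift_inv:
  assumes "A \<in> lifts"
  shows "matrix_inv A \<in> lifts" "matrix_inv A ** A = mat 1" "A ** matrix_inv A = mat 1"
    "SL_scalars #>\<^bsub>SL\<^esub> (matrix_inv A) = inv\<^bsub>PSL\<^esub> (SL_scalars #>\<^bsub>SL\<^esub> A)"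
proof -
  interpret group "PSL :: (real ^ 'n ^ 'n) set monoid" by (rule group_PSL)
  interpret SL: group "SL :: (real ^ 'n ^ 'n) monoid" by (rule group_SL)
  have "invertible A" using lift_det[OF assms] by (simp add: invertible_det_nz)
  then show inv: "matrix_inv A ** A = mat 1" "A ** matrix_inv A = mat 1"
    by (auto intro: matrix_inv_mult)
  then have det: "det (matrix_inv A) = 1"
    using det_mul[of A "matrix_inv A"] lift_det[OF assms] by simp
  have "\<one>\<^bsub>PSL\<^esub> = SL_scalars #>\<^bsub>SL\<^esub> (\<one>\<^bsub>SL\<^esub> :: real ^ 'n ^ 'n)"
    using SL.coset_mult_one[of SL_scalars] by (auto simp: PSL_def FactGroup_def SL_scalars_def)
  moreover have "(SL_scalars #>\<^bsub>SL\<^esub> (matrix_inv A)) \<otimes>\<^bsub>PSL\<^esub> (SL_scalars #>\<^bsub>SL\<^esub> A) = SL_scalars #>\<^bsub>SL\<^esub> (matrix_inv A ** A)"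
    using normal.rcos_sum[OF normal_SL_scalars, of "matrix_inv A" A] det lift_det[OF assms]
    by (simp add: PSL_def FactGroup_def SL_def)
  ultimately have "inv\<^bsub>PSL\<^esub> (SL_scalars #>\<^bsub>SL\<^esub> A) = SL_scalars #>\<^bsub>SL\<^esub> (matrix_inv A)"
    using det lift_det[OF assms] inv
    by (intro inv_equality PSL_class_mem) (auto simp: SL_def)
  then show "SL_scalars #>\<^bsub>SL\<^esub> (matrix_inv A) = inv\<^bsub>PSL\<^esub> (SL_scalars #>\<^bsub>SL\<^esub> A)" ..
  with det show "matrix_inv A \<in> lifts"
    using lift_class[OF assms] subgroup.m_inv_closed[OF subgroup] by (simp add: lift_iff)
qed

end

locale zariski_dense_subgroup = PSL_subgroup \<Gamma> for \<Gamma> :: "(real ^ 'n::finite ^ 'n) set set" +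
  assumes dense: "zariski_dense_PSL \<Gamma>"
begin

text \<open>
  Homogeneity serves twice: it makes the zero set invariant under scalars, so that it descends to
  \<open>PSL\<close>, and it passes from \<open>SL\<close> to all matrices of positive determinant. As \<open>A + s\<close> has
  positive determinant for all large \<open>s\<close>, the polynomial \<open>s \<mapsto> p (A + s)\<close> vanishes identically.
\<close>

lemma homogeneous_polynomial_vanishes:
  assumes p: "real_polynomial_function p" and hom: "\<And>c A. c \<noteq> 0 \<Longrightarrow> p (c *\<^sub>R A) = c ^ d * p A"
    and zero: "\<And>A. A \<in> lifts \<Longrightarrow> p A = 0"
  shows "p A = 0"
proof -
  define S where "S = {g \<in> carrier PSL. \<forall>A\<in>g. p A = 0}"
  have "\<Union>S = {A \<in> carrier SL. \<forall>q\<in>{p}. q A = 0}"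
  proof (intro equalityI subsetI)
    fix A assume "A \<in> \<Union>S"
    then show "A \<in> {A \<in> carrier SL. \<forall>q\<in>{p}. q A = 0}"
      using PSL_class_of_member(1) by (auto simp: S_def)
  next
    fix A assume A: "A \<in> {A \<in> carrier SL. \<forall>q\<in>{p}. q A = 0}"
    have "p (c *\<^sub>R A) = 0" if "det (c *\<^sub>R A) = 1" for c
    proof -
      have "c \<noteq> 0" using that[unfolded det_scaleR] by (auto simp: power_0_left)
      then show ?thesis using A hom[of c A] by simp
    qed
    with A have "\<forall>B\<in>SL_scalars #>\<^bsub>SL\<^esub> A. p B = 0"
      by (auto simp: mem_PSL_class_iff) (auto simp: SL_def)
    with A show "A \<in> \<Union>S"
      using PSL_class_mem[of A] by (auto simp: S_def)
  qed
  with p have "zariski_closed_PSL S"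
    unfolding zariski_closed_PSL_def by (intro conjI exI[of _ "{p}"]) (auto simp: S_def)
  moreover have "\<Gamma> \<subseteq> S"
    using zero subgroup.subset[OF subgroup] by (auto simp: S_def lifts_def)
  ultimately have "carrier PSL \<subseteq> S"
    using dense by (auto simp: zariski_dense_PSL_def)
  then have SL: "p B = 0" if "det B = 1" for B
    using that PSL_class_mem[of B] by (auto simp: S_def SL_def)
  have pos: "p B = 0" if B: "det B > 0" for B
  proof -
    define c where "c = root CARD('n) (det B)"
    have c: "c > 0" "c ^ CARD('n) = det B"
      using B by (auto simp: c_def intro!: real_root_gt_zero real_root_pow_pos zero_less_card_finite)
    then have "det (inverse c *\<^sub>R B) = 1"
      using B by (simp add: det_scaleR power_inverse)
    then have "p (inverse c *\<^sub>R B) = 0"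
      by (rule SL)
    then have "p (c *\<^sub>R inverse c *\<^sub>R B) = 0"
      using c(1) by (simp only: hom[of c] less_imp_neq[symmetric] not_False_eq_True mult_zero_right)
    with c show ?thesis by simp
  qed
  have "((\<lambda>s::real. det (mat 1 + inverse s *\<^sub>R A)) \<longlongrightarrow> det (mat 1 + 0 *\<^sub>R A)) at_top"
    by (intro continuous_on_tendsto_compose[OF continuous_det] tendsto_intros tendsto_inverse_0_at_top filterlim_ident) auto
  then have "\<forall>\<^sub>F s in at_top. det (mat 1 + inverse s *\<^sub>R A) > 0"
    by (rule order_tendstoD) simp
  then have "\<forall>\<^sub>F s in at_top. p (A + s *\<^sub>R mat 1) = 0"
    using eventually_gt_at_top[of 0]
  proof eventually_elim
    case (elim s)
    have "p (s *\<^sub>R (mat 1 + inverse s *\<^sub>R A)) = 0"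
      using elim pos hom by simp
    with elim show ?case by (simp add: scaleR_add_right add.commute)
  qed
  then obtain r where "\<And>s. s \<ge> r \<Longrightarrow> p (A + s *\<^sub>R mat 1) = 0"
    by (auto simp: eventually_at_top_linorder)
  then have "{r..} \<subseteq> {s. p (A + s *\<^sub>R mat 1) = 0}" by auto
  then have "infinite {s. p (A + s *\<^sub>R mat 1) = 0}"
    using infinite_Ici finite_subset by blast
  from real_polynomial_zero_of_infinite_zeros[OF real_polynomial_function_line[OF p] this, of 0]
  show ?thesis by simp
qed

end

section \<open>Semigroups of similarities\<close>

lemma bounded_bilinear_matrix_mult:
  "bounded_bilinear ((**) :: real ^ 'n::finite ^ 'm::finite \<Rightarrow> real ^ 'p::finite ^ 'n \<Rightarrow> real ^ 'p ^ 'm)"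
  unfolding bilinear_conv_bounded_bilinear[symmetric] bilinear_def
  by (auto intro!: linearI simp: matrix_matrix_mult_def vec_eq_iff sum.distrib distrib_left distrib_right
      sum_distrib_left mult_ac)

lemmas tendsto_matrix_mult [tendsto_intros] =
  bounded_bilinear.tendsto[OF bounded_bilinear_matrix_mult]
lemmas continuous_on_matrix_mult [continuous_intros] =
  bounded_bilinear.continuous_on[OF bounded_bilinear_matrix_mult]

lemma linear_transpose: "linear (transpose :: real ^ 'n::finite ^ 'm::finite \<Rightarrow> real ^ 'm ^ 'n)"
  by (rule linearI) (auto simp: transpose_def vec_eq_iff)

lemmas continuous_on_transpose [continuous_intros] =
  bounded_linear.continuous_on[OF linear_transpose[unfolded linear_conv_bounded_linear]]

text \<open>
  The function \<open>f x\<close>, the largest norm on the orbit of \<open>x\<close>, does not increase along the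
  semigroup, so the semigroup moves a minimiser to a minimiser. By the parallelogram law and
  injectivity, \<open>f\<close> has only one minimiser on the convex set \<open>C\<close>.
\<close>

lemma compact_semigroup_fixed_point:
  fixes T :: "'k::topological_space \<Rightarrow> 'a::euclidean_space \<Rightarrow> 'a"
  assumes J: "compact J" "J \<noteq> {}"
    and lin: "\<And>k. k \<in> J \<Longrightarrow> linear (T k)"
    and cont: "continuous_on (J \<times> UNIV) (\<lambda>(k, x). T k x)"
    and comp: "\<And>j k. j \<in> J \<Longrightarrow> k \<in> J \<Longrightarrow> \<exists>l\<in>J. \<forall>x. T j (T k x) = T l x"
    and C: "compact C" "convex C" "C \<noteq> {}" "\<And>k x. k \<in> J \<Longrightarrow> x \<in> C \<Longrightarrow> T k x \<in> C"
    and inj: "\<And>k x y. k \<in> J \<Longrightarrow> x \<in> C \<Longrightarrow> y \<in> C \<Longrightarrow> T k x = T k y \<Longrightarrow> x = y"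
  obtains x where "x \<in> C" "\<And>k. k \<in> J \<Longrightarrow> T k x = x"
proof -
  have "compact ((\<lambda>(k, x). T k x) ` (J \<times> sphere 0 1))"
    by (intro compact_continuous_image continuous_on_subset[OF cont] compact_Times J) auto
  from compact_imp_bounded[OF this] obtain B where
    B0: "B > 0" and B1: "\<forall>z\<in>(\<lambda>(k, x). T k x) ` (J \<times> sphere 0 1). norm z \<le> B"
    unfolding bounded_pos by blast
  have B: "norm (T k x) \<le> B" if "k \<in> J" "norm x = 1" for k x
    using B1 that by auto
  have TB: "norm (T k x) \<le> B * norm x" if k: "k \<in> J" for k x
  proof (cases "x = 0")
    case False
    have "norm (T k (x /\<^sub>R norm x)) \<le> B" using False by (intro B k) simp
    then show ?thesis
      using False by (simp add: linear_cmul[OF lin[OF k]] field_simps)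
  qed (simp add: linear_0[OF lin[OF k]])
  define f where "f x = (SUP k\<in>J. norm (T k x))" for x
  have bdd: "bdd_above ((\<lambda>k. norm (T k x)) ` J)" for x
    using TB by (auto intro!: bdd_aboveI[of _ "B * norm x"])
  have f_upper: "norm (T k x) \<le> f x" if "k \<in> J" for k x
    unfolding f_def by (intro cSUP_upper that bdd)
  have f_attained: "\<exists>k\<in>J. f x = norm (T k x)" for x
  proof -
    have "continuous_on J (\<lambda>k. (k, x))"
      by (intro continuous_intros)
    from continuous_on_compose2[OF cont this] have "continuous_on J (\<lambda>k. T k x)"
      by auto
    then have "continuous_on J (\<lambda>k. norm (T k x))"
      by (rule continuous_on_norm)
    from continuous_attains_sup[OF J this] obtain k where k: "k \<in> J" "\<And>j. j \<in> J \<Longrightarrow> norm (T j x) \<le> norm (T k x)"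
      by blast
    then have "f x \<le> norm (T k x)"
      unfolding f_def by (intro cSUP_least J)
    with f_upper[OF k(1)] k(1) show ?thesis by (metis order.antisym)
  qed
  have lip: "f x \<le> f y + B * dist x y" for x y
  proof -
    obtain k where k: "k \<in> J" "f x = norm (T k x)" using f_attained by blast
    have "T k x = T k y + T k (x - y)"
      by (simp add: linear_diff[OF lin[OF k(1)]])
    then have "norm (T k x) \<le> norm (T k y) + norm (T k (x - y))"
      by (metis norm_triangle_ineq)
    also have "\<dots> \<le> f y + B * dist x y"
      unfolding dist_norm by (intro add_mono f_upper TB k)
    finally show ?thesis by (simp add: k)
  qed
  have "B-lipschitz_on C f"
  proof (rule lipschitz_onI)
    fix x y
    show "dist (f x) (f y) \<le> B * dist x y"
      using lip[of x y] lip[of y x] by (auto simp: dist_real_def dist_commute abs_le_iff)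
  qed (use B0 in simp)
  then have "continuous_on C f" by (rule lipschitz_on_continuous_on)
  from continuous_attains_inf[OF C(1,3) this] obtain x where x: "x \<in> C" "\<And>y. y \<in> C \<Longrightarrow> f x \<le> f y"
    by blast
  show thesis
  proof (rule that[OF x(1)])
    fix k assume k: "k \<in> J"
    define y where "y = T k x"
    have y: "y \<in> C" using C(4)[OF k x(1)] by (simp add: y_def)
    have fy: "f y \<le> f x"
    proof -
      obtain j where j: "j \<in> J" "f y = norm (T j y)" using f_attained by blast
      then obtain l where "l \<in> J" "T j y = T l x" using comp[OF j(1) k] by (auto simp: y_def)
      with j show ?thesis using f_upper by metis
    qed
    define z where "z = (1/2) *\<^sub>R x + (1/2) *\<^sub>R y"
    have "z \<in> C" unfolding z_def by (intro convexD[OF C(2)] x y) auto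
    obtain j where j: "j \<in> J" "f z = norm (T j z)" using f_attained by blast
    have "T j z = (1/2) *\<^sub>R (T j x + T j y)"
      by (simp add: z_def linear_add[OF lin[OF j(1)]] linear_cmul[OF lin[OF j(1)]] scaleR_add_right)
    then have "(f z)\<^sup>2 = (norm (T j x + T j y))\<^sup>2 / 4"
      by (simp add: j power_divide)
    also have "\<dots> = ((norm (T j x))\<^sup>2 + (norm (T j y))\<^sup>2) / 2 - (norm (T j x - T j y))\<^sup>2 / 4"
      by (simp add: power2_norm_eq_inner inner_add inner_diff inner_commute field_simps)
    also have "\<dots> \<le> ((f x)\<^sup>2 + (f x)\<^sup>2) / 2 - (norm (T j x - T j y))\<^sup>2 / 4"
      using f_upper[OF j(1), of x] order_trans[OF f_upper[OF j(1), of y] fy]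
      by (intro diff_right_mono divide_right_mono add_mono power_mono) auto
    finally have "(norm (T j x - T j y))\<^sup>2 / 4 \<le> (f x)\<^sup>2 - (f z)\<^sup>2" by simp
    moreover have "(f x)\<^sup>2 \<le> (f z)\<^sup>2"
    proof (rule power_mono[OF x(2)[OF \<open>z \<in> C\<close>]])
      show "0 \<le> f x" using f_attained[of x] by auto
    qed
    ultimately have "(norm (T j x - T j y))\<^sup>2 \<le> 0" by linarith
    then have "T j x = T j y" by simp
    then show "T k x = x" using inj[OF j(1) x(1) y] by (simp add: y_def)
  qed
qed


lemma matrix_diff_ldistrib: "A ** (B - C) = A ** B - A ** C"
  for A :: "real ^ 'n::finite ^ 'm::finite" and B :: "real ^ 'p::finite ^ 'n"
  by (rule bounded_bilinear.diff_right[OF bounded_bilinear_matrix_mult])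

lemma matrix_diff_rdistrib: "(A - B) ** C = A ** C - B ** C"
  for A :: "real ^ 'n::finite ^ 'm::finite" and C :: "real ^ 'p::finite ^ 'n"
  by (rule bounded_bilinear.diff_left[OF bounded_bilinear_matrix_mult])

lemma matrix_add_rdistrib: "(A + B) ** C = A ** C + B ** C"
  for A :: "real ^ 'n::finite ^ 'm::finite" and C :: "real ^ 'p::finite ^ 'n"
  by (rule bounded_bilinear.add_left[OF bounded_bilinear_matrix_mult])

text \<open>
  The elements of \<open>S\<close> act on the range of the idempotent \<open>\<pi>\<close>, and \<open>d\<close> below is their
  determinant there: the determinant after extension by the identity on the kernel of \<open>\<pi>\<close>.
  Since no nonzero element of the closed cone \<open>S\<close> is singular on that range, the elements with
  \<open>\<bar>d s\<bar> = 1\<close> form a compact semigroup, and every nonzero element of \<open>S\<close> is a multiple of one of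
  them. A compact semigroup of linear maps preserves an inner product, so \<open>S\<close> consists
  of similarities.
\<close>

lemma nonsingular_cone_is_conformal:
  fixes S :: "(real ^ 'n::finite ^ 'n) set" and \<pi> :: "real ^ 'n ^ 'n"
  assumes closed: "closed S"
    and mult: "\<And>s t. s \<in> S \<Longrightarrow> t \<in> S \<Longrightarrow> s ** t \<in> S"
    and cone: "\<And>s c. s \<in> S \<Longrightarrow> c *\<^sub>R s \<in> S"
    and unit: "\<And>s. s \<in> S \<Longrightarrow> \<pi> ** s = s \<and> s ** \<pi> = s"
    and idem: "\<pi> ** \<pi> = \<pi>"
    and nonsing: "\<And>s x. s \<in> S \<Longrightarrow> s \<noteq> 0 \<Longrightarrow> s *v x = 0 \<Longrightarrow> \<pi> *v x = 0"
    and nontriv: "\<exists>s\<in>S. s \<noteq> 0"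
  obtains Q where "\<And>v. \<pi> *v v = v \<Longrightarrow> v \<noteq> 0 \<Longrightarrow> v \<bullet> (Q *v v) > 0"
    and "\<And>s. s \<in> S \<Longrightarrow> \<exists>c. transpose s ** Q ** s = c *\<^sub>R Q"
proof -
  define d where "d s = det (s + (mat 1 - \<pi>))" for s
  define \<delta> where "\<delta> c = d (c *\<^sub>R \<pi>)" for c
  have d_cont: "continuous_on UNIV d"
    unfolding d_def by (intro continuous_on_compose2[OF continuous_det] continuous_intros) auto
  have \<delta>_cont: "continuous_on UNIV \<delta>"
    unfolding \<delta>_def by (intro continuous_on_compose2[OF d_cont] continuous_intros) auto
  have d_mult: "d (s ** t) = d s * d t"
    if "s ** \<pi> = s" "\<pi> ** t = t" for s t
  proof -
    have "(s + (mat 1 - \<pi>)) ** (t + (mat 1 - \<pi>)) = s ** t + (mat 1 - \<pi>)"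
      using that idem
      by (simp add: matrix_add_ldistrib matrix_add_rdistrib matrix_diff_ldistrib matrix_diff_rdistrib)
    then show ?thesis by (simp add: d_def flip: det_mul)
  qed
  have d_scale: "d (c *\<^sub>R s) = \<delta> c * d s" if "\<pi> ** s = s" for c s
  proof -
    have "c *\<^sub>R s = (c *\<^sub>R \<pi>) ** s"
      by (metis that scalar_matrix_assoc)
    then show ?thesis
      unfolding \<delta>_def using d_mult[of "c *\<^sub>R \<pi>" s] that idem by (simp flip: scalar_matrix_assoc)
  qed
  have \<delta>_inverse: "\<delta> c * \<delta> (inverse c) = 1" if "c \<noteq> 0" for c
  proof -
    have "\<delta> c * \<delta> (inverse c) = d \<pi>"
      using d_scale[of "inverse c *\<^sub>R \<pi>" c] that idem by (simp add: \<delta>_def matrix_scalar_ac flip: scalar_matrix_assoc)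
    then show ?thesis by (simp add: d_def)
  qed
  obtain s0 where s0: "s0 \<in> S" "s0 \<noteq> 0" using nontriv by blast
  have \<delta>0: "\<delta> 0 = 0"
  proof -
    obtain x where "s0 *v x \<noteq> 0" using s0(2) by (metis matrix_eq matrix_vector_mult_0)
    moreover have "(mat 1 - \<pi>) *v (s0 *v x) = 0"
      using unit[OF s0(1)] by (simp add: matrix_vector_mul_assoc matrix_diff_rdistrib)
    ultimately have "\<not> invertible (mat 1 - \<pi>)"
      by (metis invertible_def matrix_left_invertible_ker)
    then show ?thesis by (simp add: \<delta>_def d_def invertible_det_nz)
  qed
  have \<delta>_small: "\<exists>r>0. \<forall>c. 0 < c \<longrightarrow> c < r \<longrightarrow> \<bar>\<delta> c\<bar> < e" if e: "e > 0" for e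
  proof -
    obtain r where "r > 0" "\<And>c. dist c 0 < r \<Longrightarrow> dist (\<delta> c) (\<delta> 0) < e"
      using \<delta>_cont e unfolding continuous_on_iff by blast
    then show ?thesis by (intro exI[of _ r]) (auto simp: \<delta>0 dist_real_def)
  qed
  have inj: "invertible (s + (mat 1 - \<pi>))" if s: "s \<in> S" "s \<noteq> 0" for s
  proof -
    have "x = 0" if x: "(s + (mat 1 - \<pi>)) *v x = 0" for x
    proof -
      have sum0: "s *v x + (x - \<pi> *v x) = 0"
        using x by (simp add: matrix_vector_mult_add_rdistrib matrix_vector_mult_diff_rdistrib)
      have "\<pi> *v (s *v x + (x - \<pi> *v x)) = s *v x"
        using unit[OF s(1)] idem
        by (simp add: matrix_vector_right_distrib matrix_vector_mult_diff_distrib matrix_vector_mul_assoc)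
      with sum0 have "s *v x = 0" by simp
      with nonsing[OF s] sum0 show ?thesis by simp
    qed
    then show ?thesis
      using matrix_left_invertible_ker invertible_left_inverse by blast
  qed
  have d_nz: "d s \<noteq> 0" if "s \<in> S" "s \<noteq> 0" for s
    using inj[OF that] by (simp add: d_def invertible_det_nz)
  define K where "K = {s \<in> S. \<bar>d s\<bar> = 1}"
  have K_nz: "s \<noteq> 0" if "s \<in> K" for s
  proof
    assume "s = 0"
    with that \<delta>0 show False by (simp add: K_def \<delta>_def)
  qed
  have normalise: "\<exists>c>0. c *\<^sub>R s \<in> K" if s: "s \<in> S" "s \<noteq> 0" for s
  proof -
    have pos: "\<bar>d s\<bar> > 0" using d_nz[OF s] by simp
    obtain r where r: "r > 0" "\<And>c. 0 < c \<Longrightarrow> c < r \<Longrightarrow> \<bar>\<delta> c\<bar> < \<bar>d s\<bar>"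
      using \<delta>_small[OF pos] by blast
    \<comment> \<open>Small near 0, \<open>\<delta>\<close> is large near infinity, because \<open>\<delta> c\<close> and \<open>\<delta> (inverse c)\<close> are inverse.\<close>
    define b where "b = inverse (r / 2)"
    have b: "b > 0" using r by (simp add: b_def)
    have "\<bar>\<delta> (inverse b)\<bar> < \<bar>d s\<bar>" using r by (simp add: b_def)
    moreover have "\<bar>\<delta> b\<bar> * \<bar>\<delta> (inverse b)\<bar> = 1"
      using \<delta>_inverse[of b] b by (simp flip: abs_mult)
    ultimately have "1 \<le> \<bar>\<delta> b\<bar> * \<bar>d s\<bar>"
      by (metis abs_ge_zero less_eq_real_def mult_left_mono)
    then have "\<exists>c\<ge>0. c \<le> b \<and> \<bar>\<delta> c\<bar> * \<bar>d s\<bar> = 1"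
      using b \<delta>0 by (intro IVT' continuous_intros continuous_on_subset[OF \<delta>_cont]) auto
    then obtain c where c: "0 \<le> c" "\<bar>\<delta> c\<bar> * \<bar>d s\<bar> = 1" by blast
    then have "c \<noteq> 0" using \<delta>0 by auto
    with c s unit[OF s(1)] have "c > 0 \<and> c *\<^sub>R s \<in> K"
      by (auto simp: K_def cone d_scale abs_mult)
    then show ?thesis by blast
  qed
  have K_compact: "compact K"
  proof -
    have "closed ((\<lambda>s. \<bar>d s\<bar>) -` {1})"
      by (intro closed_vimage continuous_intros continuous_on_subset[OF d_cont]) auto
    moreover have "K = S \<inter> (\<lambda>s. \<bar>d s\<bar>) -` {1}" by (auto simp: K_def)
    ultimately have "closed K" using closed by auto
    moreover have "bounded K"
    proof -
      define S1 where "S1 = S \<inter> sphere 0 1"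
      have "compact S1" unfolding S1_def using closed by (intro closed_Int_compact) auto
      moreover have "S1 \<noteq> {}"
        using s0 cone[OF s0(1), of "inverse (norm s0)"] by (auto simp: S1_def)
      moreover have "continuous_on S1 (\<lambda>s. \<bar>d s\<bar>)"
        by (intro continuous_intros continuous_on_subset[OF d_cont]) auto
      ultimately obtain s1 where s1: "s1 \<in> S1" "\<And>s. s \<in> S1 \<Longrightarrow> \<bar>d s1\<bar> \<le> \<bar>d s\<bar>"
        using continuous_attains_inf by metis
      have "s1 \<in> S" "s1 \<noteq> 0" using s1(1) by (auto simp: S1_def)
      then have "\<bar>d s1\<bar> > 0" using d_nz by simp
      from \<delta>_small[OF this] obtain r where r: "r > 0" "\<And>c. 0 < c \<Longrightarrow> c < r \<Longrightarrow> \<bar>\<delta> c\<bar> < \<bar>d s1\<bar>"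
        by blast
      have "norm s \<le> inverse r" if s: "s \<in> K" for s
      proof (rule ccontr)
        assume "\<not> norm s \<le> inverse r"
        then have "inverse (norm s) < r"
          using r(1) by (metis inverse_inverse_eq inverse_less_iff_less inverse_positive_iff_positive less_trans not_le)
        moreover have n: "norm s > 0" using K_nz[OF s] by simp
        ultimately have "\<bar>\<delta> (inverse (norm s))\<bar> < \<bar>d s1\<bar>" using r(2) by simp
        moreover have "s /\<^sub>R norm s \<in> S1" using s n cone by (auto simp: S1_def K_def)
        then have "\<bar>d s1\<bar> \<le> \<bar>d (s /\<^sub>R norm s)\<bar>" by (rule s1(2))
        then have "\<bar>d s1\<bar> \<le> \<bar>\<delta> (inverse (norm s))\<bar>"
          using s unit[of s] by (simp add: d_scale K_def abs_mult)
        ultimately show False by simp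
      qed
      then show ?thesis by (auto simp: bounded_iff)
    qed
    ultimately show ?thesis by (simp add: compact_eq_bounded_closed)
  qed
  have K_mult: "s ** t \<in> K" if "s \<in> K" "t \<in> K" for s t
    using that mult unit by (simp add: K_def d_mult abs_mult)
  define T where "T k Q = transpose k ** Q ** k" for k Q :: "real ^ 'n ^ 'n"
  have T_lin: "linear (T k)" for k
    unfolding T_def
    by (intro linearI) (simp_all add: matrix_add_ldistrib matrix_add_rdistrib matrix_scalar_ac flip: scalar_matrix_assoc)
  have T_comp: "T j (T k Q) = T (k ** j) Q" for j k Q
    by (simp add: T_def matrix_transpose_mul matrix_mul_assoc)
  have T_cont: "continuous_on (K \<times> UNIV) (\<lambda>(k, x). T k x)"
    unfolding T_def case_prod_unfold by (intro continuous_intros)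
  \<comment> \<open>Fixed points are sought among the forms that are positive definite on the range of \<open>\<pi>\<close>.\<close>
  define C where "C = convex hull ((\<lambda>k. T k (mat 1)) ` K)"
  have K_ne: "K \<noteq> {}" using normalise[OF s0] by auto
  have "compact ((\<lambda>k. T k (mat 1)) ` K)"
    unfolding T_def by (intro compact_continuous_image K_compact continuous_intros)
  then have C: "compact C" "convex C" "C \<noteq> {}"
    using K_ne by (auto simp: C_def compact_convex_hull)
  have TC: "T k Q \<in> C" if k: "k \<in> K" and Q: "Q \<in> C" for k Q
  proof -
    have "T k Q \<in> convex hull (T k ` (\<lambda>k. T k (mat 1)) ` K)"
      using Q unfolding C_def convex_hull_linear_image[OF T_lin, symmetric] by (rule imageI)
    also have "\<dots> \<subseteq> C"
      unfolding C_def by (rule hull_mono) (auto simp: T_comp K_mult[OF _ k])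
    finally show ?thesis .
  qed
  have Csupp: "transpose \<pi> ** Q = Q \<and> Q ** \<pi> = Q" if "Q \<in> C" for Q
  proof -
    let ?W = "{Q. transpose \<pi> ** Q = Q} \<inter> {Q. Q ** \<pi> = Q}"
    have "convex ?W"
      by (intro convex_Int subspace_imp_convex)
        (auto simp: subspace_def matrix_add_ldistrib matrix_add_rdistrib matrix_scalar_ac simp flip: scalar_matrix_assoc)
    moreover have "(\<lambda>k. T k (mat 1)) ` K \<subseteq> ?W"
    proof clarify
      fix k assume "k \<in> K"
      then have k: "k ** \<pi> = k" using unit by (simp add: K_def)
      then have "transpose \<pi> ** transpose k = transpose k"
        by (simp flip: matrix_transpose_mul)
      with k show "T k (mat 1) \<in> ?W"
        by (simp add: T_def matrix_mul_assoc) (simp flip: matrix_mul_assoc)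
    qed
    ultimately have "C \<subseteq> ?W" unfolding C_def by (rule hull_minimal[rotated])
    with that show ?thesis by blast
  qed
  have T_inj: "P = Q" if k: "k \<in> K" and PQ: "P \<in> C" "Q \<in> C" and eq: "T k P = T k Q" for k P Q
  proof -
    define D where "D = P - Q"
    define N where "N = k + (mat 1 - \<pi>)"
    have D: "transpose \<pi> ** D = D" "D ** \<pi> = D"
      using Csupp PQ by (auto simp: D_def matrix_diff_ldistrib matrix_diff_rdistrib)
    have "D ** N = D ** k"
      by (simp add: N_def matrix_add_ldistrib matrix_diff_ldistrib D)
    moreover have "transpose N ** D = transpose k ** D"
    proof -
      have "transpose N = transpose k + (mat 1 - transpose \<pi>)"
        by (simp add: N_def transpose_def vec_eq_iff mat_def)
      then show ?thesis by (simp add: matrix_add_rdistrib matrix_diff_rdistrib D)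
    qed
    ultimately have "transpose N ** D ** N = T k D"
      by (metis T_def matrix_mul_assoc)
    also have "\<dots> = 0"
      using eq by (simp add: D_def linear_diff[OF T_lin])
    finally have zero: "transpose N ** D ** N = 0" .
    have "invertible N" using inj[of k] k K_nz[OF k] by (simp add: N_def K_def)
    then obtain N' where N': "N ** N' = mat 1" by (auto simp: invertible_def)
    then have N'': "transpose N' ** transpose N = mat 1"
      by (metis matrix_transpose_mul transpose_mat)
    have "D = (transpose N' ** transpose N) ** D ** (N ** N')"
      by (simp add: N' N'')
    also have "\<dots> = transpose N' ** (transpose N ** D ** N) ** N'"
      by (simp only: matrix_mul_assoc)
    also have "\<dots> = 0" by (simp add: zero)
    finally show ?thesis by (simp add: D_def)
  qed
  obtain Q where Q: "Q \<in> C" "\<And>k. k \<in> K \<Longrightarrow> T k Q = Q"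
    by (rule compact_semigroup_fixed_point[OF K_compact K_ne T_lin T_cont _ C TC T_inj])
      (use T_comp K_mult in blast)+
  show thesis
  proof (rule that)
    fix v :: "real ^ 'n" assume v: "\<pi> *v v = v" "v \<noteq> 0"
    have "linear (\<lambda>Q. v \<bullet> (Q *v v))"
      by (intro linearI) (simp_all add: matrix_vector_mult_add_rdistrib inner_add_right flip: scaleR_matrix_vector_assoc)
    then have "convex ((\<lambda>Q. v \<bullet> (Q *v v)) -` {0<..})"
      by (rule convex_linear_vimage) auto
    moreover have "(\<lambda>k. T k (mat 1)) ` K \<subseteq> (\<lambda>Q. v \<bullet> (Q *v v)) -` {0<..}"
    proof clarify
      fix k assume k: "k \<in> K"
      have "k *v v \<noteq> 0"
        using nonsing[of k v] k K_nz[OF k] v by (auto simp: K_def)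
      moreover have "v \<bullet> (T k (mat 1) *v v) = (k *v v) \<bullet> (k *v v)"
        by (simp add: T_def matrix_vector_mul_assoc[symmetric] inner_commute[of v] dot_lmul_matrix)
      ultimately show "T k (mat 1) \<in> (\<lambda>Q. v \<bullet> (Q *v v)) -` {0<..}" by simp
    qed
    ultimately have "C \<subseteq> (\<lambda>Q. v \<bullet> (Q *v v)) -` {0<..}"
      unfolding C_def by (rule hull_minimal[rotated])
    with Q(1) show "v \<bullet> (Q *v v) > 0" by auto
  next
    fix s assume s: "s \<in> S"
    show "\<exists>c. transpose s ** Q ** s = c *\<^sub>R Q"
    proof (cases "s = 0")
      case True
      then show ?thesis by (intro exI[of _ 0]) simp
    next
      case False
      from normalise[OF s this] obtain c where c: "c > 0" "c *\<^sub>R s \<in> K" by blast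
      have "T (c *\<^sub>R s) Q = (c * c) *\<^sub>R T s Q"
        by (simp add: T_def linear_cmul[OF linear_transpose] matrix_scalar_ac flip: scalar_matrix_assoc)
      then have "Q = (c * c) *\<^sub>R T s Q" using Q(2)[OF c(2)] by simp
      then have "inverse (c * c) *\<^sub>R Q = T s Q"
        by (metis c(1) less_irrefl mult_eq_0_iff scaleR_left_imp_eq scaleR_scaleR left_inverse scaleR_one)
      then show ?thesis unfolding T_def by metis
    qed
  qed
qed

section \<open>Rank one limits of a Zariski dense subgroup\<close>

definition rank_one :: "real ^ 'n::finite \<Rightarrow> real ^ 'n \<Rightarrow> real ^ 'n ^ 'n" where
  "rank_one a k = (\<chi> i j. a $ i * k $ j)"

lemma rank_one_mult_vector [simp]: "rank_one a k *v x = (k \<bullet> x) *\<^sub>R a"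
  by (simp add: rank_one_def matrix_vector_mult_def vec_eq_iff inner_vec_def sum_distrib_left mult_ac)

lemma rank_one_eq_0_iff [simp]: "rank_one a k = 0 \<longleftrightarrow> a = 0 \<or> k = 0"
  by (auto simp: rank_one_def vec_eq_iff)

lemma mult_rank_one: "A ** rank_one a k = rank_one (A *v a) k"
  by (simp add: matrix_eq matrix_vector_mult_scaleR flip: matrix_vector_mul_assoc)

lemma rank_one_mult: "rank_one a k ** A = rank_one a (k v* A)"
  by (simp add: matrix_eq dot_lmul_matrix flip: matrix_vector_mul_assoc)

text \<open>
  A basis of \<open>V\<close> that contains \<open>v\<close> loses an element under \<open>f\<close>.
\<close>

lemma dim_image_less:
  fixes f :: "'a::euclidean_space \<Rightarrow> 'b::euclidean_space"
  assumes f: "linear f" and v: "v \<in> V" "v \<noteq> 0" "f v = 0"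
  shows "dim (f ` V) < dim V"
proof -
  have "independent {v}" using v by simp
  then obtain B where B: "{v} \<subseteq> B" "B \<subseteq> V" "independent B" "V \<subseteq> span B"
    using maximal_independent_subset_extend[of "{v}" V] v by blast
  have fin: "finite B" using B(3) by (rule independent_imp_finite)
  have "f ` V \<subseteq> span (f ` B)"
    using B(4) by (metis f image_mono linear_span_image)
  also have "f ` B = insert 0 (f ` (B - {v}))"
    using B(1) v by auto
  finally have "f ` V \<subseteq> span (f ` (B - {v}))"
    by (simp add: span_insert_0)
  then have "dim (f ` V) \<le> card (f ` (B - {v}))"
    by (rule dim_le_card) (use fin in simp)
  also have "\<dots> \<le> card (B - {v})" by (rule card_image_le) (use fin in simp)
  also have "\<dots> < card B" using fin B(1) by (intro psubset_card_mono) auto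
  also have "card B = dim V" using B by (intro basis_card_eq_dim) auto
  finally show ?thesis .
qed

lemma rank_one_of_rank:
  fixes A :: "real ^ 'n::finite ^ 'n"
  assumes A: "A \<noteq> 0" and rank: "rank A < 2"
  obtains a k where "a \<noteq> 0" "k \<noteq> 0" "A = rank_one a k"
proof -
  have lin: "linear ((*v) A)" by simp
  have sub: "subspace (range ((*v) A))"
    by (intro linear_subspace_image lin subspace_UNIV)
  obtain a where a: "a \<in> range ((*v) A)" "a \<noteq> 0"
    using A by (metis matrix_eq matrix_vector_mult_0 rangeI)
  have "span {a} = range ((*v) A)"
    by (rule subspace_dim_equal)
      (use a rank sub in \<open>auto simp: dim_span dim_singleton span_minimal rank_dim_range\<close>)
  then have "\<exists>c. A *v x = c *\<^sub>R a" for x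
    by (metis rangeI span_singleton rangeE)
  then obtain c where c: "\<And>x. A *v x = c x *\<^sub>R a" by metis
  define k where "k = (a v* A) /\<^sub>R (a \<bullet> a)"
  have "k \<bullet> x = c x" for x
    using a by (simp add: k_def dot_lmul_matrix c)
  then have "A = rank_one a k" by (simp add: matrix_eq c)
  with A a show thesis by (intro that[of a k]) auto
qed

lemma real_polynomial_function_inner:
  fixes f g :: "'a::real_normed_vector \<Rightarrow> 'b::euclidean_space"
  assumes "bounded_linear f" "bounded_linear g"
  shows "real_polynomial_function (\<lambda>x. f x \<bullet> g x)"
proof -
  have "(\<lambda>x. f x \<bullet> g x) = (\<lambda>x. \<Sum>b\<in>Basis. (f x \<bullet> b) * (g x \<bullet> b))"
    by (rule ext) (rule euclidean_inner)
  then show ?thesis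
    by (simp only:) (intro real_polynomial_function_sum real_polynomial_function.intros(4)
      real_polynomial_function.intros(1) bounded_linear_compose[OF bounded_linear_inner_left] assms finite_Basis)
qed

context zariski_dense_subgroup
begin

text \<open>
  The scalars allow sequences in the group that tend to infinity to have nonzero limits here.
\<close>

definition limits :: "(real ^ 'n ^ 'n) set" where
  "limits = closure {c *\<^sub>R A | c A. A \<in> lifts}"

lemma lifts_subset_limits: "A \<in> lifts \<Longrightarrow> A \<in> limits"
  unfolding limits_def by (intro subsetD[OF closure_subset]) (auto intro: exI[of _ 1])

lemma limits_scaleR:
  assumes "A \<in> limits"
  shows "c *\<^sub>R A \<in> limits"
proof -
  let ?L = "{c *\<^sub>R A | c A. A \<in> lifts}"
  have "(*\<^sub>R) c ` limits \<subseteq> limits"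
    unfolding limits_def
  proof (rule image_closure_subset)
    have "(*\<^sub>R) c ` ?L \<subseteq> ?L"
      by (auto simp: scaleR_scaleR) blast
    then show "(*\<^sub>R) c ` ?L \<subseteq> closure ?L"
      by (rule order_trans[OF _ closure_subset])
  qed (intro continuous_intros closed_closure)+
  with assms show ?thesis by blast
qed

lemma limits_mult:
  assumes "A \<in> limits" "B \<in> limits"
  shows "A ** B \<in> limits"
proof -
  let ?L = "{c *\<^sub>R A | c A. A \<in> lifts}"
  have "(c *\<^sub>R C) ** (d *\<^sub>R D) = (c * d) *\<^sub>R (C ** D)" for c d and C D :: "real ^ 'n ^ 'n"
    by (simp add: matrix_scalar_ac flip: scalar_matrix_assoc)
  then have L: "C ** D \<in> ?L" if "C \<in> ?L" "D \<in> ?L" for C D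
    using that lift_mult by blast
  have 1: "C ** B \<in> limits" if C: "C \<in> ?L" for C
  proof -
    have "(**) C ` limits \<subseteq> limits"
      unfolding limits_def
    proof (rule image_closure_subset)
      show "(**) C ` ?L \<subseteq> closure ?L"
        by (rule order_trans[OF _ closure_subset]) (intro image_subsetI L[OF C])
    qed (intro continuous_intros closed_closure)+
    with assms show ?thesis by blast
  qed
  have "(\<lambda>A. A ** B) ` limits \<subseteq> limits"
    unfolding limits_def
  proof (rule image_closure_subset)
    show "(\<lambda>A. A ** B) ` ?L \<subseteq> closure ?L"
      by (intro image_subsetI 1[unfolded limits_def])
  qed (intro continuous_intros closed_closure)+
  with assms show ?thesis by blast
qed

text \<open>
  Take a nonzero limit \<open>\<tau>\<close> of minimal rank, with range \<open>V\<close>. For a limit \<open>m\<close>, the map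
  \<open>\<tau> m\<close> of \<open>V\<close> to itself is zero or invertible, by minimality; hence these maps are
  similarities of \<open>V\<close> for some inner product. That is a polynomial condition on \<open>m\<close>, so by
  density it holds for every matrix \<open>m\<close>. If \<open>V\<close> contained two independent vectors, a
  matrix \<open>m\<close> that kills only one of them would violate it.
\<close>

lemma exists_rank_one_limit:
  obtains a k where "a \<noteq> 0" "k \<noteq> 0" "rank_one a k \<in> limits"
proof -
  have "mat 1 \<in> limits - {0}"
    using lifts_subset_limits[OF lift_one] by (auto simp: vec_eq_iff mat_def)
  then obtain \<tau> where \<tau>: "\<tau> \<in> limits" "\<tau> \<noteq> 0"
    and least: "\<And>m. m \<in> limits \<Longrightarrow> m \<noteq> 0 \<Longrightarrow> rank \<tau> \<le> rank m"
    using ex_has_least_nat[of "\<lambda>m. m \<in> limits - {0}" "mat 1" rank] by auto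
  have "rank \<tau> < 2"
  proof (rule ccontr)
    assume "\<not> rank \<tau> < 2"
    then have dim2: "dim (range ((*v) \<tau>)) \<ge> 2" by (simp add: rank_dim_range)
    obtain g where g: "linear g" "\<And>v. v \<in> range ((*v) \<tau>) \<Longrightarrow> \<tau> *v g v = v"
      using linear_exists_right_inverse_on[of "(*v) \<tau>" UNIV] by auto
    \<comment> \<open>An idempotent with the same range as \<open>\<tau>\<close>.\<close>
    define \<pi> where "\<pi> = \<tau> ** matrix g"
    have \<pi>_apply: "\<pi> *v x = \<tau> *v g x" for x
      by (simp add: \<pi>_def g(1) flip: matrix_vector_mul_assoc)
    have \<pi>\<tau>: "\<pi> ** \<tau> = \<tau>"
      by (simp add: matrix_eq \<pi>_apply g(2) flip: matrix_vector_mul_assoc)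
    then have idem: "\<pi> ** \<pi> = \<pi>"
      by (metis \<pi>_def matrix_mul_assoc)
    \<comment> \<open>\<open>S0\<close> need not be closed, but minimality of the rank applies to its closure \<open>S\<close> too, since
      \<open>s ** \<tau>\<close> is a limit for all \<open>s\<close> in \<open>S\<close>.\<close>
    define S0 where "S0 = {\<tau> ** m ** \<pi> | m. m \<in> limits}"
    define S where "S = closure S0"
    have S0S: "S0 \<subseteq> S" unfolding S_def by (rule closure_subset)
    have mult0: "s ** t \<in> S0" if st: "s \<in> S0" "t \<in> S0" for s t
    proof -
      obtain m m' where m: "m \<in> limits" "m' \<in> limits" "s = \<tau> ** m ** \<pi>" "t = \<tau> ** m' ** \<pi>"
        using st by (auto simp: S0_def)
      have "s ** t = \<tau> ** m ** (\<pi> ** \<tau>) ** m' ** \<pi>"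
        by (simp add: m matrix_mul_assoc)
      also have "\<dots> = \<tau> ** (m ** \<tau> ** m') ** \<pi>"
        by (simp add: \<pi>\<tau> matrix_mul_assoc)
      finally show ?thesis
        using m \<tau>(1) by (auto simp: S0_def intro!: limits_mult)
    qed
    have mult: "s ** t \<in> S" if st: "s \<in> S" "t \<in> S" for s t
    proof -
      have 1: "u ** t \<in> S" if u: "u \<in> S0" for u
      proof -
        have "(**) u ` S \<subseteq> S"
          unfolding S_def
          by (rule image_closure_subset)
            (use mult0[OF u] closure_subset in \<open>auto intro!: continuous_intros\<close>)
        with st show ?thesis by blast
      qed
      have "(\<lambda>s. s ** t) ` S \<subseteq> S"
        unfolding S_def
        by (rule image_closure_subset)
          (intro continuous_intros closed_closure image_subsetI 1[unfolded S_def])+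
      with st show ?thesis by blast
    qed
    have cone: "c *\<^sub>R s \<in> S" if "s \<in> S" for s c
    proof -
      have "c *\<^sub>R s \<in> S0" if s0: "s \<in> S0" for s
      proof -
        obtain m where "m \<in> limits" "s = \<tau> ** m ** \<pi>" using s0 by (auto simp: S0_def)
        then have "c *\<^sub>R s = \<tau> ** (c *\<^sub>R m) ** \<pi>" "c *\<^sub>R m \<in> limits"
          by (simp_all add: limits_scaleR matrix_scalar_ac scalar_matrix_assoc)
        then show ?thesis by (auto simp: S0_def)
      qed
      then have "(*\<^sub>R) c ` S \<subseteq> S"
        unfolding S_def
        by (intro image_closure_subset) (use closure_subset in \<open>auto intro!: continuous_intros\<close>)
      with that show ?thesis by blast
    qed
    have unit: "\<pi> ** s = s \<and> s ** \<pi> = s" if "s \<in> S" for s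
    proof -
      have "closed {s. \<pi> ** s = s \<and> s ** \<pi> = s}"
        by (intro closed_Collect_conj closed_Collect_eq continuous_intros)
      moreover have "S0 \<subseteq> {s. \<pi> ** s = s \<and> s ** \<pi> = s}"
        by (auto simp: S0_def matrix_mul_assoc \<pi>\<tau>) (simp add: idem flip: matrix_mul_assoc)
      ultimately have "S \<subseteq> {s. \<pi> ** s = s \<and> s ** \<pi> = s}"
        unfolding S_def by (rule closure_minimal[rotated])
      with that show ?thesis by blast
    qed
    have S\<tau>: "s ** \<tau> \<in> limits" if "s \<in> S" for s
    proof -
      have "(\<lambda>s. s ** \<tau>) ` S \<subseteq> limits"
        unfolding S_def
      proof (rule image_closure_subset)
        show "(\<lambda>s. s ** \<tau>) ` S0 \<subseteq> limits"
        proof clarify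
          fix s assume "s \<in> S0"
          then obtain m where m: "m \<in> limits" "s = \<tau> ** m ** \<pi>" by (auto simp: S0_def)
          then have "s ** \<tau> = \<tau> ** m ** \<tau>" by (simp add: \<pi>\<tau> flip: matrix_mul_assoc)
          with m \<tau>(1) show "s ** \<tau> \<in> limits" by (auto intro!: limits_mult)
        qed
      qed (auto intro!: continuous_intros simp: limits_def)
      with that show ?thesis by blast
    qed
    have nonsing: "\<pi> *v x = 0" if s: "s \<in> S" "s \<noteq> 0" "s *v x = 0" for s x
    proof (rule ccontr)
      assume nz: "\<pi> *v x \<noteq> 0"
      have "s ** \<tau> \<noteq> 0"
      proof
        assume "s ** \<tau> = 0"
        then have "s ** \<pi> = 0" by (simp add: \<pi>_def matrix_mul_assoc)
        with unit[OF s(1)] s(2) show False by simp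
      qed
      then have "rank \<tau> \<le> rank (s ** \<tau>)" using least S\<tau>[OF s(1)] by blast
      also have "rank (s ** \<tau>) = dim ((*v) s ` range ((*v) \<tau>))"
        by (simp add: rank_dim_range image_image matrix_vector_mul_assoc)
      also have "\<dots> < dim (range ((*v) \<tau>))"
      proof (rule dim_image_less)
        show "\<pi> *v x \<in> range ((*v) \<tau>)" by (simp add: \<pi>_apply)
        show "s *v (\<pi> *v x) = 0" using unit[OF s(1)] s(3) by (simp add: matrix_vector_mul_assoc)
      qed (use nz in auto)
      finally show False by (simp add: rank_dim_range)
    qed
    have fix_\<pi>: "\<pi> *v v = v" if "v \<in> range ((*v) \<tau>)" for v
      using that g(2) by (simp add: \<pi>_apply)
    obtain v where v: "v \<in> range ((*v) \<tau>)" "v \<noteq> 0"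
      using \<tau>(2) by (metis matrix_eq matrix_vector_mult_0 rangeI)
    have nontriv: "\<exists>s\<in>S. s \<noteq> 0"
    proof -
      \<comment> \<open>Some matrix in the group does not map the range of \<open>\<tau>\<close> into its kernel.\<close>
      have "\<exists>m\<in>lifts. \<tau> *v (m *v v) \<noteq> 0"
      proof (rule ccontr)
        assume "\<not> (\<exists>m\<in>lifts. \<tau> *v (m *v v) \<noteq> 0)"
        then have zero: "\<tau> *v (m *v v) = 0" if "m \<in> lifts" for m using that by blast
        obtain z where z: "\<tau> *v z \<noteq> 0" using \<tau>(2) by (metis matrix_eq matrix_vector_mult_0)
        define p where "p m = (\<tau> *v z) \<bullet> (\<tau> *v (m *v v))" for m :: "real ^ 'n ^ 'n"
        have "linear p"
          unfolding p_def by (intro linearI)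
            (simp_all add: matrix_vector_mult_add_rdistrib matrix_vector_right_distrib inner_add_right
              matrix_vector_mult_scaleR flip: scaleR_matrix_vector_assoc)
        have "p (rank_one z v) = 0"
        proof (rule homogeneous_polynomial_vanishes[where d = 1])
          show "real_polynomial_function p"
            using \<open>linear p\<close> by (intro real_polynomial_function.intros(1)) (simp add: linear_conv_bounded_linear)
          show "p (c *\<^sub>R A) = c ^ 1 * p A" for c A
            using linear_cmul[OF \<open>linear p\<close>] by simp
        qed (simp add: p_def zero)
        then show False using z v(2) by (simp add: p_def matrix_vector_mult_scaleR)
      qed
      then obtain m where m: "m \<in> lifts" "\<tau> *v (m *v v) \<noteq> 0" by blast
      then have "(\<tau> ** m ** \<pi>) *v v \<noteq> 0"
        using fix_\<pi>[OF v(1)] by (simp flip: matrix_vector_mul_assoc)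
      then have "\<tau> ** m ** \<pi> \<noteq> 0" by auto
      moreover have "\<tau> ** m ** \<pi> \<in> S0" using lifts_subset_limits[OF m(1)] by (auto simp: S0_def)
      ultimately show ?thesis using S0S by blast
    qed
    have closedS: "closed S" by (simp add: S_def)
    obtain Q where Qpos: "\<And>v. \<pi> *v v = v \<Longrightarrow> v \<noteq> 0 \<Longrightarrow> v \<bullet> (Q *v v) > 0"
      and Qsim: "\<And>s. s \<in> S \<Longrightarrow> \<exists>c. transpose s ** Q ** s = c *\<^sub>R Q"
      by (rule nonsingular_cone_is_conformal[of S \<pi>])
        (use closedS mult cone unit idem nonsing nontriv in blast)+
    define q where "q u = u \<bullet> (Q *v u)" for u
    obtain w where w: "w \<in> range ((*v) \<tau>)" "w \<notin> span {v}"
    proof -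
      have "\<not> range ((*v) \<tau>) \<subseteq> span {v}"
      proof
        assume "range ((*v) \<tau>) \<subseteq> span {v}"
        then have "dim (range ((*v) \<tau>)) \<le> card {v}" by (rule dim_le_card) simp
        with dim2 show False by simp
      qed
      then show thesis using that by blast
    qed
    define p where "p m = q (\<tau> *v (m *v v)) * q w - q (\<tau> *v (m *v w)) * q v" for m :: "real ^ 'n ^ 'n"
    have p_poly: "real_polynomial_function p"
    proof -
      have "linear (\<lambda>m :: real ^ 'n ^ 'n. \<tau> *v (m *v u))" for u
        by (intro linearI) (simp_all add: matrix_vector_mult_add_rdistrib matrix_vector_right_distrib
              matrix_vector_mult_scaleR flip: scaleR_matrix_vector_assoc)
      moreover have "linear (\<lambda>m :: real ^ 'n ^ 'n. Q *v (\<tau> *v (m *v u)))" for u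
        by (intro linearI) (simp_all add: matrix_vector_mult_add_rdistrib matrix_vector_right_distrib
              matrix_vector_mult_scaleR flip: scaleR_matrix_vector_assoc)
      ultimately show ?thesis
        unfolding p_def q_def
        by (intro real_polynomial_function_diff real_polynomial_function.intros(2,4) real_polynomial_function_inner)
          (auto simp: linear_conv_bounded_linear)
    qed
    have p_lifts: "p m = 0" if m: "m \<in> lifts" for m
    proof -
      have "\<tau> ** m ** \<pi> \<in> S"
        using lifts_subset_limits[OF m] S0S by (auto simp: S0_def)
      from Qsim[OF this] obtain c where c: "transpose (\<tau> ** m ** \<pi>) ** Q ** (\<tau> ** m ** \<pi>) = c *\<^sub>R Q" by blast
      have "q (\<tau> *v (m *v u)) = c * q u" if u: "u \<in> range ((*v) \<tau>)" for u
      proof -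
        have "\<tau> *v (m *v u) = (\<tau> ** m ** \<pi>) *v u"
          using fix_\<pi>[OF u] by (simp flip: matrix_vector_mul_assoc)
        then have "q (\<tau> *v (m *v u)) = u \<bullet> ((transpose (\<tau> ** m ** \<pi>) ** Q ** (\<tau> ** m ** \<pi>)) *v u)"
          by (simp add: q_def matrix_vector_mul_assoc[symmetric] inner_commute[of u] dot_lmul_matrix del: matrix_mul_assoc)
             (simp add: inner_commute)
        then show ?thesis by (simp add: c q_def flip: scaleR_matrix_vector_assoc)
      qed
      with v w show ?thesis by (simp add: p_def)
    qed
    have p_zero: "p m = 0" for m
      by (rule homogeneous_polynomial_vanishes[of p 2, OF p_poly _ p_lifts])
        (simp add: p_def q_def matrix_vector_mult_scaleR power2_eq_square algebra_simps flip: scaleR_matrix_vector_assoc)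
    define y where "y = w - ((w \<bullet> v) / (v \<bullet> v)) *\<^sub>R v"
    have "y \<noteq> 0"
    proof
      assume "y = 0"
      then have "w = ((w \<bullet> v) / (v \<bullet> v)) *\<^sub>R v" by (simp add: y_def)
      with w(2) show False by (metis span_base span_scale singletonI)
    qed
    moreover have yv: "y \<bullet> v = 0" using v(2) by (simp add: y_def inner_diff_left)
    moreover have "y \<bullet> w = y \<bullet> y"
      using yv by (simp add: y_def inner_diff_right inner_commute)
    ultimately have yw: "y \<bullet> w \<noteq> 0" by simp
    obtain z where z: "\<tau> *v z \<noteq> 0" using \<tau>(2) by (metis matrix_eq matrix_vector_mult_0)
    have "p (rank_one z y) = - ((y \<bullet> w)\<^sup>2 * q (\<tau> *v z) * q v)"
      by (simp add: p_def yv q_def matrix_vector_mult_scaleR power2_eq_square)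
    moreover have "q (\<tau> *v z) > 0" "q v > 0"
      unfolding q_def using z v fix_\<pi> by (auto intro!: Qpos)
    ultimately show False using p_zero[of "rank_one z y"] yw by simp
  qed
  from rank_one_of_rank[OF \<tau>(2) this] \<tau>(1) show thesis using that by blast
qed

end

lemma matrix_inv_eqI:
  fixes A B :: "real ^ 'n::finite ^ 'n"
  assumes "A ** B = mat 1"
  shows "matrix_inv A = B"
proof -
  have "B ** A = mat 1" using assms by (simp add: matrix_left_right_inverse)
  then have "invertible A" using assms by (auto simp: invertible_def)
  then have "matrix_inv A ** A = mat 1" by (rule matrix_inv_mult)
  then show ?thesis
    by (metis assms matrix_mul_assoc matrix_mul_lid matrix_mul_rid)
qed

text \<open>The adjugate matrix of \<open>A\<close>, applied to a vector; the entries are those of Cramer's rule.\<close>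

definition adjugate_apply :: "real ^ 'n::finite ^ 'n \<Rightarrow> real ^ 'n \<Rightarrow> real ^ 'n" where
  "adjugate_apply A w = (\<chi> k. det (\<chi> i j. if j = k then w $ i else A $ i $ j))"

lemma adjugate_apply_eq:
  assumes "A *v x = w" "det A \<noteq> 0"
  shows "adjugate_apply A w = det A *\<^sub>R x"
  using cramer[OF assms(2), of x w] assms by (simp add: adjugate_apply_def vec_eq_iff)

lemma adjugate_apply_scaleR:
  fixes A :: "real ^ 'n::finite ^ 'n"
  assumes "c \<noteq> 0"
  shows "adjugate_apply (c *\<^sub>R A) w = c ^ (CARD('n) - 1) *\<^sub>R adjugate_apply A w"
proof -
  have "c * adjugate_apply (c *\<^sub>R A) w $ k = c ^ CARD('n) * adjugate_apply A w $ k" for k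
  proof -
    let ?B = "\<lambda>A. (\<chi> i j. if j = k then w $ i else A $ i $ j) :: real ^ 'n ^ 'n"
    have 1: "transpose (?B (c *\<^sub>R A)) = (\<chi> i. if i = k then w else (\<chi> j. c * A $ j $ i))"
      by (simp add: transpose_def vec_eq_iff)
    have 2: "transpose (c *\<^sub>R ?B A) = (\<chi> i. if i = k then c *s w else (\<chi> j. c * A $ j $ i))"
      by (simp add: transpose_def vec_eq_iff)
    have "c * det (?B (c *\<^sub>R A)) = c * det (transpose (?B (c *\<^sub>R A)))"
      by (simp only: det_transpose)
    also have "\<dots> = det (transpose (c *\<^sub>R ?B A))"
      by (simp only: 1 2 det_row_mul)
    also have "\<dots> = c ^ CARD('n) * det (?B A)"
      by (simp only: det_transpose det_scaleR)
    finally show ?thesis by (simp add: adjugate_apply_def)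
  qed
  moreover have "c ^ CARD('n) = c * c ^ (CARD('n) - 1)"
    by (simp add: power_eq_if)
  ultimately show ?thesis using assms by (simp add: vec_eq_iff)
qed

lemma real_polynomial_adjugate_apply:
  "real_polynomial_function (\<lambda>A :: real ^ 'n::finite ^ 'n. adjugate_apply A w $ k)"
proof -
  have "real_polynomial_function (\<lambda>A :: real ^ 'n ^ 'n. if j = k then w $ i else A $ i $ j)" for i j
    by (cases "j = k") (auto intro: real_polynomial_matrix_entry real_polynomial_function.intros(2))
  then show ?thesis
    by (simp add: adjugate_apply_def) (intro real_polynomial_function_det, simp)
qed

context zariski_dense_subgroup
begin

text \<open>
  On \<open>SL\<close> the inverse is the adjugate, so the failure of the conclusion would be a homogeneous
  polynomial identity. The unipotent matrix \<open>1 + k w\<^sup>T\<close> refutes it when \<open>k\<close> and \<open>w\<close> are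
  orthogonal, and the identity matrix otherwise.
\<close>

lemma exists_lift_moving_both_ways:
  assumes k: "k \<noteq> 0" and w: "w \<noteq> 0"
  obtains g where "g \<in> lifts" "k \<bullet> (g *v w) \<noteq> 0" "k \<bullet> (matrix_inv g *v w) \<noteq> 0"
proof (rule ccontr)
  assume "\<not> thesis"
  with that have none: "(k \<bullet> (g *v w)) * (k \<bullet> (matrix_inv g *v w)) = 0" if "g \<in> lifts" for g
    using that by auto
  define p where "p A = (k \<bullet> (A *v w)) * (k \<bullet> adjugate_apply A w)" for A :: "real ^ 'n ^ 'n"
  have adj: "adjugate_apply A w = det A *\<^sub>R (B *v w)" if AB: "A ** B = mat 1" for A B :: "real ^ 'n ^ 'n"
  proof (rule adjugate_apply_eq)
    show "A *v (B *v w) = w" using AB by (simp add: matrix_vector_mul_assoc)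
    have "det A * det B = 1" using AB by (metis det_I det_mul)
    then show "det A \<noteq> 0" by auto
  qed
  have p_eq: "p A = (k \<bullet> (A *v w)) * (det A * (k \<bullet> (B *v w)))" if "A ** B = mat 1" for A B
    by (simp add: p_def adj[OF that])
  have "p A = 0" for A
  proof (rule homogeneous_polynomial_vanishes[where d = "CARD('n)"])
    have "linear (\<lambda>A :: real ^ 'n ^ 'n. k \<bullet> (A *v w))"
      by (intro linearI)
        (simp_all add: matrix_vector_mult_add_rdistrib inner_add_right flip: scaleR_matrix_vector_assoc)
    then have "real_polynomial_function (\<lambda>A :: real ^ 'n ^ 'n. k \<bullet> (A *v w))"
      by (intro real_polynomial_function.intros(1)) (simp add: linear_conv_bounded_linear)
    moreover have "real_polynomial_function (\<lambda>A :: real ^ 'n ^ 'n. k \<bullet> adjugate_apply A w)"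
      unfolding inner_vec_def inner_real_def
      by (intro real_polynomial_function_sum real_polynomial_function.intros(2,4) real_polynomial_adjugate_apply finite)
    ultimately show "real_polynomial_function p"
      unfolding p_def by (rule real_polynomial_function.intros(4))
    have "c ^ CARD('n) = c * c ^ (CARD('n) - 1)" for c :: real
      by (simp add: power_eq_if)
    then show "p (c *\<^sub>R A) = c ^ CARD('n) * p A" if "c \<noteq> 0" for c A
      by (simp add: p_def adjugate_apply_scaleR[OF that] mult_ac flip: scaleR_matrix_vector_assoc)
    show "p A = 0" if "A \<in> lifts" for A
      using none[OF that] p_eq[OF lift_inv(3)[OF that]] by auto
  qed
  note p0 = this
  have kw: "k \<bullet> w = 0"
    using p0[of "mat 1"] p_eq[of "mat 1" "mat 1"] by simp
  have "rank_one k w ** rank_one k w = 0"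
    using kw by (simp add: mult_rank_one inner_commute)
  then have inv: "(mat 1 + rank_one k w) ** (mat 1 - rank_one k w) = mat 1"
    by (simp add: matrix_add_rdistrib matrix_diff_ldistrib)
  have "det (mat 1 + rank_one k w) * det (mat 1 - rank_one k w) = 1"
    using inv by (metis det_I det_mul)
  then have "det (mat 1 + rank_one k w) \<noteq> 0" by auto
  moreover have "k \<bullet> ((mat 1 + rank_one k w) *v w) \<noteq> 0" "k \<bullet> ((mat 1 - rank_one k w) *v w) \<noteq> 0"
    using k w kw by (simp_all add: matrix_vector_mult_add_rdistrib matrix_vector_mult_diff_rdistrib inner_add_right inner_diff_right)
  ultimately show False using p0 p_eq[OF inv] by simp
qed

text \<open>
  If \<open>A i\<close>, rescaled, tends to a rank one matrix \<open>a k\<^sup>T\<close>, the rescaled inverses of \<open>A i\<close> have some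
  nonzero limit point \<open>\<sigma>\<close>, which may have larger rank. The conjugates \<open>A i g (A i)\<^sup>-\<^sup>1\<close> and
  their inverses \<open>A i g\<^sup>-\<^sup>1 (A i)\<^sup>-\<^sup>1\<close> then both have rank one limits, unless \<open>k\<^sup>T g \<sigma>\<close> or
  \<open>k\<^sup>T g\<^sup>-\<^sup>1 \<sigma>\<close> is zero.
\<close>

lemma exists_contracting_sequence:
  obtains a k l and u :: "nat \<Rightarrow> real ^ 'n ^ 'n" and \<alpha> :: "nat \<Rightarrow> real"
  where "a \<noteq> 0" "k \<noteq> 0" "l \<noteq> 0" "\<And>i. u i \<in> lifts"
    "(\<lambda>i. \<alpha> i *\<^sub>R u i) \<longlonglongrightarrow> rank_one a k"
    "(\<lambda>i. \<alpha> i *\<^sub>R matrix_inv (u i)) \<longlonglongrightarrow> rank_one a l"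
proof -
  obtain a k where ak: "a \<noteq> 0" "k \<noteq> 0" "rank_one a k \<in> limits"
    by (rule exists_rank_one_limit)
  then obtain s where s: "\<And>i. s i \<in> {c *\<^sub>R A | c A. A \<in> lifts}" "s \<longlonglongrightarrow> rank_one a k"
    unfolding limits_def closure_sequential by blast
  then have "\<forall>i. \<exists>c A. A \<in> lifts \<and> s i = c *\<^sub>R A" by blast
  then obtain c A where A: "\<And>i. A i \<in> lifts" and sA: "\<And>i. s i = c i *\<^sub>R A i" by metis
  define B where "B i = matrix_inv (A i) /\<^sub>R norm (matrix_inv (A i))" for i
  have "matrix_inv (A i) \<noteq> 0" for i
  proof
    assume "matrix_inv (A i) = 0"
    then have "(mat 1 :: real ^ 'n ^ 'n) = 0" using lift_inv(2)[OF A[of i]] by simp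
    then show False by (simp add: vec_eq_iff mat_def) (metis zero_neq_one)
  qed
  then have "B i \<in> sphere 0 1" for i by (simp add: B_def)
  moreover have "seq_compact (sphere (0 :: real ^ 'n ^ 'n) 1)"
    by (simp add: compact_imp_seq_compact)
  ultimately obtain \<sigma> r where \<sigma>: "\<sigma> \<in> sphere 0 1" and r: "strict_mono (r :: nat \<Rightarrow> nat)" "(B \<circ> r) \<longlonglongrightarrow> \<sigma>"
    by (meson seq_compactE)
  have "\<sigma> \<noteq> 0" using \<sigma> by auto
  then obtain z where z: "\<sigma> *v z \<noteq> 0" by (metis matrix_eq matrix_vector_mult_0)
  obtain g where g: "g \<in> lifts" "k \<bullet> (g *v (\<sigma> *v z)) \<noteq> 0" "k \<bullet> (matrix_inv g *v (\<sigma> *v z)) \<noteq> 0"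
    by (rule exists_lift_moving_both_ways[OF ak(2) z])
  define u where "u h i = A (r i) ** h ** matrix_inv (A (r i))" for h i
  define \<alpha> where "\<alpha> i = c (r i) / norm (matrix_inv (A (r i)))" for i
  have lim: "(\<lambda>i. \<alpha> i *\<^sub>R u h i) \<longlonglongrightarrow> rank_one a ((k v* h) v* \<sigma>)" for h
  proof -
    have "(\<lambda>i. (s \<circ> r) i ** h ** (B \<circ> r) i) \<longlonglongrightarrow> rank_one a k ** h ** \<sigma>"
      by (intro tendsto_matrix_mult tendsto_const LIMSEQ_subseq_LIMSEQ[OF s(2) r(1)] r(2))
    moreover have "(s \<circ> r) i ** h ** (B \<circ> r) i = \<alpha> i *\<^sub>R u h i" for i
      by (simp add: sA B_def u_def \<alpha>_def divide_inverse matrix_scalar_ac flip: scalar_matrix_assoc)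
    ultimately show ?thesis by (simp add: rank_one_mult)
  qed
  have u_lifts: "u h i \<in> lifts" if "h \<in> lifts" for h i
    unfolding u_def by (intro lift_mult A lift_inv(1) that)
  have u_inv: "matrix_inv (u g i) = u (matrix_inv g) i" for i
  proof (rule matrix_inv_eqI)
    let ?A = "A (r i)"
    have "u g i ** u (matrix_inv g) i = ?A ** g ** (matrix_inv ?A ** ?A) ** matrix_inv g ** matrix_inv ?A"
      by (simp only: u_def matrix_mul_assoc)
    also have "\<dots> = ?A ** (g ** matrix_inv g) ** matrix_inv ?A"
      by (simp add: lift_inv(2)[OF A] matrix_mul_assoc)
    also have "\<dots> = mat 1"
      by (simp add: lift_inv(3)[OF A] lift_inv(3)[OF g(1)])
    finally show "u g i ** u (matrix_inv g) i = mat 1" .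
  qed
  show thesis
  proof (rule that)
    show "a \<noteq> 0" by (rule ak)
    have "(k v* h) v* \<sigma> \<noteq> 0" if "k \<bullet> (h *v (\<sigma> *v z)) \<noteq> 0" for h
    proof
      assume "(k v* h) v* \<sigma> = 0"
      then have "((k v* h) v* \<sigma>) \<bullet> z = 0" by simp
      with that show False by (simp add: dot_lmul_matrix)
    qed
    with g show "(k v* g) v* \<sigma> \<noteq> 0" "(k v* matrix_inv g) v* \<sigma> \<noteq> 0" by blast+
    show "u g i \<in> lifts" for i by (rule u_lifts[OF g(1)])
    show "(\<lambda>i. \<alpha> i *\<^sub>R u g i) \<longlonglongrightarrow> rank_one a ((k v* g) v* \<sigma>)" by (rule lim)
    show "(\<lambda>i. \<alpha> i *\<^sub>R matrix_inv (u g i)) \<longlonglongrightarrow> rank_one a ((k v* matrix_inv g) v* \<sigma>)"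
      unfolding u_inv by (rule lim)
  qed
qed

end

section \<open>The topology of projective space\<close>

text \<open>
  The Gram determinant is a polynomial that detects linear dependence.
\<close>

definition gram :: "'a::real_inner \<Rightarrow> 'a \<Rightarrow> real" where
  "gram v w = (v \<bullet> v) * (w \<bullet> w) - (v \<bullet> w)\<^sup>2"

lemma gram_commute: "gram v w = gram w v"
  by (simp add: gram_def inner_commute mult.commute)

lemma gram_nonneg: "gram v w \<ge> 0"
  using Cauchy_Schwarz_ineq[of v w] by (simp add: gram_def)

lemma gram_scaleR_left: "gram (c *\<^sub>R v) w = c\<^sup>2 * gram v w"
  by (simp add: gram_def power2_eq_square algebra_simps)

lemma gram_scaleR_right: "gram v (c *\<^sub>R w) = c\<^sup>2 * gram v w"
  by (simp add: gram_commute[of v] gram_scaleR_left)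

lemma gram_eq_0_iff:
  assumes "v \<noteq> 0"
  shows "gram v w = 0 \<longleftrightarrow> (\<exists>c. w = c *\<^sub>R v)"
proof
  assume 0: "gram v w = 0"
  define y where "y = w - ((v \<bullet> w) / (v \<bullet> v)) *\<^sub>R v"
  have "y \<bullet> y = gram v w / (v \<bullet> v)"
    using assms by (simp add: y_def gram_def inner_diff inner_commute field_simps power2_eq_square)
  with 0 have "y = 0" by simp
  then show "\<exists>c. w = c *\<^sub>R v" by (auto simp: y_def)
next
  assume "\<exists>c. w = c *\<^sub>R v"
  then show "gram v w = 0" by (auto simp: gram_def power2_eq_square)
qed

lemma proj_point_eq_iff:
  assumes v: "v \<noteq> 0" and w: "w \<noteq> 0"
  shows "proj_point v = proj_point w \<longleftrightarrow> gram v w = 0"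
proof
  assume "proj_point v = proj_point w"
  then have "span {v} = span {w}" using line_of_proj_point v w by metis
  then have "w \<in> span {v}" by (simp add: span_base)
  then show "gram v w = 0" using gram_eq_0_iff[OF v] by (auto simp: span_singleton)
next
  assume "gram v w = 0"
  then obtain c where c: "w = c *\<^sub>R v" using gram_eq_0_iff[OF v] by blast
  with w have "c \<noteq> 0" by auto
  with c show "proj_point v = proj_point w"
    using span_image_scale[of "{v}" "\<lambda>_. c"] by (simp add: proj_point_def)
qed

lemma proj_point_scaleR: "c \<noteq> 0 \<Longrightarrow> proj_point (c *\<^sub>R v) = proj_point v"
  using span_image_scale[of "{v}" "\<lambda>_. c"] by (simp add: proj_point_def)

text \<open>Open subsets of projective space correspond to open cones.\<close>

definition open_cone :: "(real ^ 'n::finite) set \<Rightarrow> bool" where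
  "open_cone V \<longleftrightarrow> open V \<and> 0 \<notin> V \<and> (\<forall>v\<in>V. \<forall>c. c \<noteq> 0 \<longrightarrow> c *\<^sub>R v \<in> V)"

lemma proj_point_image_iff:
  assumes "open_cone V" "v \<noteq> 0"
  shows "proj_point v \<in> proj_point ` V \<longleftrightarrow> v \<in> V"
proof
  assume "proj_point v \<in> proj_point ` V"
  then obtain w where w: "w \<in> V" "proj_point v = proj_point w" by blast
  then have "w \<noteq> 0" using assms by (auto simp: open_cone_def)
  then obtain c where c: "v = c *\<^sub>R w"
    using w(2) assms(2) gram_eq_0_iff[of w v] by (auto simp: proj_point_eq_iff gram_commute)
  with assms w show "v \<in> V" by (auto simp: open_cone_def)
qed blast

lemma open_proj_point_image:
  assumes "open_cone V"
  shows "open (proj_point ` V)"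
proof -
  have "{v. v \<noteq> 0 \<and> proj_point v \<in> proj_point ` V} = V"
    using proj_point_image_iff[OF assms] assms by (auto simp: open_cone_def)
  with assms show ?thesis by (simp add: open_rproj_def open_cone_def)
qed

lemma open_cone_preimage:
  assumes "open U"
  shows "open_cone {v. v \<noteq> 0 \<and> proj_point v \<in> U}"
  using assms by (auto simp: open_cone_def open_rproj_def proj_point_scaleR)

instance rproj :: (finite) t2_space
proof
  fix x y :: "'a rproj" assume xy: "x \<noteq> y"
  obtain v where v: "v \<noteq> 0" "x = proj_point v" by (rule proj_point_cases)
  obtain w where w: "w \<noteq> 0" "y = proj_point w" by (rule proj_point_cases)
  have gram: "gram v w > 0"
    using xy v w gram_nonneg[of v w] by (auto simp: proj_point_eq_iff less_le)
  \<comment> \<open>The lines that make a smaller angle with one of the two given lines than with the other.\<close>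
  define near where "near p q = {u. (u \<bullet> q)\<^sup>2 * (p \<bullet> p) < (u \<bullet> p)\<^sup>2 * (q \<bullet> q)}" for p q :: "real ^ 'a"
  have cone: "open_cone (near p q)" for p q
    unfolding open_cone_def near_def
    by (auto intro!: open_Collect_less continuous_intros simp: power_mult_distrib mult.assoc)
  have mem: "p \<in> near p q" if "p \<noteq> 0" "gram p q > 0" for p q
    using that by (simp add: near_def gram_def power2_eq_square mult_ac inner_commute)
  have "proj_point ` near v w \<inter> proj_point ` near w v = {}"
  proof -
    have "u \<notin> near w v" if "u \<in> near v w" for u
      using that by (simp add: near_def)
    moreover have "u \<noteq> 0" if "u \<in> near v w" for u
      using that by (auto simp: near_def)
    ultimately show ?thesis
      using proj_point_image_iff[OF cone] by blast
  qed
  moreover have "x \<in> proj_point ` near v w" "y \<in> proj_point ` near w v"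
    using v w gram mem[of v w] mem[of w v] by (auto simp: gram_commute)
  ultimately show "\<exists>U V. open U \<and> open V \<and> x \<in> U \<and> y \<in> V \<and> U \<inter> V = {}"
    using open_proj_point_image[OF cone] by metis
qed

lemma separate_finite_family:
  fixes p :: "'i \<Rightarrow> 'a::t2_space"
  assumes "finite I" "inj_on p I"
  obtains W where "\<And>i. i \<in> I \<Longrightarrow> open (W i) \<and> p i \<in> W i" "disjoint_family_on W I"
proof -
  have "\<exists>S T. open S \<and> open T \<and> p i \<in> S \<and> p j \<in> T \<and> S \<inter> T = {}" if "i \<in> I" "j \<in> I" "i \<noteq> j" for i j
    using that assms(2) by (intro hausdorff) (auto dest: inj_onD)
  then obtain S T where ST: "\<And>i j. i \<in> I \<Longrightarrow> j \<in> I \<Longrightarrow> i \<noteq> j \<Longrightarrow>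
      open (S i j) \<and> open (T i j) \<and> p i \<in> S i j \<and> p j \<in> T i j \<and> S i j \<inter> T i j = {}"
    by metis
  define W where "W i = (\<Inter>j\<in>I - {i}. S i j \<inter> T j i)" for i
  show thesis
  proof (rule that)
    show "open (W i) \<and> p i \<in> W i" if "i \<in> I" for i
      unfolding W_def using assms(1) ST that by (auto intro!: open_INT open_Int)
    show "disjoint_family_on W I"
      unfolding disjoint_family_on_def
    proof (intro ballI impI)
      fix i j assume "i \<in> I" "j \<in> I" "i \<noteq> j"
      then have "W i \<subseteq> S i j" "W j \<subseteq> T i j" "S i j \<inter> T i j = {}"
        using ST by (auto simp: W_def)
      then show "W i \<inter> W j = {}" by blast
    qed
  qed
qed

section \<open>Vectors and hyperplanes in general position\<close>

text \<open>
  On the unit sphere, the sum of \<open>\<bar>n i \<bullet> x\<bar>\<close> over \<open>N\<close> indices is positive, hence bounded below by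
  compactness; \<open>N\<close> small summands would violate the bound.
\<close>

lemma general_position_multiplicity:
  fixes n :: "'i \<Rightarrow> 'a::euclidean_space"
  assumes fin: "finite J"
    and gen: "\<And>I x. I \<subseteq> J \<Longrightarrow> card I = N \<Longrightarrow> x \<noteq> 0 \<Longrightarrow> \<exists>i\<in>I. n i \<bullet> x \<noteq> 0"
  obtains \<delta> where "\<delta> > 0" "\<And>x. norm x = 1 \<Longrightarrow> card {j\<in>J. \<bar>n j \<bullet> x\<bar> \<le> \<delta>} < N"
proof -
  have ex: "\<exists>e>0. \<forall>x. norm x = 1 \<longrightarrow> e \<le> (\<Sum>i\<in>I. \<bar>n i \<bullet> x\<bar>)" if I: "I \<subseteq> J" "card I = N" for I
  proof -
    have "finite I" using I(1) fin by (rule finite_subset)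
    have "continuous_on (sphere 0 1) (\<lambda>x. \<Sum>i\<in>I. \<bar>n i \<bullet> x\<bar>)"
      by (intro continuous_intros)
    moreover have "sphere (0::'a) 1 \<noteq> {}" by simp
    ultimately obtain x0 where x0: "norm x0 = 1" "\<And>x. norm x = 1 \<Longrightarrow> (\<Sum>i\<in>I. \<bar>n i \<bullet> x0\<bar>) \<le> (\<Sum>i\<in>I. \<bar>n i \<bullet> x\<bar>)"
      using continuous_attains_inf[OF compact_sphere, of 0 1 "\<lambda>x. \<Sum>i\<in>I. \<bar>n i \<bullet> x\<bar>"]
      by auto
    then obtain i where "i \<in> I" "n i \<bullet> x0 \<noteq> 0" using gen[OF I, of x0] by force
    then have "(\<Sum>i\<in>I. \<bar>n i \<bullet> x0\<bar>) > 0"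
      using \<open>finite I\<close> by (intro sum_pos2[of I i]) auto
    with x0 show ?thesis by blast
  qed
  define Is where "Is = {I. I \<subseteq> J \<and> card I = N}"
  have "finite Is" using fin by (simp add: Is_def)
  obtain e where e: "\<And>I. I \<in> Is \<Longrightarrow> e I > 0"
    "\<And>I x. I \<in> Is \<Longrightarrow> norm x = 1 \<Longrightarrow> e I \<le> (\<Sum>i\<in>I. \<bar>n i \<bullet> x\<bar>)"
    using ex unfolding Is_def by (simp only: mem_Collect_eq) metis
  define e0 where "e0 = Min (insert 1 (e ` Is))"
  have e0: "e0 > 0" "\<And>I. I \<in> Is \<Longrightarrow> e0 \<le> e I"
    using \<open>finite Is\<close> e(1) by (auto simp: e0_def)
  define \<delta> where "\<delta> = e0 / (real N + 1)"
  have \<delta>: "\<delta> > 0" "real N * \<delta> < e0"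
    using e0(1) by (auto simp: \<delta>_def field_simps)
  show thesis
  proof (rule that[OF \<delta>(1)], rule ccontr)
    fix x :: 'a assume x: "norm x = 1" and "\<not> card {j\<in>J. \<bar>n j \<bullet> x\<bar> \<le> \<delta>} < N"
    then have "N \<le> card {j\<in>J. \<bar>n j \<bullet> x\<bar> \<le> \<delta>}" by simp
    then obtain I where I: "I \<subseteq> {j\<in>J. \<bar>n j \<bullet> x\<bar> \<le> \<delta>}" "card I = N"
      by (rule obtain_subset_with_card_n)
    then have "I \<in> Is" by (auto simp: Is_def)
    have "e0 \<le> (\<Sum>i\<in>I. \<bar>n i \<bullet> x\<bar>)"
      using e0(2) e(2) \<open>I \<in> Is\<close> x by force
    also have "\<dots> \<le> (\<Sum>i\<in>I. \<delta>)" using I by (intro sum_mono) auto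
    also have "\<dots> = real N * \<delta>" using I by simp
    finally show False using \<delta> by simp
  qed
qed

text \<open>
  Eigenvectors \<open>e i\<close>, \<open>e j\<close> and \<open>e i + e j\<close> force equal eigenvalues.
\<close>

lemma matrix_scalar_of_eigenvectors:
  fixes A :: "real ^ 'n::finite ^ 'n"
  assumes "\<And>v. \<exists>c. A *v v = c *\<^sub>R v"
  shows "\<exists>c. A = c *\<^sub>R mat 1"
proof -
  have entry: "(A *v axis j 1) $ i = A $ i $ j" for i j
    by (simp add: matrix_vector_mul_component inner_axis)
  have off: "A $ i $ j = 0" if "i \<noteq> j" for i j
  proof -
    obtain c where "A *v axis j 1 = c *\<^sub>R axis j 1" using assms by blast
    then have "A $ i $ j = (c *\<^sub>R axis j 1 :: real ^ 'n) $ i" by (metis entry)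
    with that show ?thesis by (simp add: axis_def)
  qed
  have diag: "A $ i $ i = A $ j $ j" for i j
  proof (cases "i = j")
    case False
    obtain c where c: "A *v (axis i 1 + axis j 1) = c *\<^sub>R (axis i 1 + axis j 1)" using assms by blast
    have k: "A $ k $ i + A $ k $ j = c * (axis i 1 + axis j 1 :: real ^ 'n) $ k" for k
      using arg_cong[OF c, of "\<lambda>v. v $ k"] by (simp add: matrix_vector_right_distrib entry)
    from k[of i] k[of j] False off[of i j] off[of j i] show ?thesis
      by (simp add: axis_def)
  qed simp
  have "A = (A $ undefined $ undefined) *\<^sub>R mat 1"
    using off diag by (auto simp: vec_eq_iff mat_def)
  then show ?thesis by blast
qed

section \<open>Placing points and hyperplanes\<close>

locale minimal_zariski_dense_subgroup = zariski_dense_subgroup \<Gamma>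
  for \<Gamma> :: "(real ^ 'n::finite ^ 'n) set set" +
  assumes minimal: "minimal_action (PSL\<lparr>carrier := \<Gamma>\<rparr>) PSL_action"
begin

abbreviation "class A \<equiv> SL_scalars #>\<^bsub>SL\<^esub> A"

lemma act_lift:
  assumes "A \<in> lifts" "v \<noteq> 0"
  shows "PSL_action (class A) (proj_point v) = proj_point (A *v v)" "A *v v \<noteq> 0"
proof -
  have "A \<in> carrier SL" using lift_det[OF assms(1)] by (simp add: SL_def)
  with assms(2) show "PSL_action (class A) (proj_point v) = proj_point (A *v v)" "A *v v \<noteq> 0"
    by (simp_all add: PSL_action_coset SL_mult_nonzero)
qed

text \<open>
  By minimality the preimages of \<open>U\<close> under the group cover projective space, which is compact.
\<close>

lemma finite_lifts_reach_open:
  assumes U: "open U" "U \<noteq> {}"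
  obtains J where "finite J" "J \<subseteq> lifts" "\<And>v. v \<noteq> 0 \<Longrightarrow> \<exists>B\<in>J. proj_point (B *v v) \<in> U"
proof -
  have "UNIV \<subseteq> (\<Union>A\<in>lifts. PSL_action (class A) -` U)"
  proof
    fix x :: "'n rproj"
    have "U \<inter> orbit (PSL\<lparr>carrier := \<Gamma>\<rparr>) PSL_action x \<noteq> {}"
      using minimal U open_Int_closure_eq_empty[OF U(1)] by (auto simp: minimal_action_def)
    then obtain g where g: "g \<in> \<Gamma>" "PSL_action g x \<in> U" by (auto simp: orbit_def)
    then obtain A where A: "A \<in> carrier SL" "g = class A"
      using PSL_cases subgroup.mem_carrier[OF subgroup] by metis
    with g have "A \<in> lifts" using lift_iff[of A] by (simp add: SL_def)
    with A g show "x \<in> (\<Union>A\<in>lifts. PSL_action (class A) -` U)" by auto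
  qed
  moreover have "open (PSL_action (class A) -` U)" if "A \<in> lifts" for A
    using that lift_class[OF that] subgroup.mem_carrier[OF subgroup]
    by (intro open_vimage U continuous_on_PSL_action) auto
  ultimately obtain J where J: "J \<subseteq> lifts" "finite J" "UNIV \<subseteq> (\<Union>A\<in>J. PSL_action (class A) -` U)"
    using compactE_image[OF compact_rproj, of lifts "\<lambda>A. PSL_action (class A) -` U"] by metis
  show thesis
  proof (rule that[OF J(2,1)])
    fix v :: "real ^ 'n" assume v: "v \<noteq> 0"
    obtain B where "B \<in> J" "PSL_action (class B) (proj_point v) \<in> U" using J(3) by blast
    moreover have "B \<in> lifts" using J(1) \<open>B \<in> J\<close> by blast
    ultimately show "\<exists>B\<in>J. proj_point (B *v v) \<in> U"
      using act_lift(1)[OF _ v] by metis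
  qed
qed

text \<open>
  Finitely many translates of the elements that move \<open>p\<close> into \<open>V\<close> cover the group, by
  minimality and compactness. If each of those elements failed the second condition, a
  product of finitely many linear forms would vanish on the whole group, hence on all
  matrices.
\<close>

lemma exists_lift_into_cone:
  assumes V: "open_cone V" "V \<noteq> {}" and p: "p \<noteq> 0" and k: "k \<noteq> 0" and W: "finite W" "0 \<notin> W"
  obtains A where "A \<in> lifts" "A *v p \<in> V" "\<And>w. w \<in> W \<Longrightarrow> k \<bullet> (matrix_inv A *v w) \<noteq> 0"
proof (rule ccontr)
  assume "\<not> thesis"
  with that have no: "\<exists>w\<in>W. k \<bullet> (matrix_inv A *v w) = 0" if "A \<in> lifts" "A *v p \<in> V" for A
    using that by blast
  have ne: "proj_point ` V \<noteq> {}" using V(2) by blast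
  obtain J where J: "finite J" "J \<subseteq> lifts" "\<And>v. v \<noteq> 0 \<Longrightarrow> \<exists>B\<in>J. proj_point (B *v v) \<in> proj_point ` V"
    by (rule finite_lifts_reach_open[OF open_proj_point_image[OF V(1)] ne]) blast
  define W' where "W' = (\<lambda>(B, w). matrix_inv B *v w) ` (J \<times> W)"
  have W': "finite W'" by (simp add: W'_def J(1) W(1))
  have zero: "\<exists>w\<in>W'. k \<bullet> (A *v w) = 0" if A: "A \<in> lifts" for A
  proof -
    let ?A = "matrix_inv A"
    have A': "?A \<in> lifts" by (rule lift_inv(1)[OF A])
    then have nz: "?A *v p \<noteq> 0" by (rule act_lift(2)[OF _ p])
    then obtain B where B: "B \<in> J" "proj_point (B *v (?A *v p)) \<in> proj_point ` V" using J(3) by blast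
    then have Bl: "B \<in> lifts" using J(2) by blast
    have "(B ** ?A) *v p \<in> V"
      using B(2) proj_point_image_iff[OF V(1) act_lift(2)[OF Bl nz]] by (simp add: matrix_vector_mul_assoc)
    moreover have "B ** ?A \<in> lifts" by (rule lift_mult[OF Bl A'])
    ultimately obtain w where w: "w \<in> W" "k \<bullet> (matrix_inv (B ** ?A) *v w) = 0"
      using no by blast
    have "(B ** ?A) ** (A ** matrix_inv B) = B ** (?A ** A) ** matrix_inv B"
      by (simp only: matrix_mul_assoc)
    then have "matrix_inv (B ** ?A) = A ** matrix_inv B"
      by (intro matrix_inv_eqI) (simp add: lift_inv(2)[OF A] lift_inv(3)[OF Bl])
    with w have "k \<bullet> (A *v (matrix_inv B *v w)) = 0" by (simp add: matrix_vector_mul_assoc)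
    then show ?thesis using w(1) B(1) by (auto simp: W'_def)
  qed
  define q where "q A = (\<Prod>w\<in>W'. k \<bullet> (A *v w))" for A :: "real ^ 'n ^ 'n"
  have q0: "q A = 0" for A
  proof (rule homogeneous_polynomial_vanishes[where d = "card W'"])
    have "linear (\<lambda>A :: real ^ 'n ^ 'n. k \<bullet> (A *v w))" for w
      by (intro linearI)
        (simp_all add: matrix_vector_mult_add_rdistrib inner_add_right flip: scaleR_matrix_vector_assoc)
    then show "real_polynomial_function q"
      unfolding q_def
      by (intro real_polynomial_function_prod W' real_polynomial_function.intros(1)) (simp add: linear_conv_bounded_linear)
    show "q (c *\<^sub>R A) = c ^ card W' * q A" for c A
      by (simp add: q_def prod.distrib flip: scaleR_matrix_vector_assoc)
    show "q A = 0" if "A \<in> lifts" for A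
      using zero[OF that] W' by (auto simp: q_def)
  qed
  have W'0: "w \<noteq> 0" if w: "w \<in> W'" for w
  proof -
    obtain B v where B: "B \<in> J" "v \<in> W" "w = matrix_inv B *v v" using w by (auto simp: W'_def)
    then have "B \<in> lifts" "v \<noteq> 0" using J(2) W(2) by auto
    from act_lift(2)[OF lift_inv(1)[OF this(1)] this(2)] show ?thesis by (simp add: B(3))
  qed
  obtain y where y: "\<And>w. w \<in> W' \<Longrightarrow> y \<bullet> w \<noteq> 0"
  proof (rule open_avoids_polynomials[of "(\<lambda>w y. y \<bullet> w) ` W'" "UNIV :: (real ^ 'n) set"])
    fix r :: "real ^ 'n \<Rightarrow> real" assume "r \<in> (\<lambda>w y. y \<bullet> w) ` W'"
    then obtain w where w: "w \<in> W'" "r = (\<lambda>y. y \<bullet> w)" by blast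
    show "real_polynomial_function r"
      unfolding w(2) by (intro real_polynomial_function.intros(1) bounded_linear_inner_left)
    have "r w \<noteq> 0" using W'0[OF w(1)] by (simp add: w(2))
    then show "\<exists>x. r x \<noteq> 0" by blast
  qed (use W' in auto)
  have "q (rank_one k y) \<noteq> 0"
    using y k W' by (simp add: q_def)
  with q0 show False by blast
qed


text \<open>
  The elements are chosen one after the other. For the lines through the translates of \<open>A j p j\<close>
  under \<open>F\<close> to be distinct from each other and from the earlier ones, the vector \<open>A j p j\<close> has to
  avoid the zeros of finitely many nonzero polynomials, which makes the cone \<open>V j\<close> smaller but not
  empty. The functional \<open>k j\<close>, moved by \<open>A j\<close>, has to avoid the spans of fewer than \<open>n\<close> earlier
  functionals. Each of these is a proper subspace, so it suffices not to vanish on one vector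
  orthogonal to it, as \<open>exists_lift_into_cone\<close> provides.
\<close>

lemma exists_general_position:
  fixes p k :: "nat \<Rightarrow> real ^ 'n" and V :: "nat \<Rightarrow> (real ^ 'n) set"
  assumes n2: "CARD('n) \<ge> 2"
    and V: "\<And>j. open_cone (V j)" "\<And>j. V j \<noteq> {}" and p: "\<And>j. p j \<noteq> 0" and k: "\<And>j. k j \<noteq> 0"
    and F: "finite F" "F \<subseteq> lifts" "\<And>f f'. f \<in> F \<Longrightarrow> f' \<in> F \<Longrightarrow> f \<noteq> f' \<Longrightarrow> \<nexists>c. f' = c *\<^sub>R f"
  shows "\<exists>A. (\<forall>j<M. A j \<in> lifts \<and> A j *v p j \<in> V j) \<and>
    (\<forall>f\<in>F. \<forall>f'\<in>F. \<forall>i<M. \<forall>j<M. (f, i) \<noteq> (f', j) \<longrightarrow>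
      gram (f *v (A i *v p i)) (f' *v (A j *v p j)) \<noteq> 0) \<and>
    (\<forall>I\<subseteq>{..<M}. card I \<le> CARD('n) \<longrightarrow>
      inj_on (\<lambda>j. k j v* matrix_inv (A j)) I \<and> independent ((\<lambda>j. k j v* matrix_inv (A j)) ` I))"
proof (induction M)
  case 0
  then show ?case by (auto simp: independent_empty)
next
  case (Suc M)
  then obtain A where IH: "(\<forall>j<M. A j \<in> lifts \<and> A j *v p j \<in> V j) \<and>
    (\<forall>f\<in>F. \<forall>f'\<in>F. \<forall>i<M. \<forall>j<M. (f, i) \<noteq> (f', j) \<longrightarrow>
      gram (f *v (A i *v p i)) (f' *v (A j *v p j)) \<noteq> 0) \<and>
    (\<forall>I\<subseteq>{..<M}. card I \<le> CARD('n) \<longrightarrow>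
      inj_on (\<lambda>j. k j v* matrix_inv (A j)) I \<and> independent ((\<lambda>j. k j v* matrix_inv (A j)) ` I))"
    by (elim exE)
  have A: "A j \<in> lifts" "A j *v p j \<in> V j" if "j < M" for j
    using IH that by blast+
  note dist = IH[THEN conjunct2, THEN conjunct1, rule_format]
  note gen = IH[THEN conjunct2, THEN conjunct2, rule_format]
  define n where "n j = k j v* matrix_inv (A j)" for j
  have perp: "\<exists>w. w \<noteq> 0 \<and> (\<forall>y\<in>span S. orthogonal w y)" if d: "dim S < CARD('n)" for S :: "(real ^ 'n) set"
  proof -
    have "dim S < DIM(real ^ 'n)" using d by simp
    then obtain w where "w \<noteq> 0" "\<And>y. y \<in> span S \<Longrightarrow> orthogonal w y"
      by (rule orthogonal_to_subspace_exists) blast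
    then show ?thesis by blast
  qed
  \<comment> \<open>The polynomial conditions on the new point.\<close>
  define P1 where "P1 = {(\<lambda>v. gram (f *v v) (f' *v v)) | f f'. f \<in> F \<and> f' \<in> F \<and> f \<noteq> f'}"
  define P2 where "P2 = {(\<lambda>v. gram (f *v v) (f' *v (A j *v p j))) | f f' j. f \<in> F \<and> f' \<in> F \<and> j < M}"
  have "P1 \<subseteq> (\<lambda>(f, f') v. gram (f *v v) (f' *v v)) ` (F \<times> F)"
    by (auto simp: P1_def)
  then have "finite P1" using F(1) by (meson finite_SigmaI finite_imageI finite_subset)
  have "P2 \<subseteq> (\<lambda>(f, f', j) v. gram (f *v v) (f' *v (A j *v p j))) ` (F \<times> F \<times> {..<M})"
    by (force simp: P2_def)
  then have "finite P2" using F(1) by (meson finite_SigmaI finite_imageI finite_subset finite_lessThan)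
  have lin: "bounded_linear ((*v) f)" for f :: "real ^ 'n ^ 'n"
    by (simp add: linear_conv_bounded_linear[symmetric])
  have in1: "real_polynomial_function (\<lambda>v. (f *v v) \<bullet> (f' *v v))" for f f' :: "real ^ 'n ^ 'n"
    by (intro real_polynomial_function_inner lin)
  have in2: "real_polynomial_function (\<lambda>v. (f *v v) \<bullet> w)" for f :: "real ^ 'n ^ 'n" and w
    by (intro real_polynomial_function.intros(1) bounded_linear_compose[OF bounded_linear_inner_left lin])
  have gram_poly: "real_polynomial_function (\<lambda>v. gram (f *v v) (f' *v v))"
    "real_polynomial_function (\<lambda>v. gram (f *v v) w)" for f f' :: "real ^ 'n ^ 'n" and w
    unfolding gram_def
    by (intro real_polynomial_function_diff real_polynomial_function.intros(2,4) real_polynomial_function_power in1 in2)+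
  have nz1: "\<exists>v. q v \<noteq> 0" if q: "q \<in> P1" for q
  proof (rule ccontr)
    assume zero: "\<nexists>v. q v \<noteq> 0"
    obtain f f' where f: "f \<in> F" "f' \<in> F" "f \<noteq> f'" and qf: "q = (\<lambda>v. gram (f *v v) (f' *v v))"
      using q by (auto simp: P1_def)
    have fl: "f \<in> lifts" using f F(2) by blast
    have "\<exists>c. (matrix_inv f ** f') *v v = c *\<^sub>R v" for v
    proof (cases "v = 0")
      case False
      have "gram (f *v v) (f' *v v) = 0" using zero by (simp add: qf)
      then obtain c where "f' *v v = c *\<^sub>R (f *v v)"
        using gram_eq_0_iff[OF act_lift(2)[OF fl False]] by blast
      then have "(matrix_inv f ** f') *v v = c *\<^sub>R ((matrix_inv f ** f) *v v)"
        by (simp add: matrix_vector_mult_scaleR flip: matrix_vector_mul_assoc)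
      then show ?thesis by (auto simp: lift_inv(2)[OF fl])
    qed simp
    then obtain c where c: "matrix_inv f ** f' = c *\<^sub>R mat 1"
      using matrix_scalar_of_eigenvectors by blast
    have "f' = (f ** matrix_inv f) ** f'" by (simp add: lift_inv(3)[OF fl])
    also have "\<dots> = f ** (c *\<^sub>R mat 1)" by (simp only: c flip: matrix_mul_assoc)
    also have "\<dots> = c *\<^sub>R f" by (simp add: matrix_scalar_ac flip: scalar_matrix_assoc)
    finally show False using F(3)[OF f] by blast
  qed
  have nz2: "\<exists>v. q v \<noteq> 0" if q: "q \<in> P2" for q
  proof -
    obtain f f' j where f: "f \<in> F" "f' \<in> F" "j < M" and qf: "q = (\<lambda>v. gram (f *v v) (f' *v (A j *v p j)))"
      using q by (auto simp: P2_def)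
    define w where "w = f' *v (A j *v p j)"
    have "f \<in> lifts" "f' \<in> lifts" using f F(2) by auto
    then have w: "w \<noteq> 0" unfolding w_def using act_lift(2) A(1)[OF f(3)] p by blast
    have "dim {w} < CARD('n)" using n2 by simp
    from perp[OF this] obtain y where y: "y \<noteq> 0" "orthogonal y w" by (auto simp: span_base)
    have "q (matrix_inv f *v y) = gram y w"
      by (simp add: qf w_def matrix_vector_mul_assoc lift_inv(3)[OF \<open>f \<in> lifts\<close>])
    also have "\<dots> \<noteq> 0" using y w by (simp add: gram_def orthogonal_def)
    finally show ?thesis by blast
  qed
  have fin: "finite (P1 \<union> P2)" using \<open>finite P1\<close> \<open>finite P2\<close> by blast
  have poly: "real_polynomial_function q" if "q \<in> P1 \<union> P2" for q
    using that gram_poly by (auto simp: P1_def P2_def)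
  define V' where "V' = {v \<in> V M. \<forall>q\<in>P1 \<union> P2. q v \<noteq> 0}"
  have "open V'"
  proof -
    have "open (V M \<inter> (\<Inter>q\<in>P1 \<union> P2. q -` (- {0})))"
      using V(1)[of M] fin poly
      by (intro open_Int open_INT ballI open_vimage continuous_on_real_polynomial_function) (auto simp: open_cone_def)
    moreover have "V' = V M \<inter> (\<Inter>q\<in>P1 \<union> P2. q -` (- {0}))" by (auto simp: V'_def)
    ultimately show ?thesis by simp
  qed
  moreover have "q (c *\<^sub>R v) \<noteq> 0" if "q \<in> P1 \<union> P2" "q v \<noteq> 0" "c \<noteq> 0" for q v c
    using that by (auto simp: P1_def P2_def matrix_vector_mult_scaleR gram_scaleR_left gram_scaleR_right)
  ultimately have V'_cone: "open_cone V'"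
    using V(1)[of M] unfolding open_cone_def V'_def by blast
  have V'_ne: "V' \<noteq> {}"
  proof -
    have "open (V M)" using V(1)[of M] by (simp add: open_cone_def)
    from open_avoids_polynomials[OF fin poly _ this V(2)] nz1 nz2
    obtain x where "x \<in> V M" "\<And>q. q \<in> P1 \<union> P2 \<Longrightarrow> q x \<noteq> 0" by blast
    then show ?thesis by (auto simp: V'_def)
  qed
  \<comment> \<open>A normal vector to each hyperplane that the new functional has to avoid.\<close>
  define Is where "Is = {I. I \<subseteq> {..<M} \<and> card I < CARD('n)}"
  have "\<exists>w. w \<noteq> 0 \<and> (\<forall>y\<in>span (n ` I). orthogonal w y)" if "I \<in> Is" for I
  proof (rule perp)
    have "finite I" using that by (auto simp: Is_def intro: finite_subset)
    then show "dim (n ` I) < CARD('n)"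
      using that dim_le_card'[of "n ` I"] card_image_le[of I n] by (simp add: Is_def)
  qed
  then obtain w where w: "\<And>I. I \<in> Is \<Longrightarrow> w I \<noteq> 0" "\<And>I y. I \<in> Is \<Longrightarrow> y \<in> span (n ` I) \<Longrightarrow> w I \<bullet> y = 0"
    unfolding orthogonal_def by metis
  have "Is \<subseteq> Pow {..<M}" by (auto simp: Is_def)
  then have "finite Is" by (rule finite_subset) simp
  then have W: "finite (w ` Is)" "0 \<notin> w ` Is" using w(1) by auto
  obtain B where B: "B \<in> lifts" "B *v p M \<in> V'" "\<And>w'. w' \<in> w ` Is \<Longrightarrow> k M \<bullet> (matrix_inv B *v w') \<noteq> 0"
    by (rule exists_lift_into_cone[OF V'_cone V'_ne p k W]) blast
  have new: "k M v* matrix_inv B \<notin> span (n ` I)" if I: "I \<in> Is" for I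
  proof
    assume "k M v* matrix_inv B \<in> span (n ` I)"
    then have "(k M v* matrix_inv B) \<bullet> w I = 0" using w(2)[OF I] by (subst inner_commute) blast
    with B(3)[of "w I"] I show False by (simp add: dot_lmul_matrix)
  qed
  define A' where "A' = A(M := B)"
  define n' where "n' j = k j v* matrix_inv (A' j)" for j
  have n': "n' j = n j" if "j < M" for j using that by (simp add: n_def n'_def A'_def)
  have Bq: "q (B *v p M) \<noteq> 0" if "q \<in> P1 \<union> P2" for q
    using B(2) that by (simp add: V'_def)
  have q1: "gram (f *v (B *v p M)) (f' *v (B *v p M)) \<noteq> 0" if "f \<in> F" "f' \<in> F" "f \<noteq> f'" for f f'
  proof (rule Bq)
    show "(\<lambda>v. gram (f *v v) (f' *v v)) \<in> P1 \<union> P2"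
      unfolding P1_def using that by blast
  qed
  have q2: "gram (f *v (B *v p M)) (f' *v (A j *v p j)) \<noteq> 0" if "f \<in> F" "f' \<in> F" "j < M" for f f' j
  proof (rule Bq)
    show "(\<lambda>v. gram (f *v v) (f' *v (A j *v p j))) \<in> P1 \<union> P2"
      unfolding P2_def using that by blast
  qed
  show ?case
  proof (intro exI[of _ A'] conjI)
    show "\<forall>j<Suc M. A' j \<in> lifts \<and> A' j *v p j \<in> V j"
      using A B by (auto simp: A'_def less_Suc_eq V'_def)
    show "\<forall>f\<in>F. \<forall>f'\<in>F. \<forall>i<Suc M. \<forall>j<Suc M. (f, i) \<noteq> (f', j) \<longrightarrow>
        gram (f *v (A' i *v p i)) (f' *v (A' j *v p j)) \<noteq> 0"
    proof (intro ballI allI impI)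
      fix f f' i j assume fij: "f \<in> F" "f' \<in> F" "i < Suc M" "j < Suc M" "(f, i) \<noteq> (f', j)"
      consider "i < M" "j < M" | "i = M" "j < M" | "i < M" "j = M" | "i = M" "j = M"
        using fij by linarith
      then show "gram (f *v (A' i *v p i)) (f' *v (A' j *v p j)) \<noteq> 0"
      proof cases
        case 1
        then show ?thesis using dist[OF fij(1,2) 1 fij(5)] by (simp add: A'_def)
      next
        case 2
        then show ?thesis using q2[OF fij(1,2) 2(2)] by (simp add: A'_def)
      next
        case 3
        then show ?thesis using q2[OF fij(2,1) 3(1)] by (simp add: A'_def gram_commute)
      next
        case 4
        then show ?thesis using q1[OF fij(1,2)] fij(5) by (simp add: A'_def)
      qed
    qed
    show "\<forall>I\<subseteq>{..<Suc M}. card I \<le> CARD('n) \<longrightarrow>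
        inj_on (\<lambda>j. k j v* matrix_inv (A' j)) I \<and> independent ((\<lambda>j. k j v* matrix_inv (A' j)) ` I)"
      unfolding n'_def[symmetric]
    proof (intro allI impI)
      fix I assume I: "I \<subseteq> {..<Suc M}" "card I \<le> CARD('n)"
      define I' where "I' = I - {M}"
      have I': "I' \<subseteq> {..<M}" using I(1) by (auto simp: I'_def less_Suc_eq)
      have finI: "finite I" using I(1) by (rule finite_subset) simp
      have "card I' \<le> card I" unfolding I'_def using finI by (intro card_mono) auto
      then have "inj_on n I' \<and> independent (n ` I')"
        unfolding n_def using gen[OF I'] I(2) by linarith
      moreover have eq: "n' j = n j" if "j \<in> I'" for j using n' I' that by blast
      ultimately have old: "inj_on n' I'" "independent (n' ` I')" and im: "n' ` I' = n ` I'"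
        by (auto simp: inj_on_def cong: image_cong)
      show "inj_on n' I \<and> independent (n' ` I)"
      proof (cases "M \<in> I")
        case False
        then show ?thesis using old by (simp add: I'_def)
      next
        case True
        then have II: "I = insert M I'" "M \<notin> I'" by (auto simp: I'_def)
        have "card I' < CARD('n)" using card_Diff1_less[OF finI True] I(2) by (simp add: I'_def)
        then have ns: "n' M \<notin> span (n' ` I')"
          unfolding im using new[of I'] I' by (simp add: Is_def n'_def A'_def)
        have "n' M \<notin> n' ` I'"
        proof
          assume "n' M \<in> n' ` I'"
          from span_base[OF this] ns show False by contradiction
        qed
        then have "inj_on n' I"
          unfolding II(1) inj_on_insert using old(1) II(2) by simp
        moreover have "independent (n' ` I)"
          unfolding II(1) image_insert by (rule independent_insertI[OF ns old(2)])
        ultimately show ?thesis ..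
      qed
    qed
  qed
qed

end

section \<open>Contracting elements of the group\<close>

lemma bounded_bilinear_matrix_vector_mult:
  "bounded_bilinear ((*v) :: real ^ 'n::finite ^ 'm::finite \<Rightarrow> real ^ 'n \<Rightarrow> real ^ 'm)"
  unfolding bilinear_conv_bounded_bilinear[symmetric] bilinear_def
  by (auto intro!: linearI simp: matrix_vector_mult_add_rdistrib simp flip: scaleR_matrix_vector_assoc)

lemma eventually_maps_compact_into_open:
  fixes X :: "nat \<Rightarrow> real ^ 'n::finite ^ 'm::finite"
  assumes lim: "X \<longlonglongrightarrow> T" and S: "compact S" and E: "open E" and into: "\<And>x. x \<in> S \<Longrightarrow> T *v x \<in> E"
  shows "\<forall>\<^sub>F i in sequentially. \<forall>x\<in>S. X i *v x \<in> E"
proof -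
  have "compact ((*v) T ` S)"
    by (intro compact_continuous_image S matrix_vector_mult_linear_continuous_on)
  moreover have "(*v) T ` S \<subseteq> E" using into by blast
  ultimately obtain e where e: "e > 0" "(\<Union>y\<in>(*v) T ` S. ball y e) \<subseteq> E"
    using compact_subset_open_imp_ball_epsilon_subset[OF _ E] by metis
  obtain b where b: "b > 0" "\<forall>x\<in>S. norm x \<le> b"
    using compact_imp_bounded[OF S] by (auto simp: bounded_pos)
  obtain K where K: "K > 0" "\<And>A (x :: real ^ 'n). norm ((A :: real ^ 'n ^ 'm) *v x) \<le> norm A * norm x * K"
    using bounded_bilinear.pos_bounded[OF bounded_bilinear_matrix_vector_mult] by blast
  have "\<forall>\<^sub>F i in sequentially. dist (X i) T < e / (b * K)"
    using lim e(1) b(1) K(1) by (intro tendstoD) auto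
  then show ?thesis
  proof eventually_elim
    case (elim i)
    show ?case
    proof
      fix x assume x: "x \<in> S"
      have "norm ((X i - T) *v x) \<le> norm (X i - T) * norm x * K" by (rule K(2))
      also have "\<dots> \<le> norm (X i - T) * b * K"
        using b x K(1) by (intro mult_right_mono mult_left_mono) auto
      also have "\<dots> < e" using elim b(1) K(1) by (simp add: dist_norm field_simps)
      finally have "X i *v x \<in> ball (T *v x) e"
        by (simp add: dist_norm norm_minus_commute matrix_vector_mult_diff_rdistrib)
      then show "X i *v x \<in> E" using e(2) x by blast
    qed
  qed
qed

lemma independent_nonorthogonal:
  fixes x :: "'a::euclidean_space"
  assumes "independent B" "card B = DIM('a)" "x \<noteq> 0"
  shows "\<exists>b\<in>B. b \<bullet> x \<noteq> 0"
proof (rule ccontr)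
  assume "\<not> (\<exists>b\<in>B. b \<bullet> x \<noteq> 0)"
  then have "B \<subseteq> {y. y \<bullet> x = 0}" by auto
  moreover have "subspace {y. y \<bullet> x = 0}"
    by (auto simp: subspace_def inner_add_left)
  ultimately have "span B \<subseteq> {y. y \<bullet> x = 0}" by (rule span_minimal)
  moreover have "UNIV \<subseteq> span B"
    using assms by (intro card_ge_dim_independent) auto
  ultimately have "x \<bullet> x = 0" by blast
  with assms(3) show False by simp
qed

context minimal_zariski_dense_subgroup
begin

text \<open>
  If \<open>u\<close> is close to \<open>a k\<^sup>T\<close> and its inverse to \<open>a l\<^sup>T\<close> up to scalars, then \<open>g u h\<^sup>-\<^sup>1\<close> contracts
  to \<open>g a\<close> off the hyperplane \<open>h (ker k)\<close>, and its inverse contracts to \<open>h a\<close> off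
  \<open>g (ker l)\<close>. The elements \<open>g\<close> and \<open>h\<close> for the \<open>i\<close>-th contracting element have the indices
  \<open>2 i\<close> and \<open>2 i + 1\<close> in a single family in general position, so that a line is close to
  fewer than \<open>n\<close> of all these hyperplanes.
\<close>

lemma exists_contracting_family:
  fixes U :: "nat \<Rightarrow> 'n rproj set"
  assumes n2: "CARD('n) \<ge> 2" and F: "finite F" "F \<subseteq> \<Gamma>" and U: "\<And>i. open (U i) \<and> U i \<noteq> {}"
  shows "\<exists>t A B. (\<forall>i\<in>{1..m}. t i \<in> \<Gamma> \<and> A i \<subseteq> U i \<and> B i \<subseteq> U i) \<and>
    disjoint_family_on (case_sum (\<lambda>(g, i). PSL_action g ` A i) (\<lambda>(h, j). PSL_action h ` B j))
      (F \<times> {1..m} <+> F \<times> {1..m}) \<and>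
    (\<forall>x. card {i\<in>{1..m}. PSL_action (t i) x \<notin> A i} \<le> CARD('n)) \<and>
    (\<forall>x. card {i\<in>{1..m}. PSL_action (inv\<^bsub>PSL\<^esub> (t i)) x \<notin> B i} \<le> CARD('n))"
proof -
  obtain a k l and u :: "nat \<Rightarrow> real ^ 'n ^ 'n" and \<alpha> :: "nat \<Rightarrow> real"
    where a: "a \<noteq> 0" and k: "k \<noteq> 0" and l: "l \<noteq> 0" and u: "\<And>i. u i \<in> lifts"
      and u_lim: "(\<lambda>i. \<alpha> i *\<^sub>R u i) \<longlonglongrightarrow> rank_one a k"
      and u_inv_lim: "(\<lambda>i. \<alpha> i *\<^sub>R matrix_inv (u i)) \<longlonglongrightarrow> rank_one a l"
    by (rule exists_contracting_sequence) blast
  define rep where "rep g = (SOME A. A \<in> g)" for g :: "(real ^ 'n ^ 'n) set"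
  have rep: "rep g \<in> lifts" "class (rep g) = g" if g: "g \<in> \<Gamma>" for g
  proof -
    have gP: "g \<in> carrier PSL" using g subgroup.mem_carrier[OF subgroup] by blast
    then obtain A where "A \<in> carrier SL" "g = class A" by (rule PSL_cases)
    then have "A \<in> g" using PSL_class_mem(2) by blast
    then have r: "rep g \<in> g" unfolding rep_def by (rule someI)
    then show "rep g \<in> lifts" using g by (auto simp: lifts_def)
    show "class (rep g) = g" using PSL_class_of_member(2)[OF gP r] by simp
  qed
  have nonprop: "\<nexists>c. f' = c *\<^sub>R f" if f: "f \<in> rep ` F" "f' \<in> rep ` F" "f \<noteq> f'" for f f'
  proof
    assume "\<exists>c. f' = c *\<^sub>R f"
    moreover obtain g g' where g: "g \<in> F" "g' \<in> F" "f = rep g" "f' = rep g'" using f by blast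
    moreover have "f \<in> carrier SL" "f' \<in> carrier SL"
      using g F(2) rep(1) lift_det by (auto simp: SL_def)
    ultimately have "f' \<in> class f" by (simp add: mem_PSL_class_iff)
    then have "f' \<in> g" using g F(2) rep(2) by auto
    then have "class f' = g"
      using PSL_class_of_member(2)[of g f'] g F(2) subgroup.mem_carrier[OF subgroup] by blast
    then have "g' = g" using g F(2) rep(2) by auto
    with g f(3) show False by simp
  qed
  \<comment> \<open>The indices used are \<open>2 * i\<close> and \<open>2 * i + 1\<close> for \<open>i\<close> from 1 to \<open>m\<close>.\<close>
  define M where "M = 2 * m + 2"
  define kk where "kk j = (if even j then l else k)" for j :: nat
  define V where "V j = {v. v \<noteq> 0 \<and> proj_point v \<in> U (j div 2)}" for j
  have V_cone: "open_cone (V j)" for j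
    unfolding V_def using U by (intro open_cone_preimage) blast
  have V_ne: "V j \<noteq> {}" for j
  proof -
    obtain x where "x \<in> U (j div 2)" using U by blast
    then show ?thesis by (cases x rule: proj_point_cases) (auto simp: V_def)
  qed
  have kk: "kk j \<noteq> 0" for j using k l by (simp add: kk_def)
  have repF: "finite (rep ` F)" "rep ` F \<subseteq> lifts" using F rep by auto
  have "\<exists>A. (\<forall>j<M. A j \<in> lifts \<and> A j *v a \<in> V j) \<and>
    (\<forall>f\<in>rep ` F. \<forall>f'\<in>rep ` F. \<forall>i<M. \<forall>j<M. (f, i) \<noteq> (f', j) \<longrightarrow>
      gram (f *v (A i *v a)) (f' *v (A j *v a)) \<noteq> 0) \<and>
    (\<forall>I\<subseteq>{..<M}. card I \<le> CARD('n) \<longrightarrow>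
      inj_on (\<lambda>j. kk j v* matrix_inv (A j)) I \<and> independent ((\<lambda>j. kk j v* matrix_inv (A j)) ` I))"
    by (rule exists_general_position[OF n2 V_cone V_ne a kk repF]) (use nonprop in blast)
  then obtain A where A0: "(\<forall>j<M. A j \<in> lifts \<and> A j *v a \<in> V j) \<and>
    (\<forall>f\<in>rep ` F. \<forall>f'\<in>rep ` F. \<forall>i<M. \<forall>j<M. (f, i) \<noteq> (f', j) \<longrightarrow>
      gram (f *v (A i *v a)) (f' *v (A j *v a)) \<noteq> 0) \<and>
    (\<forall>I\<subseteq>{..<M}. card I \<le> CARD('n) \<longrightarrow>
      inj_on (\<lambda>j. kk j v* matrix_inv (A j)) I \<and> independent ((\<lambda>j. kk j v* matrix_inv (A j)) ` I))"
    by (elim exE) (rule that)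
  have A: "A j \<in> lifts" "A j *v a \<in> V j" if "j < M" for j
    using A0 that by blast+
  note gram = A0[THEN conjunct2, THEN conjunct1, rule_format]
  define n where "n j = kk j v* matrix_inv (A j)" for j
  then have n_eq: "n = (\<lambda>j. kk j v* matrix_inv (A j))" by (simp add: fun_eq_iff)
  note gen = A0[THEN conjunct2, THEN conjunct2, rule_format, folded n_eq]
  have "\<exists>i\<in>I. n i \<bullet> x \<noteq> 0" if I: "I \<subseteq> {..<M}" "card I = CARD('n)" and x: "x \<noteq> 0" for I x
  proof -
    have "inj_on n I" "independent (n ` I)" using gen[OF I(1)] I(2) by simp_all
    then show ?thesis
      using independent_nonorthogonal[of "n ` I" x] x I(2) by (auto simp: card_image)
  qed
  then obtain \<delta> where \<delta>: "\<delta> > 0" "\<And>x. norm x = 1 \<Longrightarrow> card {j\<in>{..<M}. \<bar>n j \<bullet> x\<bar> \<le> \<delta>} < CARD('n)"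
    by (rule general_position_multiplicity[OF finite_lessThan]) blast+
  \<comment> \<open>Disjoint neighbourhoods of all the translated attracting points.\<close>
  define pt where "pt = (\<lambda>(g, j). PSL_action g (proj_point (A j *v a)))"
  have pt: "pt (g, j) = proj_point (rep g *v (A j *v a))" "rep g *v (A j *v a) \<noteq> 0"
    if "g \<in> F" "j < M" for g j
    using act_lift[of "rep g" "A j *v a"] act_lift(2)[OF A(1)[OF that(2)] a] rep[of g] that F(2)
    by (auto simp: pt_def)
  have "inj_on pt (F \<times> {..<M})"
  proof (rule inj_onI)
    fix p q assume p: "p \<in> F \<times> {..<M}" and q: "q \<in> F \<times> {..<M}" and eq: "pt p = pt q"
    obtain g i where gi: "p = (g, i)" "g \<in> F" "i < M" using p by auto
    obtain h j where hj: "q = (h, j)" "h \<in> F" "j < M" using q by auto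
    have "gram (rep g *v (A i *v a)) (rep h *v (A j *v a)) = 0"
      using eq pt[OF gi(2,3)] pt[OF hj(2,3)] by (simp add: gi hj proj_point_eq_iff)
    then have "(rep g, i) = (rep h, j)" using gram[of "rep g" "rep h" i j] gi hj by blast
    then show "p = q" using gi hj rep(2) F(2) by (metis Pair_inject subsetD)
  qed
  moreover have "finite (F \<times> {..<M})" using F by simp
  ultimately obtain W where W: "\<And>p. p \<in> F \<times> {..<M} \<Longrightarrow> open (W p) \<and> pt p \<in> W p"
    and W_disj: "disjoint_family_on W (F \<times> {..<M})"
    using separate_finite_family[of "F \<times> {..<M}" pt] by blast
  define Q where "Q j = U (j div 2) \<inter> (\<Inter>g\<in>F. PSL_action g -` W (g, j))" for j
  have Q_open: "open (Q j)" if "j < M" for j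
    unfolding Q_def using U W F that subgroup.mem_carrier[OF subgroup]
    by (intro open_Int open_INT ballI open_vimage continuous_on_PSL_action) auto
  have Q_mem: "proj_point (A j *v a) \<in> Q j" if "j < M" for j
    using A(2)[OF that] W that by (auto simp: Q_def V_def pt_def)
  have Q_act: "PSL_action g x \<in> W (g, j)" if "g \<in> F" "x \<in> Q j" for g j x
    using that by (auto simp: Q_def)
  define E where "E j = {v. v \<noteq> 0 \<and> proj_point v \<in> Q j}" for j
  have E_open: "open (E j)" if "j < M" for j
    using open_cone_preimage[OF Q_open[OF that]] by (simp add: E_def open_cone_def)
  define S where "S j = {x :: real ^ 'n. norm x = 1 \<and> \<delta> \<le> \<bar>n j \<bullet> x\<bar>}" for j
  have S_compact: "compact (S j)" for j
  proof -
    have "closed {x. \<delta> \<le> \<bar>n j \<bullet> x\<bar>}" by (intro closed_Collect_le continuous_intros)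
    then have "compact (sphere 0 1 \<inter> {x. \<delta> \<le> \<bar>n j \<bullet> x\<bar>})" by (intro compact_Int_closed) auto
    moreover have "S j = sphere 0 1 \<inter> {x. \<delta> \<le> \<bar>n j \<bullet> x\<bar>}" by (auto simp: S_def)
    ultimately show ?thesis by simp
  qed
  have contract: "\<forall>\<^sub>F s in sequentially. \<forall>x\<in>S j. (A i ** (\<alpha> s *\<^sub>R w s) ** matrix_inv (A j)) *v x \<in> E i"
    if ij: "i < M" "j < M" and w: "(\<lambda>s. \<alpha> s *\<^sub>R w s) \<longlonglongrightarrow> rank_one a (kk j)"
    for i j and w :: "nat \<Rightarrow> real ^ 'n ^ 'n"
  proof (rule eventually_maps_compact_into_open[OF _ S_compact E_open[OF ij(1)]])
    show "(\<lambda>s. A i ** (\<alpha> s *\<^sub>R w s) ** matrix_inv (A j)) \<longlonglongrightarrow> A i ** rank_one a (kk j) ** matrix_inv (A j)"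
      by (intro tendsto_matrix_mult tendsto_const w)
    fix x assume "x \<in> S j"
    then have "n j \<bullet> x \<noteq> 0" using \<delta>(1) by (auto simp: S_def)
    moreover have "A i *v a \<noteq> 0" using A(2)[OF ij(1)] by (auto simp: V_def)
    ultimately show "(A i ** rank_one a (kk j) ** matrix_inv (A j)) *v x \<in> E i"
      using Q_mem[OF ij(1)] by (simp add: mult_rank_one rank_one_mult E_def n_def proj_point_scaleR)
  qed
  have lim: "(\<lambda>s. \<alpha> s *\<^sub>R u s) \<longlonglongrightarrow> rank_one a (kk (2 * i + 1))"
    "(\<lambda>s. \<alpha> s *\<^sub>R matrix_inv (u s)) \<longlonglongrightarrow> rank_one a (kk (2 * i))" for i
    using u_lim u_inv_lim by (simp_all add: kk_def)
  have "\<forall>\<^sub>F s in sequentially. \<forall>i\<in>{1..m}.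
      (\<forall>x\<in>S (2 * i + 1). (A (2 * i) ** (\<alpha> s *\<^sub>R u s) ** matrix_inv (A (2 * i + 1))) *v x \<in> E (2 * i)) \<and>
      (\<forall>x\<in>S (2 * i). (A (2 * i + 1) ** (\<alpha> s *\<^sub>R matrix_inv (u s)) ** matrix_inv (A (2 * i))) *v x \<in> E (2 * i + 1))"
    by (intro eventually_ball_finite ballI eventually_conj contract lim) (auto simp: M_def)
  from eventually_happens'[OF sequentially_bot this] obtain s where
    s: "\<And>i x. i \<in> {1..m} \<Longrightarrow> x \<in> S (2 * i + 1) \<Longrightarrow>
        (A (2 * i) ** (\<alpha> s *\<^sub>R u s) ** matrix_inv (A (2 * i + 1))) *v x \<in> E (2 * i)"
    and s': "\<And>i x. i \<in> {1..m} \<Longrightarrow> x \<in> S (2 * i) \<Longrightarrow>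
        (A (2 * i + 1) ** (\<alpha> s *\<^sub>R matrix_inv (u s)) ** matrix_inv (A (2 * i))) *v x \<in> E (2 * i + 1)"
    by blast
  have idx: "2 * i < M" "2 * i + 1 < M" if "i \<in> {1..m}" for i
    using that by (auto simp: M_def)
  define T where "T i = A (2 * i) ** u s ** matrix_inv (A (2 * i + 1))" for i
  have T: "T i \<in> lifts" if "i \<in> {1..m}" for i
    unfolding T_def using idx[OF that] by (intro lift_mult lift_inv(1) A u)
  have T_inv: "matrix_inv (T i) = A (2 * i + 1) ** matrix_inv (u s) ** matrix_inv (A (2 * i))"
    if "i \<in> {1..m}" for i
  proof (rule matrix_inv_eqI)
    note inv = lift_inv(2)[OF A(1)] lift_inv(3)[OF A(1)] lift_inv(3)[OF u]
    have "T i ** (A (2 * i + 1) ** matrix_inv (u s) ** matrix_inv (A (2 * i)))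
      = A (2 * i) ** u s ** (matrix_inv (A (2 * i + 1)) ** A (2 * i + 1)) ** matrix_inv (u s) ** matrix_inv (A (2 * i))"
      by (simp only: T_def matrix_mul_assoc)
    also have "\<dots> = A (2 * i) ** (u s ** matrix_inv (u s)) ** matrix_inv (A (2 * i))"
      by (simp only: inv(1)[OF idx(2)[OF that]] matrix_mul_rid matrix_mul_assoc)
    also have "\<dots> = mat 1"
      by (simp only: inv(3) inv(2)[OF idx(1)[OF that]] matrix_mul_rid)
    finally show "T i ** (A (2 * i + 1) ** matrix_inv (u s) ** matrix_inv (A (2 * i))) = mat 1" .
  qed
  have scal: "PSL_action (class B) (proj_point x) \<in> Q i"
    if "B \<in> lifts" "x \<noteq> 0" "B = C ** w ** D" "(C ** (c *\<^sub>R w) ** D) *v x \<in> E i" for B C w D x c i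
  proof -
    have "C ** (c *\<^sub>R w) ** D = c *\<^sub>R B"
      by (simp add: that(3) matrix_scalar_ac flip: scalar_matrix_assoc)
    then have "c *\<^sub>R (B *v x) \<in> E i" using that(4) by (simp flip: scaleR_matrix_vector_assoc)
    then have "proj_point (B *v x) \<in> Q i"
      by (cases "c = 0") (auto simp: E_def proj_point_scaleR)
    then show ?thesis using act_lift(1)[OF that(1,2)] by simp
  qed
  have multiplicity: "card {i\<in>{1..m}. PSL_action (r i) x \<notin> Q (e i)} \<le> CARD('n)"
    if good: "\<And>i v. i \<in> {1..m} \<Longrightarrow> v \<in> S (d i) \<Longrightarrow> PSL_action (r i) (proj_point v) \<in> Q (e i)"
      and d: "inj_on d {1..m}" "\<And>i. i \<in> {1..m} \<Longrightarrow> d i < M" for r e d x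
  proof -
    obtain v0 where v0: "v0 \<noteq> 0" "x = proj_point v0" by (rule proj_point_cases)
    define v where "v = v0 /\<^sub>R norm v0"
    have v: "norm v = 1" "x = proj_point v" using v0 by (auto simp: v_def proj_point_scaleR)
    have "card {i\<in>{1..m}. PSL_action (r i) x \<notin> Q (e i)} \<le> card {j\<in>{..<M}. \<bar>n j \<bullet> v\<bar> \<le> \<delta>}"
    proof (rule card_inj_on_le)
      show "inj_on d {i\<in>{1..m}. PSL_action (r i) x \<notin> Q (e i)}"
        by (rule inj_on_subset[OF d(1)]) blast
      show "d ` {i\<in>{1..m}. PSL_action (r i) x \<notin> Q (e i)} \<subseteq> {j\<in>{..<M}. \<bar>n j \<bullet> v\<bar> \<le> \<delta>}"
      proof (rule image_subsetI)
        fix i assume "i \<in> {i\<in>{1..m}. PSL_action (r i) x \<notin> Q (e i)}"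
        then have i: "i \<in> {1..m}" "PSL_action (r i) x \<notin> Q (e i)" by blast+
        then have "v \<notin> S (d i)" using good v(2) by blast
        then show "d i \<in> {j\<in>{..<M}. \<bar>n j \<bullet> v\<bar> \<le> \<delta>}"
          using v(1) d(2)[OF i(1)] by (simp add: S_def)
      qed
    qed simp
    also have "\<dots> \<le> CARD('n)" using \<delta>(2)[OF v(1)] by simp
    finally show ?thesis .
  qed
  have S_nz: "v \<noteq> 0" if "v \<in> S j" for v j using that by (auto simp: S_def)
  show ?thesis
  proof (intro exI conjI)
    show "\<forall>i\<in>{1..m}. class (T i) \<in> \<Gamma> \<and> Q (2 * i) \<subseteq> U i \<and> Q (2 * i + 1) \<subseteq> U i"
      using lift_class[OF T] by (auto simp: Q_def)
    show "\<forall>x. card {i\<in>{1..m}. PSL_action (class (T i)) x \<notin> Q (2 * i)} \<le> CARD('n)"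
    proof (intro allI multiplicity)
      show "PSL_action (class (T i)) (proj_point v) \<in> Q (2 * i)"
        if i: "i \<in> {1..m}" and v: "v \<in> S (2 * i + 1)" for i v
        by (rule scal[OF T[OF i] S_nz[OF v] T_def s[OF i v]])
    qed (use idx in \<open>auto simp: inj_on_def\<close>)
    show "\<forall>x. card {i\<in>{1..m}. PSL_action (inv\<^bsub>PSL\<^esub> (class (T i))) x \<notin> Q (2 * i + 1)} \<le> CARD('n)"
    proof (intro allI multiplicity)
      show "PSL_action (inv\<^bsub>PSL\<^esub> (class (T i))) (proj_point v) \<in> Q (2 * i + 1)"
        if i: "i \<in> {1..m}" and v: "v \<in> S (2 * i)" for i v
        using scal[OF lift_inv(1)[OF T[OF i]] S_nz[OF v] T_inv[OF i] s'[OF i v]] lift_inv(4)[OF T[OF i]]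
        by simp
    qed (use idx in \<open>auto simp: inj_on_def\<close>)
    show "disjoint_family_on (case_sum (\<lambda>(g, i). PSL_action g ` Q (2 * i)) (\<lambda>(h, j). PSL_action h ` Q (2 * j + 1)))
        (F \<times> {1..m} <+> F \<times> {1..m})" (is "disjoint_family_on ?D ?I")
    proof -
      define \<iota> where "\<iota> = case_sum (\<lambda>(g :: (real ^ 'n ^ 'n) set, i :: nat). (g, 2 * i)) (\<lambda>(h, j). (h, 2 * j + 1))"
      have sub: "?D p \<subseteq> W (\<iota> p)" and mem: "\<iota> p \<in> F \<times> {..<M}" if "p \<in> ?I" for p
        using that idx Q_act by (auto simp: \<iota>_def)
      have inj: "p = q" if "p \<in> ?I" "q \<in> ?I" "\<iota> p = \<iota> q" for p q
        using that by (auto simp: \<iota>_def) presburger+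
      show ?thesis
        unfolding disjoint_family_on_def
      proof (intro ballI impI)
        fix p q assume pq: "p \<in> ?I" "q \<in> ?I" "p \<noteq> q"
        then have "\<iota> p \<noteq> \<iota> q" using inj by blast
        then have "W (\<iota> p) \<inter> W (\<iota> q) = {}"
          using disjoint_family_onD[OF W_disj mem[OF pq(1)] mem[OF pq(2)]] by blast
        then show "?D p \<inter> ?D q = {}" using sub[OF pq(1)] sub[OF pq(2)] by blast
      qed
    qed
  qed
qed

end

theorem theorem3p4:
  fixes \<Gamma> :: "(real ^ 'n::finite ^ 'n) set set"
    and \<phi> :: "('n rproj \<Rightarrow>\<^sub>C complex) \<Rightarrow> complex"
  assumes "CARD('n) \<ge> 2"
    and "subgroup \<Gamma> PSL"
    and "zariski_dense_PSL \<Gamma>"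
    and "minimal_action (PSL\<lparr>carrier := \<Gamma>\<rparr>) PSL_action"
    and "cstar_state \<phi>"
  shows "PHP_property (PSL\<lparr>carrier := \<Gamma>\<rparr>)
           (induced_action (PSL\<lparr>carrier := \<Gamma>\<rparr>) PSL_action) \<phi>"
proof -
  interpret minimal_zariski_dense_subgroup \<Gamma>
    by (intro minimal_zariski_dense_subgroup.intro zariski_dense_subgroup.intro PSL_subgroup.intro
        zariski_dense_subgroup_axioms.intro minimal_zariski_dense_subgroup_axioms.intro assms)
  interpret PSL: group "PSL :: (real ^ 'n ^ 'n) set monoid" by (rule group_PSL)
  have \<Gamma>: "g \<in> carrier PSL" if "g \<in> \<Gamma>" for g
    using that subgroup.mem_carrier[OF assms(2)] by blast
  interpret G: continuous_action "PSL\<lparr>carrier := \<Gamma>\<rparr>" PSL_action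
  proof (intro continuous_action.intro continuous_action_axioms.intro)
    show "group (PSL\<lparr>carrier := \<Gamma>\<rparr>)" by (rule PSL.subgroup_imp_group[OF assms(2)])
  qed (use \<Gamma> in \<open>simp_all add: continuous_on_PSL_action PSL_action_one PSL_action_mult\<close>)
  have inv: "inv\<^bsub>PSL\<lparr>carrier := \<Gamma>\<rparr>\<^esub> g = inv\<^bsub>PSL\<^esub> g" if "g \<in> \<Gamma>" for g
    using PSL.m_inv_consistent[OF assms(2) that] .
  show ?thesis
  proof (rule G.PHP_criterion[OF assms(5)])
    fix F :: "(real ^ 'n ^ 'n) set set" and m and U :: "nat \<Rightarrow> 'n rproj set"
    assume F: "finite F" "F \<subseteq> carrier (PSL\<lparr>carrier := \<Gamma>\<rparr>)" and U: "\<And>i. open (U i) \<and> U i \<noteq> {}"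
    have "F \<subseteq> \<Gamma>" using F(2) by simp
    from exists_contracting_family[where m = m and U = U, OF assms(1) F(1) this U]
    obtain t A B where *: "(\<forall>i\<in>{1..m}. t i \<in> \<Gamma> \<and> A i \<subseteq> U i \<and> B i \<subseteq> U i) \<and>
      disjoint_family_on (case_sum (\<lambda>(g, i). PSL_action g ` A i) (\<lambda>(h, j). PSL_action h ` B j))
        (F \<times> {1..m} <+> F \<times> {1..m}) \<and>
      (\<forall>x. card {i\<in>{1..m}. PSL_action (t i) x \<notin> A i} \<le> CARD('n)) \<and>
      (\<forall>x. card {i\<in>{1..m}. PSL_action (inv\<^bsub>PSL\<^esub> (t i)) x \<notin> B i} \<le> CARD('n))"
      by (elim exE) (rule that)
    have "{i\<in>{1..m}. PSL_action (inv\<^bsub>PSL\<lparr>carrier := \<Gamma>\<rparr>\<^esub> (t i)) x \<notin> B i}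
        = {i\<in>{1..m}. PSL_action (inv\<^bsub>PSL\<^esub> (t i)) x \<notin> B i}" for x
      using * inv by (intro Collect_cong conj_cong refl) simp
    with * show "\<exists>t A B. (\<forall>i\<in>{1..m}. t i \<in> carrier (PSL\<lparr>carrier := \<Gamma>\<rparr>) \<and> A i \<subseteq> U i \<and> B i \<subseteq> U i) \<and>
      disjoint_family_on (case_sum (\<lambda>(g, i). PSL_action g ` A i) (\<lambda>(h, j). PSL_action h ` B j))
        (F \<times> {1..m} <+> F \<times> {1..m}) \<and>
      (\<forall>x. card {i\<in>{1..m}. PSL_action (t i) x \<notin> A i} \<le> CARD('n)) \<and>
      (\<forall>x. card {i\<in>{1..m}. PSL_action (inv\<^bsub>PSL\<lparr>carrier := \<Gamma>\<rparr>\<^esub> (t i)) x \<notin> B i} \<le> CARD('n))"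
      by (intro exI[of _ t] exI[of _ A] exI[of _ B]) simp
  qed
qed

end
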